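(* Consider the half-wave equation on $\mathbb{T}$, $$ i\dot\psi=|D_x|\psi+V(t,x,D_x)\psi,\qquad x\in\mathbb{T}.$$ There exist a pseudodifferential operator of order $0$, $V\in C^\infty(\mathbb{T},\mathcal{A}_0)$, with $V(t)$ self-adjoint for every $t$, and, for any $r\in\mathbb{N}$, a constant $C_r>0$ and a solution $\psi(t)$ of this equation such that, for any $t\ge0$, $\psi(t)\in H^r(\mathbb{T})$, and $$\|\psi(t)\|_{H^r(\mathbb{T})}\ \ge\ C_r\,t^r\qquad\text{for } t\text{ large enough}.$$
   Context: $\mathbb{T}=\mathbb{R}/2\pi\mathbb{Z}$, $\mathbb{N}_0=\{0,1,2,\dots\}$, $\langle j\rangle=(1+j^2)^{1/2}$. $H^r(\mathbb{T})=\mathrm{Dom}((1-\partial_{xx})^{r/2})$ is the classical Sobolev space. The Fourier coefficients are $\psi_j=\frac1{2\pi}\int_{\mathbb{T}}\psi(x)e^{-ijx}\,dx$, so that $\psi=\sum_{j\in\mathbb{Z}}\psi_je^{ijx}$, and $|D_x|\psi=\sum_{j\in\mathbb{Z}}|j|\,\psi_j\,e^{ijx}$. Symbols: for $f:\mathbb{T}\times\mathbb{Z}\to\mathbb{R}$ put $\triangle f(x,j)=f(x,j+1)-f(x,j)$. For $\rho\in\mathbb{R}$, $S^\rho_{\mathrm{to}}$ is the set of $f:\mathbb{T}\times\mathbb{Z}\to\mathbb{R}$ such that $x\mapsto f(x,j)$ is smooth for each $j\in\mathbb{Z}$ and for all $\alpha,\beta\in\mathbb{N}_0$ there is $C_{\alpha,\beta}>0$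 with $|\partial_x^\alpha\triangle^\beta f(x,j)|\le C_{\alpha,\beta}\langle j\rangle^{\rho-\beta}$. It is a Fréchet space with seminorms $\wp^\rho_k(f)=\sum_{\alpha+\beta\le k}\sup_{(x,j)\in\mathbb{T}\times\mathbb{Z}}\langle j\rangle^{-\rho+\beta}|\partial_x^\alpha\triangle^\beta f(x,j)|$, $k\in\mathbb{N}_0$. Operators: the quantization of $f$ is $(f(x,D_x)\psi)(x)=\sum_{j\in\mathbb{Z}}f(x,j)\,\psi_j\,e^{ijx}$. $\mathcal{A}_\rho$ is the set of operators $F=f(x,D_x)$ with $f\in S^\rho_{\mathrm{to}}$ (pseudodifferential operators of order $\rho$), with the Fréchet structure given by the seminorms of the symbols. $C^\infty(\mathbb{T},\mathcal{A}_0)$ is the space of smooth $2\pi$-periodic maps $t\mapsto V(t)=V(t,x,D_x)\in\mathcal{A}_0$. *)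

theory Defs
  imports "HOL-Analysis.Analysis"
begin

text \<open>
  Functions on \<open>\<real> / 2\<pi>\<int>\<close> are represented by \<open>2\<pi>\<close>-periodic functions on the reals, and elements
  of \<open>L\<^sup>2\<close> by representatives (never identified: equations between elements of \<open>L\<^sup>2\<close> are
  stated almost everywhere).  The circle carries the normalised measure \<open>dx / 2\<pi>\<close>, so that the
  exponentials \<open>e\<^sup>i\<^sup>j\<^sup>x\<close> are orthonormal.
\<close>

definition L2 :: "(real \<Rightarrow> complex) set" where
  "L2 = {\<psi>. (\<forall>x. \<psi> (x + 2 * pi) = \<psi> x) \<and> \<psi> \<in> borel_measurable lebesgue \<and>
              set_integrable lebesgue {0..2 * pi} (\<lambda>x. (cmod (\<psi> x))\<^sup>2)}"

definition L2_inner :: "(real \<Rightarrow> complex) \<Rightarrow> (real \<Rightarrow> complex) \<Rightarrow> complex" where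
  "L2_inner \<psi> \<phi> = (1 / (2 * pi)) * (LINT x:{0..2 * pi}|lebesgue. \<psi> x * cnj (\<phi> x))"

definition L2_norm :: "(real \<Rightarrow> complex) \<Rightarrow> real" where
  "L2_norm \<psi> = sqrt ((1 / (2 * pi)) * (LINT x:{0..2 * pi}|lebesgue. (cmod (\<psi> x))\<^sup>2))"

definition fourier_coeff :: "(real \<Rightarrow> complex) \<Rightarrow> int \<Rightarrow> complex" where
  "fourier_coeff \<psi> j =
     (1 / (2 * pi)) * (LINT x:{0..2 * pi}|lebesgue. \<psi> x * cis (- (of_int j * x)))"

definition japanese :: "int \<Rightarrow> real" where
  "japanese j = sqrt (1 + (of_int j)\<^sup>2)"

text \<open>
  The operator \<open>(1 - \<partial>\<^sub>x\<^sub>x)\<^sup>r\<^sup>/\<^sup>2\<close> multiplies the \<open>j\<close>-th Fourier coefficient by \<open>\<langle>j\<rangle>\<^sup>r\<close>; \<open>sobolev r\<close> is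
  its domain in \<open>L\<^sup>2\<close> and \<open>sobolev_norm r \<psi>\<close> the \<open>L\<^sup>2\<close> norm of the image of \<open>\<psi>\<close>, computed by
  Parseval.  Meant for \<open>r \<ge> 0\<close> only, since spaces of negative order are not contained in \<open>L\<^sup>2\<close>.
\<close>

definition sobolev :: "real \<Rightarrow> (real \<Rightarrow> complex) set" where
  "sobolev r = {\<psi> \<in> L2.
     (\<lambda>j. japanese j powr (2 * r) * (cmod (fourier_coeff \<psi> j))\<^sup>2) summable_on UNIV}"

definition sobolev_norm :: "real \<Rightarrow> (real \<Rightarrow> complex) \<Rightarrow> real" where
  "sobolev_norm r \<psi> =
     sqrt (\<Sum>\<^sub>\<infinity>j\<in>UNIV. japanese j powr (2 * r) * (cmod (fourier_coeff \<psi> j))\<^sup>2)"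

type_synonym symb = "real \<Rightarrow> int \<Rightarrow> real"

definition symb_diff :: "symb \<Rightarrow> symb" where
  "symb_diff f = (\<lambda>x j. f x (j + 1) - f x j)"

definition symb_deriv :: "nat \<Rightarrow> nat \<Rightarrow> symb \<Rightarrow> symb" where
  "symb_deriv \<alpha> \<beta> f = (\<lambda>x j. (deriv ^^ \<alpha>) (\<lambda>y. (symb_diff ^^ \<beta>) f y j) x)"

definition symbol_class :: "real \<Rightarrow> symb set" where
  "symbol_class \<rho> = {f.
     (\<forall>x j. f (x + 2 * pi) j = f x j) \<and>
     (\<forall>j n x. (deriv ^^ n) (\<lambda>y. f y j) differentiable (at x)) \<and>
     (\<forall>\<alpha> \<beta>. \<exists>C>0. \<forall>x j. \<bar>symb_deriv \<alpha> \<beta> f x j\<bar> \<le> C * japanese j powr (\<rho> - real \<beta>))}"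

definition symbol_seminorm :: "real \<Rightarrow> nat \<Rightarrow> symb \<Rightarrow> real" where
  "symbol_seminorm \<rho> k f =
     (\<Sum>(\<alpha>, \<beta>)\<in>{(\<alpha>, \<beta>). \<alpha> + \<beta> \<le> k}.
        SUP (x, j)\<in>UNIV. japanese j powr (- \<rho> + real \<beta>) * \<bar>symb_deriv \<alpha> \<beta> f x j\<bar>)"

text \<open>
  Here \<open>w n\<close> is the \<open>n\<close>-th derivative of the curve \<open>f\<close>, each derivative being the limit of
  difference quotients in the Frechet topology of \<open>symbol_class \<rho>\<close>.
\<close>

definition smooth_symbol_curve :: "real \<Rightarrow> (real \<Rightarrow> symb) \<Rightarrow> bool" where
  "smooth_symbol_curve \<rho> f \<longleftrightarrow>
     (\<forall>t. f (t + 2 * pi) = f t) \<and>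
     (\<exists>w :: nat \<Rightarrow> real \<Rightarrow> symb. w 0 = f \<and> (\<forall>n t. w n t \<in> symbol_class \<rho>) \<and>
        (\<forall>n t k. ((\<lambda>h. symbol_seminorm \<rho> k
                     (\<lambda>x j. (w n (t + h) x j - w n t x j) / h - w (Suc n) t x j))
                  \<longlongrightarrow> 0) (at 0)))"

text \<open>
  A (possibly unbounded) operator on \<open>L\<^sup>2\<close> is represented by its graph, which is closed under
  changing functions on null sets.  The series defining the quantization is taken in \<open>L\<^sup>2\<close>; for a
  symbol of order \<open>0\<close> it converges for every element of \<open>L\<^sup>2\<close>, but in general not pointwise.
\<close>

type_synonym L2_op = "((real \<Rightarrow> complex) \<times> (real \<Rightarrow> complex)) set"

definition quantization :: "symb \<Rightarrow> L2_op" where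
  "quantization f = {(\<psi>, g). \<psi> \<in> L2 \<and> g \<in> L2 \<and>
     ((\<lambda>F. L2_norm (\<lambda>x. g x - (\<Sum>j\<in>F. of_real (f x j) * fourier_coeff \<psi> j * cis (of_int j * x))))
        \<longlongrightarrow> 0) (finite_subsets_at_top UNIV)}"

definition pseudo_diff_ops :: "real \<Rightarrow> L2_op set" where
  "pseudo_diff_ops \<rho> = quantization ` symbol_class \<rho>"

definition smooth_pseudo_diff :: "real \<Rightarrow> (real \<Rightarrow> L2_op) set" where
  "smooth_pseudo_diff \<rho> = {V. (\<forall>t. V t \<in> pseudo_diff_ops \<rho>) \<and>
     (\<exists>f. smooth_symbol_curve \<rho> f \<and> (\<forall>t. V t = quantization (f t)))}"

text \<open>
  The right-hand side describes the graph of the adjoint.  A graph equal to its adjoint and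
  single-valued up to null sets is automatically densely defined.
\<close>

definition self_adjoint_op :: "L2_op \<Rightarrow> bool" where
  "self_adjoint_op A \<longleftrightarrow>
     A = {(\<phi>, \<eta>). \<phi> \<in> L2 \<and> \<eta> \<in> L2 \<and> (\<forall>(\<psi>, g)\<in>A. L2_inner g \<phi> = L2_inner \<psi> \<eta>)}"

definition abs_D :: L2_op where
  "abs_D = quantization (\<lambda>x j. \<bar>of_int j\<bar>)"

text \<open>
  Solutions, defined for all real times, of \<open>i \<psi>' = |D\<^sub>x| \<psi> + V(t) \<psi>\<close> in the sense usual for
  \<open>H\<^sup>r\<close> data: continuous with values in \<open>H\<^sup>r\<close> and differentiable with values in \<open>H\<^sup>r\<^sup>-\<^sup>1\<close>.
  Meant for \<open>r \<ge> 1\<close>.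
\<close>

definition half_wave_solution ::
    "real \<Rightarrow> (real \<Rightarrow> L2_op) \<Rightarrow> (real \<Rightarrow> real \<Rightarrow> complex) \<Rightarrow> bool" where
  "half_wave_solution r V \<psi> \<longleftrightarrow>
     (\<forall>t. \<psi> t \<in> sobolev r) \<and>
     (\<forall>t. ((\<lambda>s. sobolev_norm r (\<lambda>x. \<psi> s x - \<psi> t x)) \<longlongrightarrow> 0) (at t)) \<and>
     (\<forall>t. \<exists>\<psi>' u v. \<psi>' \<in> sobolev (r - 1) \<and>
        ((\<lambda>h. sobolev_norm (r - 1) (\<lambda>x. (\<psi> (t + h) x - \<psi> t x) / of_real h - \<psi>' x))
           \<longlongrightarrow> 0) (at 0) \<and>
        (\<psi> t, u) \<in> abs_D \<and> (\<psi> t, v) \<in> V t \<and>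
        (AE x in lebesgue. \<i> * \<psi>' x = u x + v x))"

end

theory Submission
  imports Defs
begin

text \<open>
  The potential is a wave travelling with the half-wave flow: \<open>V(t)\<close> is multiplication by
  \<open>cos (x - t) / 2\<close>. Its symbol is real, bounded and independent of the frequency.

  The idea. On frequencies \<open>j \<ge> 0\<close> the operator \<open>|D|\<close> generates translations of speed one, so
  the wave is in resonance with the flow and keeps pushing the solution to higher frequencies. To see
  this, pass to the moving frame: if \<open>c\<^sub>j(t)\<close> are the Fourier coefficients of a solution, then
  \<open>a\<^sub>j = e\<^sup>i\<^sup>j\<^sup>t c\<^sub>j\<close> solves the autonomous lattice equation \<open>i a' = ham a\<close> with
  \<open>(ham a)\<^sub>j = (|j| - j) a\<^sub>j + (a\<^sub>j\<^sub>-\<^sub>1 + a\<^sub>j\<^sub>+\<^sub>1) / 4\<close> (\<open>half_wave_solution_of_lattice_flow\<close>).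
  This is a quantum particle on the integers that moves freely on \<open>j \<ge> 0\<close> and meets a steep
  barrier on \<open>j < 0\<close>. It has to escape to the right at positive speed, so \<open>j\<close> is of size \<open>t\<close> and the
  norm in \<open>H\<^sup>r\<close> is of size \<open>t\<^sup>r\<close>.

  Escape is proved by a virial argument on the second moment \<open>spread a = \<Sum> (j + 1/2)\<^sup>2 |a\<^sub>j|\<^sup>2\<close>.
  Its second derivative is the squared velocity plus the work of the barrier (\<open>spread_deriv\<close>,
  \<open>momentum_deriv\<close>). Two quantities are conserved, \<open>N = \<parallel>a\<parallel>\<^sup>2\<close> and, since \<open>ham a\<close> is again a
  solution, \<open>B = \<parallel>ham a\<parallel>\<^sup>2\<close>. When \<open>B\<close> is small compared with \<open>N\<close>, the state can neither sit inside
  the barrier nor be slow, and the second derivative is at least \<open>N / 16 - 24 B\<close>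
  (\<open>acceleration_lower_bound\<close>). The truncated plane wave \<open>i\<^sup>j\<close>, \<open>1 \<le> j \<le> 128\<close>, makes this number
  equal to \<open>2\<close>; hence \<open>spread\<close> grows quadratically (\<open>ballistic_flow_exists\<close>), and by convexity the
  higher moments grow like the corresponding powers (\<open>higher_moment_lower_bound\<close>). The same
  solution serves for all \<open>r\<close>.

  Two ingredients are of a general kind. Self-adjointness of the graph of \<open>V(t)\<close> requires that the
  quantization of a multiplication symbol be defined on all of \<open>L\<^sup>2\<close>, that is, completeness of the
  exponentials (\<open>fourier_series_L2_tendsto\<close>, \<open>quantization_multiplication\<close>,
  \<open>self_adjoint_multiplication\<close>). Global solutions of the lattice equation with
  exponentially decaying coefficients come from a Dyson series in the interaction picture
  (\<open>lattice_system_solvable\<close>, \<open>lattice_flow_exists\<close>), so that all sums converge and may be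
  differentiated termwise.
\<close>

section \<open>Trigonometric polynomials\<close>

inductive trig_poly :: "(real \<Rightarrow> complex) \<Rightarrow> bool" where
  monomial: "trig_poly (\<lambda>x. c * cis (of_int j * x))"
| add: "trig_poly p \<Longrightarrow> trig_poly q \<Longrightarrow> trig_poly (\<lambda>x. p x + q x)"

lemma trig_poly_mult_monomial:
  "trig_poly q \<Longrightarrow> trig_poly (\<lambda>x. c * cis (of_int j * x) * q x)"
proof (induction rule: trig_poly.induct)
  case (monomial d k)
  have "(\<lambda>x. c * cis (of_int j * x) * (d * cis (of_int k * x))) =
        (\<lambda>x. (c * d) * cis (of_int (j + k) * x))"
    by (auto simp: fun_eq_iff cis_mult ring_distribs)
  then show ?case by (simp only: trig_poly.monomial)
next
  case (add p q)
  then show ?case using trig_poly.add by (fastforce simp: ring_distribs)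
qed

lemma trig_poly_mult:
  assumes "trig_poly p" "trig_poly q"
  shows "trig_poly (\<lambda>x. p x * q x)"
  using assms(1)
proof (induction rule: trig_poly.induct)
  case (monomial c j)
  then show ?case using trig_poly_mult_monomial[OF assms(2)] by simp
next
  case (add p p')
  then show ?case using trig_poly.add by (fastforce simp: ring_distribs)
qed

lemma trig_poly_finite_sum:
  "trig_poly p \<Longrightarrow> \<exists>F d. finite F \<and> p = (\<lambda>x. \<Sum>j\<in>F. d j * cis (of_int j * x))"
proof (induction rule: trig_poly.induct)
  case (monomial c j)
  show ?case by (rule exI[of _ "{j}"], rule exI[of _ "\<lambda>_. c"]) simp
next
  case (add p q)
  then obtain F d G e where F: "finite F" "p = (\<lambda>x. \<Sum>j\<in>F. d j * cis (of_int j * x))"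
    and G: "finite G" "q = (\<lambda>x. \<Sum>j\<in>G. e j * cis (of_int j * x))" by auto
  define d' where "d' j = (if j \<in> F then d j else 0)" for j
  define e' where "e' j = (if j \<in> G then e j else 0)" for j
  have "p x = (\<Sum>j\<in>F \<union> G. d' j * cis (of_int j * x))" for x
    unfolding F(2) by (rule sum.mono_neutral_cong_left) (use F G in \<open>auto simp: d'_def\<close>)
  moreover have "q x = (\<Sum>j\<in>F \<union> G. e' j * cis (of_int j * x))" for x
    unfolding G(2) by (rule sum.mono_neutral_cong_left) (use F G in \<open>auto simp: e'_def\<close>)
  ultimately have "(\<lambda>x. p x + q x) = (\<lambda>x. \<Sum>j\<in>F \<union> G. (d' j + e' j) * cis (of_int j * x))"
    by (simp add: ring_distribs sum.distrib)
  then show ?case using F G by (intro exI[of _ "F \<union> G"] exI[of _ "\<lambda>j. d' j + e' j"]) simp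
qed

text \<open>
  A real-linear function of \<open>cis x\<close> is a combination of \<open>cos x\<close> and \<open>sin x\<close>, hence of
  \<open>cis x\<close> and \<open>cis (- x)\<close>; products of trigonometric polynomials are trigonometric polynomials.
  This transports the Stone-Weierstrass theorem for polynomials on the unit circle in the plane
  to the exponentials.
\<close>

lemma trig_poly_real_polynomial:
  fixes g :: "complex \<Rightarrow> real"
  shows "real_polynomial_function g \<Longrightarrow> trig_poly (\<lambda>x. complex_of_real (g (cis x)))"
proof (induction rule: real_polynomial_function.induct)
  case (linear f)
  interpret bounded_linear f by fact
  have 1: "f (cis x) = cos x * f 1 + sin x * f \<i>" for x
  proof -
    have "cis x = cos x *\<^sub>R 1 + sin x *\<^sub>R \<i>" by (simp add: complex_eq_iff)
    then show ?thesis by (simp only: add scaleR) simp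
  qed
  have "complex_of_real (f (cis x)) = (f 1 / 2 - \<i> * f \<i> / 2) * cis (of_int 1 * x)
        + (f 1 / 2 + \<i> * f \<i> / 2) * cis (of_int (-1) * x)" for x
    unfolding 1 by (simp add: complex_eq_iff)
  then show ?case using trig_poly.intros by presburger
next
  case (const c)
  show ?case using trig_poly.monomial[of "of_real c" 0] by simp
next
  case (add f g)
  then show ?case using trig_poly.add by fastforce
next
  case (mult f g)
  then show ?case using trig_poly_mult by fastforce
qed

lemma trig_poly_dense_uniform:
  fixes H :: "complex \<Rightarrow> complex"
  assumes "continuous_on (sphere 0 1) H" "e > 0"
  shows "\<exists>p. trig_poly p \<and> (\<forall>x. cmod (H (cis x) - p x) < e)"
proof -
  obtain g where g: "polynomial_function g" "\<forall>z\<in>sphere 0 1. cmod (H z - g z) < e"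
    using Stone_Weierstrass_polynomial_function[OF compact_sphere assms] by blast
  have "real_polynomial_function (\<lambda>z. Re (g z))" "real_polynomial_function (\<lambda>z. Im (g z))"
    using g(1) unfolding polynomial_function_def o_def
    using bounded_linear_Re bounded_linear_Im by blast+
  then have "trig_poly (\<lambda>x. complex_of_real (Re (g (cis x))))"
    "trig_poly (\<lambda>x. complex_of_real (Im (g (cis x))))"
    using trig_poly_real_polynomial by blast+
  then have "trig_poly (\<lambda>x. complex_of_real (Re (g (cis x))) +
               (\<i> * cis (of_int 0 * x)) * complex_of_real (Im (g (cis x))))"
    by (intro trig_poly.add trig_poly_mult_monomial)
  moreover have "(\<lambda>x. complex_of_real (Re (g (cis x))) +
      (\<i> * cis (of_int 0 * x)) * complex_of_real (Im (g (cis x)))) = (\<lambda>x. g (cis x))"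
    by (auto simp: fun_eq_iff complex_eq_iff)
  ultimately have "trig_poly (\<lambda>x. g (cis x))" by (simp only:)
  then show ?thesis using g(2) by (intro exI[of _ "\<lambda>x. g (cis x)"]) auto
qed

section \<open>Fourier coefficients of square-integrable functions\<close>

abbreviation circ :: "real measure" where "circ \<equiv> lebesgue_on {0..2 * pi}"

lemma set_integral_circ:
  fixes f :: "real \<Rightarrow> 'b::{banach, second_countable_topology}"
  shows "(LINT x:{0..2 * pi}|lebesgue. f x) = integral\<^sup>L circ f"
  unfolding set_lebesgue_integral_def by (subst integral_restrict_space) auto

lemma set_integrable_circ:
  fixes f :: "real \<Rightarrow> 'b::{banach, second_countable_topology}"
  shows "set_integrable lebesgue {0..2 * pi} f \<longleftrightarrow> integrable circ f"
  unfolding set_integrable_def by (subst integrable_restrict_space) auto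

lemma finite_measure_circ: "finite_measure circ"
  by (rule finite_measure_lebesgue_on) auto

lemma measure_circ: "measure circ (space circ) = 2 * pi"
  by (simp add: measure_restrict_space)

lemma integral_circ_const: "integral\<^sup>L circ (\<lambda>x. c::'b::{banach, second_countable_topology}) = (2 * pi) *\<^sub>R c"
  using measure_circ by (simp add: lebesgue_integral_const)

lemma integrable_circ_const [simp]: "integrable circ (\<lambda>x. c::'b::{banach, second_countable_topology})"
  using finite_measure.integrable_const[OF finite_measure_circ] .

lemma integrable_circ_bounded:
  fixes f :: "real \<Rightarrow> 'b::{banach, second_countable_topology}"
  assumes "f \<in> borel_measurable circ" "\<And>x. norm (f x) \<le> B"
  shows "integrable circ f"
  by (rule finite_measure.integrable_const_bound[OF finite_measure_circ]) (use assms in auto)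

lemma L2_iff:
  "\<psi> \<in> L2 \<longleftrightarrow> (\<forall>x. \<psi> (x + 2 * pi) = \<psi> x) \<and> \<psi> \<in> borel_measurable lebesgue \<and>
      integrable circ (\<lambda>x. (cmod (\<psi> x))\<^sup>2)"
  unfolding L2_def set_integrable_circ by simp

lemma fourier_coeff_circ:
  "fourier_coeff \<psi> j = (1 / (2 * pi)) * integral\<^sup>L circ (\<lambda>x. \<psi> x * cis (- (of_int j * x)))"
  unfolding fourier_coeff_def set_integral_circ by simp

lemma L2_inner_circ: "L2_inner \<psi> \<phi> = (1 / (2 * pi)) * integral\<^sup>L circ (\<lambda>x. \<psi> x * cnj (\<phi> x))"
  unfolding L2_inner_def set_integral_circ by simp

lemma L2_norm_sq: "(L2_norm \<psi>)\<^sup>2 = (1 / (2 * pi)) * integral\<^sup>L circ (\<lambda>x. (cmod (\<psi> x))\<^sup>2)"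
proof -
  have "0 \<le> (1 / (2 * pi)) * integral\<^sup>L circ (\<lambda>x. (cmod (\<psi> x))\<^sup>2)"
    by (intro mult_nonneg_nonneg Bochner_Integration.integral_nonneg) auto
  then show ?thesis unfolding L2_norm_def set_integral_circ by (rule real_sqrt_pow2)
qed

lemma L2_norm_nonneg: "0 \<le> L2_norm \<psi>"
  unfolding L2_norm_def set_integral_circ
  by (intro real_sqrt_ge_zero mult_nonneg_nonneg Bochner_Integration.integral_nonneg) auto

lemma L2_measurable_circ: "\<psi> \<in> L2 \<Longrightarrow> \<psi> \<in> borel_measurable circ"
  unfolding L2_iff by (simp add: measurable_restrict_space1)

lemma L2_integrable_sq: "\<psi> \<in> L2 \<Longrightarrow> integrable circ (\<lambda>x. (cmod (\<psi> x))\<^sup>2)"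
  unfolding L2_iff by simp

lemma L2I_bounded:
  assumes "\<And>x. \<psi> (x + 2 * pi) = \<psi> x" "\<psi> \<in> borel_measurable lebesgue" "\<And>x. cmod (\<psi> x) \<le> B"
  shows "\<psi> \<in> L2"
proof -
  have "\<psi> \<in> borel_measurable circ" using assms(2) by (simp add: measurable_restrict_space1)
  then have "integrable circ (\<lambda>x. (cmod (\<psi> x))\<^sup>2)"
    by (intro integrable_circ_bounded[of _ "B\<^sup>2"]) (use assms(3) in \<open>auto intro: power_mono\<close>)
  then show ?thesis using assms unfolding L2_iff by auto
qed

lemma L2_mult_bounded:
  assumes "\<psi> \<in> L2" "\<And>x. m (x + 2 * pi) = m x" "m \<in> borel_measurable lebesgue" "\<And>x. cmod (m x) \<le> B"
  shows "(\<lambda>x. m x * \<psi> x) \<in> L2"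
proof -
  have m: "m \<in> borel_measurable circ" using assms(3) by (simp add: measurable_restrict_space1)
  have "integrable circ (\<lambda>x. (cmod (m x * \<psi> x))\<^sup>2)"
  proof (rule Bochner_Integration.integrable_bound)
    show "integrable circ (\<lambda>x. B\<^sup>2 * (cmod (\<psi> x))\<^sup>2)" using L2_integrable_sq[OF assms(1)] by simp
    show "(\<lambda>x. (cmod (m x * \<psi> x))\<^sup>2) \<in> borel_measurable circ"
      using m L2_measurable_circ[OF assms(1)] by measurable
    show "AE x in circ. norm ((cmod (m x * \<psi> x))\<^sup>2) \<le> norm (B\<^sup>2 * (cmod (\<psi> x))\<^sup>2)"
      using assms(4) by (auto simp: norm_mult power_mult_distrib intro!: mult_right_mono power_mono)
  qed
  then show ?thesis using assms(1-3) unfolding L2_iff by auto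
qed

lemma norm_add_sq_le: "(norm (x + y))\<^sup>2 \<le> 2 * (norm x)\<^sup>2 + 2 * (norm (y::'a::real_normed_vector))\<^sup>2"
proof -
  have "(norm (x + y))\<^sup>2 \<le> (norm x + norm y)\<^sup>2"
    by (intro power_mono norm_triangle_ineq) auto
  also have "\<dots> \<le> 2 * (norm x)\<^sup>2 + 2 * (norm y)\<^sup>2"
    using sum_squares_bound[of "norm x" "norm y"] by (simp add: power2_sum)
  finally show ?thesis .
qed

lemma L2_add:
  assumes "\<psi> \<in> L2" "\<phi> \<in> L2"
  shows "(\<lambda>x. \<psi> x + \<phi> x) \<in> L2"
proof -
  have "integrable circ (\<lambda>x. (cmod (\<psi> x + \<phi> x))\<^sup>2)"
  proof (rule Bochner_Integration.integrable_bound)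
    show "integrable circ (\<lambda>x. 2 * (cmod (\<psi> x))\<^sup>2 + 2 * (cmod (\<phi> x))\<^sup>2)"
      using assms[THEN L2_integrable_sq] by simp
    show "(\<lambda>x. (cmod (\<psi> x + \<phi> x))\<^sup>2) \<in> borel_measurable circ"
      using assms[THEN L2_measurable_circ] by measurable
  qed (use norm_add_sq_le in auto)
  then show ?thesis using assms unfolding L2_iff by auto
qed

lemma L2_scale: "\<psi> \<in> L2 \<Longrightarrow> (\<lambda>x. c * \<psi> x) \<in> L2"
  by (rule L2_mult_bounded[where B="cmod c"]) auto

lemma L2_diff: "\<psi> \<in> L2 \<Longrightarrow> \<phi> \<in> L2 \<Longrightarrow> (\<lambda>x. \<psi> x - \<phi> x) \<in> L2"
  using L2_add[OF _ L2_scale[of \<phi> "-1"]] by simp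

lemma cis_periodic: "cis (of_int j * (x + 2 * pi)) = cis (of_int j * x)"
proof -
  have "cis (of_int j * (2 * pi)) = 1"
    using cis_multiple_2pi[of "of_int j"] by (simp add: mult.commute)
  then show ?thesis by (simp only: distrib_left cis_mult[symmetric]) simp
qed

lemma continuous_on_imp_lebesgue: "continuous_on UNIV f \<Longrightarrow> f \<in> borel_measurable lebesgue"
  using continuous_imp_measurable_on_sets_lebesgue[of UNIV f] by (simp add: lebesgue_on_UNIV_eq)

lemma L2_cis: "(\<lambda>x. c * cis (of_int j * x)) \<in> L2"
  by (rule L2I_bounded[where B="cmod c"])
     (auto simp: cis_periodic norm_mult intro!: continuous_on_imp_lebesgue continuous_intros)

lemma L2_zero: "(\<lambda>x. 0) \<in> L2"
  by (rule L2I_bounded[where B=0]) auto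

lemma L2_sum: "(\<And>j. j \<in> F \<Longrightarrow> f j \<in> L2) \<Longrightarrow> (\<lambda>x. \<Sum>j\<in>F. f j x) \<in> L2"
proof (induction F rule: infinite_finite_induct)
  case (insert j F)
  then show ?case by (simp add: L2_add)
qed (auto simp: L2_zero)

lemma L2_integrable_mult:
  assumes "\<psi> \<in> L2" "\<phi> \<in> L2"
  shows "integrable circ (\<lambda>x. \<psi> x * cnj (\<phi> x))"
proof (rule Bochner_Integration.integrable_bound)
  show "integrable circ (\<lambda>x. (cmod (\<psi> x))\<^sup>2 + (cmod (\<phi> x))\<^sup>2)"
    using assms[THEN L2_integrable_sq] by simp
  show "(\<lambda>x. \<psi> x * cnj (\<phi> x)) \<in> borel_measurable circ"
    by (intro borel_measurable_times L2_measurable_circ assms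
        measurable_compose[OF L2_measurable_circ[OF assms(2)], where g=cnj and L=borel]
        borel_measurable_continuous_onI continuous_intros)
  have "cmod a * cmod b \<le> (cmod a)\<^sup>2 + (cmod b)\<^sup>2" for a b
    using sum_squares_bound[of "cmod a" "cmod b"] mult_nonneg_nonneg[OF norm_ge_zero norm_ge_zero, of a b]
    by linarith
  then show "AE x in circ. norm (\<psi> x * cnj (\<phi> x)) \<le> norm ((cmod (\<psi> x))\<^sup>2 + (cmod (\<phi> x))\<^sup>2)"
    by (simp add: norm_mult)
qed

lemma L2_integrable_cis:
  assumes "\<psi> \<in> L2"
  shows "integrable circ (\<lambda>x. \<psi> x * cis (- (of_int j * x)))"
  using L2_integrable_mult[OF assms L2_cis[of 1 j]] by (simp add: cis_cnj)

lemma integral_circ_cis: "integral\<^sup>L circ (\<lambda>x. cis (of_int n * x)) = (if n = 0 then 2 * pi else 0)"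
proof (cases "n = 0")
  case True
  then show ?thesis using integral_circ_const[of "1::complex"]
    by (simp del: lebesgue_integral_const add: scaleR_conv_of_real)
next
  case False
  let ?F = "\<lambda>x. cis (of_int n * x) / (\<i> * of_int n)"
  have "((\<lambda>x. cis (of_int n * x)) has_integral ?F (2 * pi) - ?F 0) {0..2 * pi}"
  proof (rule fundamental_theorem_of_calculus)
    show "(?F has_vector_derivative cis (of_int n * x)) (at x within {0..2*pi})" for x
      unfolding has_vector_derivative_complex_iff using False
      by (auto intro!: derivative_eq_intros simp: Re_divide Im_divide field_simps power2_eq_square
          simp flip: has_real_derivative_iff_has_vector_derivative)
  qed auto
  moreover have "cis (of_int n * (2 * pi)) = 1"
    using cis_periodic[of n 0] by simp
  ultimately have "((\<lambda>x. cis (of_int n * x)) has_integral 0) {0..2 * pi}" by simp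
  moreover have "integrable circ (\<lambda>x. cis (of_int n * x))"
    using L2_integrable_cis[OF L2_cis[of 1 0], of "-n"] by simp
  ultimately show ?thesis using False
    by (simp add: lebesgue_integral_eq_integral integral_unique)
qed

lemma fourier_coeff_add:
  assumes "\<psi> \<in> L2" "\<phi> \<in> L2"
  shows "fourier_coeff (\<lambda>x. \<psi> x + \<phi> x) j = fourier_coeff \<psi> j + fourier_coeff \<phi> j"
  unfolding fourier_coeff_circ using assms[THEN L2_integrable_cis[of _ j]]
  by (simp add: ring_distribs)

lemma fourier_coeff_scale: "fourier_coeff (\<lambda>x. c * \<psi> x) j = c * fourier_coeff \<psi> j"
  unfolding fourier_coeff_circ by (simp add: mult.assoc mult.left_commute)

lemma fourier_coeff_diff:
  assumes "\<psi> \<in> L2" "\<phi> \<in> L2"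
  shows "fourier_coeff (\<lambda>x. \<psi> x - \<phi> x) j = fourier_coeff \<psi> j - fourier_coeff \<phi> j"
  using fourier_coeff_add[OF assms(1) L2_scale[OF assms(2), of "-1"]] fourier_coeff_scale[of "-1"] by simp

lemma fourier_coeff_cis: "fourier_coeff (\<lambda>x. c * cis (of_int k * x)) j = (if j = k then c else 0)"
proof -
  have "c * cis (of_int k * x) * cis (- (of_int j * x)) = c * cis (of_int (k - j) * x)" for x
    by (simp add: mult.assoc cis_mult left_diff_distrib)
  then show ?thesis unfolding fourier_coeff_circ by (simp only: integral_mult_right_zero integral_circ_cis) auto
qed

lemma fourier_coeff_sum:
  assumes "finite F"
  shows "fourier_coeff (\<lambda>x. \<Sum>k\<in>F. d k * cis (of_int k * x)) j = (if j \<in> F then d j else 0)"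
  using assms
proof (induction F rule: finite_induct)
  case empty
  show ?case unfolding fourier_coeff_circ by simp
next
  case (insert k F)
  have "(\<lambda>x. \<Sum>k\<in>F. d k * cis (of_int k * x)) \<in> L2" by (intro L2_sum L2_cis)
  with insert show ?case by (auto simp: fourier_coeff_add L2_cis fourier_coeff_cis)
qed

text \<open>
  Completing the square in the coefficient \<open>d\<close>. Bessel's inequality and the best approximation
  property of Fourier partial sums both follow by removing one exponential at a time, without
  expanding a double sum of inner products.
\<close>

lemma L2_norm_sq_diff_monomial:
  assumes "\<phi> \<in> L2"
  shows "(L2_norm (\<lambda>x. \<phi> x - d * cis (of_int j * x)))\<^sup>2 =
     (L2_norm \<phi>)\<^sup>2 - (cmod (fourier_coeff \<phi> j))\<^sup>2 + (cmod (fourier_coeff \<phi> j - d))\<^sup>2"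
proof -
  have 1: "(cmod (u - d * cis y))\<^sup>2 = (cmod u)\<^sup>2 - 2 * Re (cnj d * (u * cis (- y))) + (cmod d)\<^sup>2" for u y
  proof -
    have "(cmod (u - d * cis y))\<^sup>2 = (cmod ((u - d * cis y) * cis (- y)))\<^sup>2" by (simp add: norm_mult)
    also have "(u - d * cis y) * cis (- y) = u * cis (- y) - d" by (simp add: left_diff_distrib mult.assoc cis_mult)
    also have "(cmod (u * cis (- y) - d))\<^sup>2 = (cmod (u * cis (- y)))\<^sup>2 - 2 * Re (cnj d * (u * cis (- y))) + (cmod d)\<^sup>2"
      unfolding cmod_power2 by (simp add: power2_eq_square algebra_simps)
    finally show ?thesis by (simp add: norm_mult)
  qed
  have i: "integrable circ (\<lambda>x. cnj d * (\<phi> x * cis (- (of_int j * x))))"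
    using L2_integrable_cis[OF assms] by simp
  define R where "R x = Re (cnj d * (\<phi> x * cis (- (of_int j * x))))" for x
  from i have iR: "integrable circ (\<lambda>x. Re (cnj d * (\<phi> x * cis (- (of_int j * x)))))"
    by (rule integrable_Re)
  have "integral\<^sup>L circ (\<lambda>x. Re (cnj d * (\<phi> x * cis (- (of_int j * x)))))
      = Re (cnj d * integral\<^sup>L circ (\<lambda>x. \<phi> x * cis (- (of_int j * x))))"
    by (simp only: integral_Re[OF i] integral_mult_right_zero)
  also have "\<dots> = Re (cnj d * (2 * pi * fourier_coeff \<phi> j))"
    unfolding fourier_coeff_circ by simp
  finally have 2: "integral\<^sup>L circ (\<lambda>x. Re (cnj d * (\<phi> x * cis (- (of_int j * x)))))
     = 2 * pi * Re (cnj d * fourier_coeff \<phi> j)" by (simp add: algebra_simps)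
  have "integral\<^sup>L circ (\<lambda>x. (cmod (\<phi> x - d * cis (of_int j * x)))\<^sup>2)
     = integral\<^sup>L circ (\<lambda>x. (cmod (\<phi> x))\<^sup>2) - 2 * (2 * pi * Re (cnj d * fourier_coeff \<phi> j)) + 2 * pi * (cmod d)\<^sup>2"
    unfolding 1 2[symmetric] R_def[symmetric] using iR[folded R_def] L2_integrable_sq[OF assms]
    by (simp add: integral_circ_const del: lebesgue_integral_const)
  then have "(L2_norm (\<lambda>x. \<phi> x - d * cis (of_int j * x)))\<^sup>2
     = (L2_norm \<phi>)\<^sup>2 - 2 * Re (cnj d * fourier_coeff \<phi> j) + (cmod d)\<^sup>2"
    unfolding L2_norm_sq by (simp add: field_simps)
  also have "\<dots> = (L2_norm \<phi>)\<^sup>2 - (cmod (fourier_coeff \<phi> j))\<^sup>2 + (cmod (fourier_coeff \<phi> j - d))\<^sup>2"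
    unfolding cmod_power2 by (simp add: power2_eq_square algebra_simps)
  finally show ?thesis .
qed

lemma L2_norm_sq_diff_sum:
  assumes "\<psi> \<in> L2" "finite F"
  shows "(L2_norm (\<lambda>x. \<psi> x - (\<Sum>j\<in>F. d j * cis (of_int j * x))))\<^sup>2 =
     (L2_norm \<psi>)\<^sup>2 + (\<Sum>j\<in>F. (cmod (fourier_coeff \<psi> j - d j))\<^sup>2 - (cmod (fourier_coeff \<psi> j))\<^sup>2)"
  using assms(2)
proof (induction F rule: finite_induct)
  case (insert k F)
  let ?\<phi> = "\<lambda>x. \<psi> x - (\<Sum>j\<in>F. d j * cis (of_int j * x))"
  have S: "(\<lambda>x. \<Sum>j\<in>F. d j * cis (of_int j * x)) \<in> L2" by (intro L2_sum L2_cis)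
  have \<phi>: "?\<phi> \<in> L2" by (rule L2_diff[OF assms(1) S])
  have "(\<lambda>x. \<psi> x - (\<Sum>j\<in>insert k F. d j * cis (of_int j * x))) = (\<lambda>x. ?\<phi> x - d k * cis (of_int k * x))"
    using insert by (simp add: algebra_simps)
  moreover have "fourier_coeff ?\<phi> k = fourier_coeff \<psi> k"
    using fourier_coeff_diff[OF assms(1) S] fourier_coeff_sum[OF insert(1)] insert by simp
  ultimately show ?case
    using L2_norm_sq_diff_monomial[OF \<phi>, of "d k" k] insert by simp
qed simp

text \<open>
  Each frequency contributes \<open>|\<psi>\<^sub>j - d\<^sub>j|\<^sup>2 - |\<psi>\<^sub>j|\<^sup>2\<close> to the squared distance, which is smallest,
  and non-positive, at \<open>d\<^sub>j = \<psi>\<^sub>j\<close>. Hence a single good approximation with frequencies in \<open>G\<close>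
  controls all Fourier partial sums over sets \<open>F \<supseteq> G\<close>, as convergence along finite sets demands.
\<close>

lemma partial_sum_best_approx:
  assumes "\<psi> \<in> L2" "finite F" "G \<subseteq> F"
  shows "(L2_norm (\<lambda>x. \<psi> x - (\<Sum>j\<in>F. fourier_coeff \<psi> j * cis (of_int j * x))))\<^sup>2
       \<le> (L2_norm (\<lambda>x. \<psi> x - (\<Sum>j\<in>G. d j * cis (of_int j * x))))\<^sup>2"
proof -
  have G: "finite G" using assms finite_subset by blast
  have "(\<Sum>j\<in>F. (cmod (fourier_coeff \<psi> j - fourier_coeff \<psi> j))\<^sup>2 - (cmod (fourier_coeff \<psi> j))\<^sup>2)
      \<le> (\<Sum>j\<in>G. - (cmod (fourier_coeff \<psi> j))\<^sup>2)"
    unfolding sum_negf using sum_mono2[OF assms(2,3), of "\<lambda>j. (cmod (fourier_coeff \<psi> j))\<^sup>2"]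
    by (simp add: sum_negf)
  also have "\<dots> \<le> (\<Sum>j\<in>G. (cmod (fourier_coeff \<psi> j - d j))\<^sup>2 - (cmod (fourier_coeff \<psi> j))\<^sup>2)"
    by (intro sum_mono) simp
  finally show ?thesis
    unfolding L2_norm_sq_diff_sum[OF assms(1,2)] L2_norm_sq_diff_sum[OF assms(1) G] by simp
qed

section \<open>Completeness of the exponentials\<close>

definition trig_approximable :: "(real \<Rightarrow> complex) \<Rightarrow> bool" where
  "trig_approximable \<psi> \<longleftrightarrow> (\<forall>e>0. \<exists>G d. finite G \<and>
     (L2_norm (\<lambda>x. \<psi> x - (\<Sum>j\<in>G. d j * cis (of_int j * x))))\<^sup>2 \<le> e)"

lemma L2_norm_sq_add_le:
  assumes "\<psi> \<in> L2" "\<phi> \<in> L2"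
  shows "(L2_norm (\<lambda>x. \<psi> x + \<phi> x))\<^sup>2 \<le> 2 * (L2_norm \<psi>)\<^sup>2 + 2 * (L2_norm \<phi>)\<^sup>2"
proof -
  have "integral\<^sup>L circ (\<lambda>x. (cmod (\<psi> x + \<phi> x))\<^sup>2)
      \<le> integral\<^sup>L circ (\<lambda>x. 2 * (cmod (\<psi> x))\<^sup>2 + 2 * (cmod (\<phi> x))\<^sup>2)"
    using assms L2_add[OF assms] by (intro integral_mono) (auto simp: L2_integrable_sq norm_add_sq_le)
  also have "\<dots> = 2 * integral\<^sup>L circ (\<lambda>x. (cmod (\<psi> x))\<^sup>2) + 2 * integral\<^sup>L circ (\<lambda>x. (cmod (\<phi> x))\<^sup>2)"
    using assms by (simp add: L2_integrable_sq)
  finally show ?thesis unfolding L2_norm_sq by (simp add: field_simps)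
qed

lemma trig_approximable_limit:
  assumes "\<psi> \<in> L2" "\<And>n. \<phi> n \<in> L2" "\<And>n. trig_approximable (\<phi> n)"
    and "(\<lambda>n. (L2_norm (\<lambda>x. \<psi> x - \<phi> n x))\<^sup>2) \<longlonglongrightarrow> 0"
  shows "trig_approximable \<psi>"
  unfolding trig_approximable_def
proof (intro allI impI)
  fix e :: real assume "e > 0"
  then have "\<forall>\<^sub>F n in sequentially. (L2_norm (\<lambda>x. \<psi> x - \<phi> n x))\<^sup>2 < e / 4"
    by (intro order_tendstoD(2)[OF assms(4)]) simp
  then obtain n where n: "(L2_norm (\<lambda>x. \<psi> x - \<phi> n x))\<^sup>2 < e / 4"
    by (auto simp: eventually_sequentially)
  obtain G d where G: "finite G" "(L2_norm (\<lambda>x. \<phi> n x - (\<Sum>j\<in>G. d j * cis (of_int j * x))))\<^sup>2 \<le> e / 4"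
    using assms(3)[of n] \<open>e > 0\<close> unfolding trig_approximable_def by (meson divide_pos_pos zero_less_numeral)
  have "(\<lambda>x. \<Sum>j\<in>G. d j * cis (of_int j * x)) \<in> L2" by (intro L2_sum L2_cis)
  from L2_norm_sq_add_le[OF L2_diff[OF assms(1,2)] L2_diff[OF assms(2) this], of n n] n G
  have "(L2_norm (\<lambda>x. \<psi> x - (\<Sum>j\<in>G. d j * cis (of_int j * x))))\<^sup>2 \<le> e" by simp
  with G(1) show "\<exists>G d. finite G \<and> (L2_norm (\<lambda>x. \<psi> x - (\<Sum>j\<in>G. d j * cis (of_int j * x))))\<^sup>2 \<le> e"
    by blast
qed

lemma trig_approximable_continuous:
  fixes H :: "complex \<Rightarrow> complex"
  assumes "continuous_on (sphere 0 1) H"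
  shows "trig_approximable (\<lambda>x. H (cis x))"
  unfolding trig_approximable_def
proof (intro allI impI)
  fix e :: real assume e: "e > 0"
  then obtain p where p: "trig_poly p" "\<And>x. cmod (H (cis x) - p x) < sqrt e"
    using trig_poly_dense_uniform[OF assms, of "sqrt e"] by auto
  obtain G d where G: "finite G" "p = (\<lambda>x. \<Sum>j\<in>G. d j * cis (of_int j * x))"
    using trig_poly_finite_sum[OF p(1)] by blast
  have "(cmod (H (cis x) - p x))\<^sup>2 \<le> e" for x
    using power_mono[OF less_imp_le[OF p(2)[of x]] norm_ge_zero, of 2] e by simp
  moreover have "0 \<le> integral\<^sup>L circ (\<lambda>x. (cmod (H (cis x) - p x))\<^sup>2)" by simp
  ultimately have "integral\<^sup>L circ (\<lambda>x. (cmod (H (cis x) - p x))\<^sup>2) \<le> integral\<^sup>L circ (\<lambda>x. e)"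
    using e by (intro integral_mono') auto
  then have "(L2_norm (\<lambda>x. H (cis x) - p x))\<^sup>2 \<le> e"
    unfolding L2_norm_sq integral_circ_const by (simp add: field_simps)
  then show "\<exists>G d. finite G \<and> (L2_norm (\<lambda>x. H (cis x) - (\<Sum>j\<in>G. d j * cis (of_int j * x))))\<^sup>2 \<le> e"
    using G by blast
qed

lemma AE_circ_iff: "(AE x in circ. P x) \<longleftrightarrow> (AE x in lebesgue. x \<in> {0..2*pi} \<longrightarrow> P x)"
  by (rule AE_restrict_space_iff) auto

lemma L2_norm_sq_dominated_convergence:
  assumes "\<psi> \<in> L2" "\<And>n. \<phi> n \<in> L2" "w \<in> L2"
    and "AE x in circ. (\<lambda>n. \<phi> n x) \<longlonglongrightarrow> \<psi> x"
    and "\<And>n x. x \<in> {0..2*pi} \<Longrightarrow> cmod (\<psi> x - \<phi> n x) \<le> cmod (w x)"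
  shows "(\<lambda>n. (L2_norm (\<lambda>x. \<psi> x - \<phi> n x))\<^sup>2) \<longlonglongrightarrow> 0"
proof -
  have "(\<lambda>n. integral\<^sup>L circ (\<lambda>x. (cmod (\<psi> x - \<phi> n x))\<^sup>2)) \<longlonglongrightarrow> integral\<^sup>L circ (\<lambda>x. 0)"
  proof (rule integral_dominated_convergence[where w="\<lambda>x. (cmod (w x))\<^sup>2"])
    show "(\<lambda>x. (cmod (\<psi> x - \<phi> n x))\<^sup>2) \<in> borel_measurable circ" for n
      using assms(1,2)[THEN L2_measurable_circ] by measurable
    show "AE x in circ. (\<lambda>n. (cmod (\<psi> x - \<phi> n x))\<^sup>2) \<longlonglongrightarrow> 0"
      using assms(4)
    proof eventually_elim
      case (elim x)
      then have "(\<lambda>n. (cmod (\<psi> x - \<phi> n x))\<^sup>2) \<longlonglongrightarrow> (cmod (\<psi> x - \<psi> x))\<^sup>2"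
        by (intro tendsto_intros)
      then show ?case by simp
    qed
    show "AE x in circ. norm ((cmod (\<psi> x - \<phi> n x))\<^sup>2) \<le> (cmod (w x))\<^sup>2" for n
      unfolding AE_circ_iff using assms(5)[of _ n] by (auto intro!: AE_I2 power_mono)
  qed (use assms(3) in \<open>auto simp: L2_integrable_sq\<close>)
  then have "(\<lambda>n. (1 / (2 * pi)) * integral\<^sup>L circ (\<lambda>x. (cmod (\<psi> x - \<phi> n x))\<^sup>2)) \<longlonglongrightarrow> (1 / (2 * pi)) * 0"
    by (intro tendsto_mult_left) simp
  then show ?thesis unfolding L2_norm_sq by simp
qed

text \<open>
  A measurable function is an almost everywhere limit of continuous functions \<open>g n\<close>. Clipping them to
  the bound of \<open>\<psi>\<close> permits dominated convergence; multiplying them by cutoffs \<open>chi n\<close> that vanish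
  at both ends of \<open>[0, 2\<pi>]\<close> turns them into continuous functions \<open>H n\<close> on the circle,
  to which Stone-Weierstrass applies.
\<close>

lemma trig_approximable_bounded:
  assumes \<psi>: "\<psi> \<in> L2" and "\<And>x. cmod (\<psi> x) \<le> K"
  shows "trig_approximable \<psi>"
proof -
  define B where "B = max K 1"
  have B: "B > 0" "\<And>x. cmod (\<psi> x) \<le> B" using assms(2) unfolding B_def by (auto simp: max.coboundedI1)
  have "\<psi> measurable_on UNIV"
    using \<psi> by (intro lebesgue_measurable_imp_measurable_on) (auto simp: L2_iff)
  then obtain N g where N: "negligible N" and g: "\<And>n. continuous_on UNIV (g n)"
    and lim: "\<And>x. x \<notin> N \<Longrightarrow> (\<lambda>n::nat. g n x) \<longlonglongrightarrow> \<psi> x"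
    unfolding measurable_on_def by auto
  define clip where "clip z = (B / max B (cmod z)) *\<^sub>R z" for z :: complex
  have clip_le: "cmod (clip z) \<le> B" for z
  proof -
    have "cmod (clip z) = B * (cmod z / max B (cmod z))" unfolding clip_def using B(1) by simp
    also have "\<dots> \<le> B * 1" using B(1) by (intro mult_left_mono) (auto simp: divide_simps)
    finally show ?thesis by simp
  qed
  have clip_id: "clip z = z" if "cmod z \<le> B" for z
    using that B(1) by (simp add: clip_def max_def)
  have clip_cont: "continuous_on UNIV clip"
    unfolding clip_def using B(1) by (intro continuous_intros) auto
  define chi where "chi n x = min 1 (real n * min x (2 * pi - x))" for n and x :: real
  have chi01: "0 \<le> chi n x" "chi n x \<le> 1" if "x \<in> {0..2*pi}" for n x
    using that unfolding chi_def by auto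
  have chi_lim: "(\<lambda>n. chi n x) \<longlonglongrightarrow> 1" if "x \<in> {0<..<2*pi}" for x
  proof (rule tendsto_eventually)
    have pos: "min x (2 * pi - x) > 0" using that by auto
    then obtain n0 where n0: "real n0 * min x (2 * pi - x) > 1" using reals_Archimedean3 by blast
    have "chi n x = 1" if "n \<ge> n0" for n
    proof -
      have "real n0 * min x (2 * pi - x) \<le> real n * min x (2 * pi - x)"
        using that pos by (intro mult_right_mono) auto
      then show ?thesis using n0 unfolding chi_def by linarith
    qed
    then show "\<forall>\<^sub>F n in sequentially. chi n x = 1" unfolding eventually_sequentially by blast
  qed
  define p where "p n s = chi n (2 * pi * s) *\<^sub>R clip (g n (2 * pi * s))" for n and s :: real
  define H where "H n = p n \<circ> (\<lambda>z. Arg2pi z / (2 * pi))" for n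
  have H_cont: "continuous_on (sphere 0 1) (H n)" for n
  proof -
    have "continuous_on {0..1} (p n)"
      unfolding p_def chi_def
      by (intro continuous_intros continuous_on_compose2[OF clip_cont] continuous_on_compose2[OF g]) auto
    then have "homotopic_loops UNIV (p n) (p n)"
      unfolding homotopic_loops_refl by (auto simp: path_def pathfinish_def pathstart_def p_def chi_def)
    \<comment> \<open>A loop induces a continuous map of the circle; this is part of the statement that homotopic
      loops induce homotopic maps, here used for the constant homotopy.\<close>
    from homotopic_loops_imp_homotopic_circlemaps[OF this]
    show ?thesis unfolding H_def using homotopic_with_imp_continuous by blast
  qed
  have H_eq: "H n (cis x) = chi n x *\<^sub>R clip (g n x)" if "x \<in> {0..<2*pi}" for n x
  proof -
    have "Arg2pi (cis x) = x" using that by (simp add: cis_conv_exp Arg2pi_exp)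
    then show ?thesis unfolding H_def p_def by simp
  qed
  have H_le: "cmod (H n (cis x)) \<le> B" for n x
  proof -
    have "0 \<le> Arg2pi (cis x)" "Arg2pi (cis x) < 2 * pi" using Arg2pi[of "cis x"] by auto
    then show ?thesis unfolding H_def p_def
      using mult_mono[OF chi01(2) clip_le, of "Arg2pi (cis x)"] chi01(1) by (simp add: B less_imp_le)
  qed
  have H_L2: "(\<lambda>x. H n (cis x)) \<in> L2" for n
  proof (rule L2I_bounded[where B=B])
    show "H n (cis (x + 2 * pi)) = H n (cis x)" for x
      using cis_periodic[of 1 x] by simp
    show "(\<lambda>x. H n (cis x)) \<in> borel_measurable lebesgue"
      by (intro continuous_on_imp_lebesgue continuous_on_compose2[OF H_cont] continuous_intros) auto
  qed (rule H_le)
  have "(\<lambda>n. (L2_norm (\<lambda>x. \<psi> x - H n (cis x)))\<^sup>2) \<longlonglongrightarrow> 0"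
  proof (rule L2_norm_sq_dominated_convergence[OF \<psi> H_L2])
    show "(\<lambda>x. complex_of_real (2 * B)) \<in> L2" by (rule L2I_bounded[where B="2 * B"]) (use B in auto)
    show "cmod (\<psi> x - H n (cis x)) \<le> cmod (complex_of_real (2 * B))" for n x
      using norm_triangle_ineq4[of "\<psi> x" "H n (cis x)"] B(2)[of x] H_le[of n x] B(1) by simp
    have "negligible (N \<union> {0, 2 * pi})" using N by (simp add: negligible_Un)
    then have "AE x in lebesgue. x \<notin> N \<union> {0, 2 * pi}"
      by (metis AE_not_in negligible_iff_null_sets)
    then show "AE x in circ. (\<lambda>n. H n (cis x)) \<longlonglongrightarrow> \<psi> x"
      unfolding AE_circ_iff
    proof eventually_elim
      case (elim x)
      show ?case
      proof
        assume "x \<in> {0..2*pi}"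
        with elim have x: "x \<in> {0<..<2*pi}" by auto
        have "(\<lambda>n. clip (g n x)) \<longlonglongrightarrow> clip (\<psi> x)"
          using lim[of x] elim clip_cont by (intro isCont_tendsto_compose[of _ clip])
            (auto simp: continuous_on_eq_continuous_at)
        then have "(\<lambda>n. chi n x *\<^sub>R clip (g n x)) \<longlonglongrightarrow> 1 *\<^sub>R clip (\<psi> x)"
          by (intro tendsto_scaleR chi_lim x)
        then show "(\<lambda>n. H n (cis x)) \<longlonglongrightarrow> \<psi> x"
          using H_eq[of x] x clip_id[OF B(2)] by simp
      qed
    qed
  qed
  from trig_approximable_limit[OF \<psi> H_L2 trig_approximable_continuous[OF H_cont] this] show ?thesis .
qed

lemma trig_approximable_L2:
  assumes "\<psi> \<in> L2"
  shows "trig_approximable \<psi>"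
proof -
  define \<phi> where "\<phi> n x = (if cmod (\<psi> x) \<le> real n then \<psi> x else 0)" for n x
  have [measurable]: "\<psi> \<in> borel_measurable lebesgue" using assms by (simp add: L2_iff)
  have "{x \<in> space lebesgue. cmod (\<psi> x) \<le> real n} \<in> sets lebesgue" for n by measurable
  then have "\<phi> n \<in> L2" for n
    unfolding \<phi>_def
    by (intro L2I_bounded[where B="real n"] measurable_If) (use assms in \<open>auto simp: L2_iff\<close>)
  moreover have "trig_approximable (\<phi> n)" for n
    by (rule trig_approximable_bounded[OF calculation, where K="real n"]) (auto simp: \<phi>_def)
  moreover have "(\<lambda>n. (L2_norm (\<lambda>x. \<psi> x - \<phi> n x))\<^sup>2) \<longlonglongrightarrow> 0"
  proof (rule L2_norm_sq_dominated_convergence[OF assms calculation(1) assms])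
    have "(\<lambda>n. \<phi> n x) \<longlonglongrightarrow> \<psi> x" for x
    proof (rule tendsto_eventually)
      obtain n0 where "cmod (\<psi> x) \<le> real n0" using real_arch_simple by blast
      then have "\<forall>n\<ge>n0. \<phi> n x = \<psi> x" unfolding \<phi>_def by auto
      then show "\<forall>\<^sub>F n in sequentially. \<phi> n x = \<psi> x" unfolding eventually_sequentially by blast
    qed
    then show "AE x in circ. (\<lambda>n. \<phi> n x) \<longlonglongrightarrow> \<psi> x" by simp
  qed (auto simp: \<phi>_def)
  ultimately show ?thesis using trig_approximable_limit[OF assms] by blast
qed

text \<open>
  Density of trigonometric polynomials together with the best approximation property.
\<close>

theorem fourier_series_L2_tendsto:
  assumes "\<psi> \<in> L2"
  shows "((\<lambda>F. (L2_norm (\<lambda>x. \<psi> x - (\<Sum>j\<in>F. fourier_coeff \<psi> j * cis (of_int j * x))))\<^sup>2) \<longlongrightarrow> 0)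
           (finite_subsets_at_top UNIV)"
proof (rule tendstoI)
  fix e :: real assume "e > 0"
  then obtain G d where G: "finite G" "(L2_norm (\<lambda>x. \<psi> x - (\<Sum>j\<in>G. d j * cis (of_int j * x))))\<^sup>2 \<le> e / 2"
    using trig_approximable_L2[OF assms] unfolding trig_approximable_def by (meson half_gt_zero)
  have "(L2_norm (\<lambda>x. \<psi> x - (\<Sum>j\<in>F. fourier_coeff \<psi> j * cis (of_int j * x))))\<^sup>2 < e"
    if "finite F" "G \<subseteq> F" for F
    using partial_sum_best_approx[OF assms that, of d] G(2) \<open>e > 0\<close> by linarith
  then show "\<forall>\<^sub>F F in finite_subsets_at_top UNIV.
      dist ((L2_norm (\<lambda>x. \<psi> x - (\<Sum>j\<in>F. fourier_coeff \<psi> j * cis (of_int j * x))))\<^sup>2) 0 < e"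
    unfolding eventually_finite_subsets_at_top using G(1) by (intro exI[of _ G]) auto
qed

section \<open>Multiplication operators\<close>

lemma L2_norm_sq_mult_le:
  assumes "\<psi> \<in> L2" "(\<lambda>x. m x * \<psi> x) \<in> L2" "\<And>x. cmod (m x) \<le> B"
  shows "(L2_norm (\<lambda>x. m x * \<psi> x))\<^sup>2 \<le> B\<^sup>2 * (L2_norm \<psi>)\<^sup>2"
proof -
  have "integral\<^sup>L circ (\<lambda>x. (cmod (m x * \<psi> x))\<^sup>2) \<le> integral\<^sup>L circ (\<lambda>x. B\<^sup>2 * (cmod (\<psi> x))\<^sup>2)"
  proof (rule integral_mono)
    show "integrable circ (\<lambda>x. (cmod (m x * \<psi> x))\<^sup>2)" by (rule L2_integrable_sq[OF assms(2)])
    show "integrable circ (\<lambda>x. B\<^sup>2 * (cmod (\<psi> x))\<^sup>2)" using L2_integrable_sq[OF assms(1)] by simp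
    show "(cmod (m x * \<psi> x))\<^sup>2 \<le> B\<^sup>2 * (cmod (\<psi> x))\<^sup>2" for x
      using assms(3) by (auto simp: norm_mult power_mult_distrib intro!: mult_right_mono power_mono)
  qed
  then show ?thesis unfolding L2_norm_sq by (simp add: field_simps)
qed

lemma L2_norm_eq_0_iff:
  assumes "\<psi> \<in> L2"
  shows "(L2_norm \<psi>)\<^sup>2 = 0 \<longleftrightarrow> (AE x in circ. \<psi> x = 0)"
  unfolding L2_norm_sq using integral_nonneg_eq_0_iff_AE[OF L2_integrable_sq[OF assms]] by simp

text \<open>
  A symbol that does not depend on the frequency quantizes to multiplication by it. The graph
  contains every \<open>\<psi>\<close> in \<open>L\<^sup>2\<close>, because the truncated series is \<open>m\<close> times a Fourier partial sum of
  \<open>\<psi>\<close> and \<open>m\<close> is bounded; this is where completeness of the exponentials enters.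
\<close>

lemma quantization_multiplication:
  fixes m :: "real \<Rightarrow> real"
  assumes m: "\<And>x. m (x + 2 * pi) = m x" "continuous_on UNIV m" "\<And>x. \<bar>m x\<bar> \<le> B"
  shows "quantization (\<lambda>x j. m x) =
    {(\<psi>, g). \<psi> \<in> L2 \<and> g \<in> L2 \<and> (AE x in circ. g x = of_real (m x) * \<psi> x)}"
proof -
  let ?S = "\<lambda>\<psi> F x. \<Sum>j\<in>F. fourier_coeff \<psi> j * cis (of_int j * x)"
  have mL2: "(\<lambda>x. of_real (m x) * \<psi> x) \<in> L2" if "\<psi> \<in> L2" for \<psi>
    using that m by (intro L2_mult_bounded[where B=B] continuous_on_imp_lebesgue continuous_intros) auto
  have m_le: "(L2_norm (\<lambda>x. of_real (m x) * \<psi> x))\<^sup>2 \<le> B\<^sup>2 * (L2_norm \<psi>)\<^sup>2" if "\<psi> \<in> L2" for \<psi>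
    using that mL2[OF that] m(3) by (intro L2_norm_sq_mult_le) auto
  have S: "?S \<psi> F \<in> L2" for \<psi> F by (intro L2_sum L2_cis)
  have lim0: "((\<lambda>F. (L2_norm (\<lambda>x. of_real (m x) * (\<psi> x - ?S \<psi> F x)))\<^sup>2) \<longlongrightarrow> 0) (finite_subsets_at_top UNIV)"
    if \<psi>: "\<psi> \<in> L2" for \<psi>
  proof (rule tendsto_sandwich[where f="\<lambda>_. 0"])
    show "((\<lambda>F. B\<^sup>2 * (L2_norm (\<lambda>x. \<psi> x - ?S \<psi> F x))\<^sup>2) \<longlongrightarrow> 0) (finite_subsets_at_top UNIV)"
      using tendsto_mult_left[OF fourier_series_L2_tendsto[OF \<psi>], of "B\<^sup>2"] by simp
    show "\<forall>\<^sub>F F in finite_subsets_at_top UNIV. (L2_norm (\<lambda>x. of_real (m x) * (\<psi> x - ?S \<psi> F x)))\<^sup>2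
        \<le> B\<^sup>2 * (L2_norm (\<lambda>x. \<psi> x - ?S \<psi> F x))\<^sup>2"
      using m_le[OF L2_diff[OF \<psi> S]] by simp
  qed auto
  have pull: "(\<Sum>j\<in>F. of_real (m x) * fourier_coeff \<psi> j * cis (of_int j * x)) = of_real (m x) * ?S \<psi> F x"
    for \<psi> F x by (simp add: sum_distrib_left mult.assoc)
  have "((\<lambda>F. L2_norm (\<lambda>x. g x - of_real (m x) * ?S \<psi> F x)) \<longlongrightarrow> 0) (finite_subsets_at_top UNIV)
      \<longleftrightarrow> (AE x in circ. g x = of_real (m x) * \<psi> x)" (is "?L \<longleftrightarrow> ?R")
    if \<psi>: "\<psi> \<in> L2" and g: "g \<in> L2" for \<psi> g
  proof
    assume ?L
    then have 1: "((\<lambda>F. (L2_norm (\<lambda>x. g x - of_real (m x) * ?S \<psi> F x))\<^sup>2) \<longlongrightarrow> 0) (finite_subsets_at_top UNIV)"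
      using tendsto_power[of _ 0 _ 2] by fastforce
    have "(L2_norm (\<lambda>x. g x - of_real (m x) * \<psi> x))\<^sup>2
       \<le> 2 * (L2_norm (\<lambda>x. g x - of_real (m x) * ?S \<psi> F x))\<^sup>2
         + 2 * (L2_norm (\<lambda>x. - 1 * (of_real (m x) * (\<psi> x - ?S \<psi> F x))))\<^sup>2" for F
    proof -
      have e: "(\<lambda>x. g x - of_real (m x) * \<psi> x)
          = (\<lambda>x. (g x - of_real (m x) * ?S \<psi> F x) + (- 1 * (of_real (m x) * (\<psi> x - ?S \<psi> F x))))"
        by (simp add: algebra_simps)
      show ?thesis unfolding e
        by (intro L2_norm_sq_add_le L2_diff g mL2 S L2_scale \<psi>)
    qed
    then have le: "(L2_norm (\<lambda>x. g x - of_real (m x) * \<psi> x))\<^sup>2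
       \<le> 2 * (L2_norm (\<lambda>x. g x - of_real (m x) * ?S \<psi> F x))\<^sup>2
         + 2 * (L2_norm (\<lambda>x. of_real (m x) * (\<psi> x - ?S \<psi> F x)))\<^sup>2" for F
      by (simp add: L2_norm_def)
    have "((\<lambda>F. 2 * (L2_norm (\<lambda>x. g x - of_real (m x) * ?S \<psi> F x))\<^sup>2
         + 2 * (L2_norm (\<lambda>x. of_real (m x) * (\<psi> x - ?S \<psi> F x)))\<^sup>2) \<longlongrightarrow> 2 * 0 + 2 * 0) (finite_subsets_at_top UNIV)"
      by (intro tendsto_intros 1 lim0 \<psi>)
    then have "(L2_norm (\<lambda>x. g x - of_real (m x) * \<psi> x))\<^sup>2 \<le> 0"
      using le by (intro tendsto_lowerbound[of _ 0 "finite_subsets_at_top UNIV"]) auto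
    then have "(L2_norm (\<lambda>x. g x - of_real (m x) * \<psi> x))\<^sup>2 = 0" by simp
    then show ?R using L2_norm_eq_0_iff[OF L2_diff[OF g mL2[OF \<psi>]]] by simp
  next
    assume R: ?R
    have "(L2_norm (\<lambda>x. g x - of_real (m x) * ?S \<psi> F x))\<^sup>2 = (L2_norm (\<lambda>x. of_real (m x) * (\<psi> x - ?S \<psi> F x)))\<^sup>2" for F
    proof -
      have "integral\<^sup>L circ (\<lambda>x. (cmod (g x - of_real (m x) * ?S \<psi> F x))\<^sup>2)
          = integral\<^sup>L circ (\<lambda>x. (cmod (of_real (m x) * (\<psi> x - ?S \<psi> F x)))\<^sup>2)"
      proof (rule integral_cong_AE)
        show "AE x in circ. (cmod (g x - of_real (m x) * ?S \<psi> F x))\<^sup>2 = (cmod (of_real (m x) * (\<psi> x - ?S \<psi> F x)))\<^sup>2"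
          using R by eventually_elim (simp add: algebra_simps)
      qed (use L2_integrable_sq[OF L2_diff[OF g mL2[OF S]]] L2_integrable_sq[OF mL2[OF L2_diff[OF \<psi> S]]] in
            \<open>auto dest: borel_measurable_integrable\<close>)
      then show ?thesis unfolding L2_norm_sq by simp
    qed
    then have "((\<lambda>F. (L2_norm (\<lambda>x. g x - of_real (m x) * ?S \<psi> F x))\<^sup>2) \<longlongrightarrow> 0) (finite_subsets_at_top UNIV)"
      using lim0[OF \<psi>] by simp
    from tendsto_real_sqrt[OF this] show ?L by (simp add: L2_norm_nonneg)
  qed
  then have "(\<psi>, g) \<in> quantization (\<lambda>x j. m x) \<longleftrightarrow>
      \<psi> \<in> L2 \<and> g \<in> L2 \<and> (AE x in circ. g x = of_real (m x) * \<psi> x)" for \<psi> g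
    unfolding quantization_def pull by (simp cong: conj_cong)
  then show ?thesis by auto
qed

lemma L2_inner_cong_AE:
  assumes "\<psi> \<in> L2" "\<phi> \<in> L2" "\<psi>' \<in> L2" "\<phi>' \<in> L2"
    "AE x in circ. \<psi> x * cnj (\<phi> x) = \<psi>' x * cnj (\<phi>' x)"
  shows "L2_inner \<psi> \<phi> = L2_inner \<psi>' \<phi>'"
proof -
  have "integral\<^sup>L circ (\<lambda>x. \<psi> x * cnj (\<phi> x)) = integral\<^sup>L circ (\<lambda>x. \<psi>' x * cnj (\<phi>' x))"
    by (rule integral_cong_AE)
       (use assms L2_integrable_mult in \<open>auto dest: borel_measurable_integrable\<close>)
  then show ?thesis unfolding L2_inner_circ by simp
qed

text \<open>
  That the adjoint is no larger than the operator is seen by testing a pair \<open>(\<phi>, \<eta>)\<close> of the adjoint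
  against \<open>\<psi> = m \<phi> - \<eta>\<close>, which gives \<open>\<parallel>\<psi>\<parallel> = 0\<close>.
\<close>

lemma self_adjoint_multiplication:
  fixes m :: "real \<Rightarrow> real"
  assumes m: "\<And>x. m (x + 2 * pi) = m x" "continuous_on UNIV m" "\<And>x. \<bar>m x\<bar> \<le> B"
  shows "self_adjoint_op (quantization (\<lambda>x j. m x))"
proof -
  let ?A = "quantization (\<lambda>x j. m x)"
  note A = quantization_multiplication[of m B, OF m]
  have mL2: "(\<lambda>x. of_real (m x) * \<psi> x) \<in> L2" if "\<psi> \<in> L2" for \<psi>
    using that m by (intro L2_mult_bounded[where B=B] continuous_on_imp_lebesgue continuous_intros) auto
  have 1: "L2_inner g \<phi> = L2_inner \<psi> \<eta>" if "(\<psi>, g) \<in> ?A" "(\<phi>, \<eta>) \<in> ?A" for \<psi> g \<phi> \<eta>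
  proof (rule L2_inner_cong_AE)
    have "AE x in circ. g x = of_real (m x) * \<psi> x" "AE x in circ. \<eta> x = of_real (m x) * \<phi> x"
      using that unfolding A by auto
    then show "AE x in circ. g x * cnj (\<phi> x) = \<psi> x * cnj (\<eta> x)"
      by eventually_elim simp
  qed (use that in \<open>auto simp: A\<close>)
  have 2: "(\<phi>, \<eta>) \<in> ?A" if \<phi>: "\<phi> \<in> L2" and \<eta>: "\<eta> \<in> L2"
    and adj: "\<And>\<psi> g. (\<psi>, g) \<in> ?A \<Longrightarrow> L2_inner g \<phi> = L2_inner \<psi> \<eta>" for \<phi> \<eta>
  proof -
    define \<psi> where "\<psi> x = of_real (m x) * \<phi> x - \<eta> x" for x
    have \<psi>: "\<psi> \<in> L2" unfolding \<psi>_def by (intro L2_diff mL2 \<phi> \<eta>)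
    have "(\<psi>, \<lambda>x. of_real (m x) * \<psi> x) \<in> ?A" unfolding A using \<psi> mL2[OF \<psi>] by simp
    from adj[OF this] have "integral\<^sup>L circ (\<lambda>x. of_real (m x) * \<psi> x * cnj (\<phi> x))
        = integral\<^sup>L circ (\<lambda>x. \<psi> x * cnj (\<eta> x))"
      unfolding L2_inner_circ by simp
    then have "integral\<^sup>L circ (\<lambda>x. of_real (m x) * \<psi> x * cnj (\<phi> x) - \<psi> x * cnj (\<eta> x)) = 0"
      using L2_integrable_mult[OF mL2[OF \<psi>] \<phi>] L2_integrable_mult[OF \<psi> \<eta>] by simp
    moreover have "of_real (m x) * \<psi> x * cnj (\<phi> x) - \<psi> x * cnj (\<eta> x) = of_real ((cmod (\<psi> x))\<^sup>2)" for x
      unfolding complex_norm_square by (simp add: \<psi>_def algebra_simps)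
    ultimately have "integral\<^sup>L circ (\<lambda>x. complex_of_real ((cmod (\<psi> x))\<^sup>2)) = 0" by simp
    then have "(L2_norm \<psi>)\<^sup>2 = 0" unfolding L2_norm_sq integral_complex_of_real by simp
    then have "AE x in circ. \<psi> x = 0" using L2_norm_eq_0_iff[OF \<psi>] by simp
    then have "AE x in circ. \<eta> x = of_real (m x) * \<phi> x" by eventually_elim (simp add: \<psi>_def)
    then show ?thesis unfolding A using \<phi> \<eta> by simp
  qed
  have 3: "\<phi> \<in> L2 \<and> \<eta> \<in> L2" if "(\<phi>, \<eta>) \<in> ?A" for \<phi> \<eta> using that unfolding A by simp
  show ?thesis unfolding self_adjoint_op_def
  proof (intro antisym subrelI)
    fix \<phi> \<eta> assume "(\<phi>, \<eta>) \<in> ?A"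
    with 1 3 show "(\<phi>, \<eta>) \<in> {(\<phi>, \<eta>). \<phi> \<in> L2 \<and> \<eta> \<in> L2 \<and>
        (\<forall>(\<psi>, g)\<in>?A. L2_inner g \<phi> = L2_inner \<psi> \<eta>)}" by blast
  next
    fix \<phi> \<eta> assume "(\<phi>, \<eta>) \<in> {(\<phi>, \<eta>). \<phi> \<in> L2 \<and> \<eta> \<in> L2 \<and>
        (\<forall>(\<psi>, g)\<in>?A. L2_inner g \<phi> = L2_inner \<psi> \<eta>)}"
    then show "(\<phi>, \<eta>) \<in> ?A" by (intro 2) auto
  qed
qed

section \<open>Travelling waves as smooth curves of symbols\<close>

lemma japanese_pos: "japanese j > 0" and japanese_ge_1: "japanese j \<ge> 1"
  unfolding japanese_def by (auto simp: add_pos_nonneg)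

text \<open>
  Differentiation shifts the phase of a cosine by a quarter period, so all derivatives of a
  difference quotient of travelling waves (a combination of three cosines) have the same form and
  obey the same bound.
\<close>

lemma deriv_funpow_phase:
  "(deriv ^^ n) (\<lambda>x. a * cos (x - s) + b * cos (x - s') + c * cos (x - s'')) =
     (\<lambda>x::real. a * cos (x - s + n * (pi/2)) + b * cos (x - s' + n * (pi/2)) + c * cos (x - s'' + n * (pi/2)))"
proof (induction n)
  case (Suc n)
  have c: "cos (y + real (Suc n) * (pi/2)) = - sin (y + n * (pi/2))" for y
    by (simp add: algebra_simps cos_add sin_add add_divide_distrib)
  show ?case
    unfolding funpow.simps o_apply Suc c
    by (intro ext DERIV_imp_deriv) (auto intro!: derivative_eq_intros)
qed simp

lemma symb_deriv_multiplier:
  "symb_deriv \<alpha> \<beta> (\<lambda>x j. m x) = (\<lambda>x j. if \<beta> = 0 then (deriv ^^ \<alpha>) m x else 0)"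
proof -
  have "(symb_diff ^^ Suc b) (\<lambda>x j. m x) = (\<lambda>x j. 0)" for b
    by (induction b) (auto simp: symb_diff_def)
  moreover have "(deriv ^^ n) (\<lambda>x::real. 0::real) = (\<lambda>x. 0)" for n
    by (induction n) auto
  ultimately show ?thesis
    by (cases \<beta>) (auto simp: symb_deriv_def simp del: funpow.simps)
qed

lemma cos_multiplier_in_symbol_class: "(\<lambda>x j. a * cos (x - s)) \<in> symbol_class 0"
proof -
  have d: "(deriv ^^ n) (\<lambda>x. a * cos (x - s)) = (\<lambda>x. a * cos (x - s + n * (pi/2)))" for n
    using deriv_funpow_phase[of n a s 0 0 0 0] by simp
  have df: "(\<lambda>y. cos (y - s + r)) differentiable at x" for r x
    unfolding real_differentiable_def by (rule exI) (auto intro!: derivative_eq_intros)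
  have "\<exists>C>0. \<forall>x j. \<bar>symb_deriv \<alpha> \<beta> (\<lambda>x j. a * cos (x - s)) x j\<bar> \<le> C * japanese j powr (0 - real \<beta>)" for \<alpha> \<beta>
  proof (intro exI[of _ "\<bar>a\<bar> + 1"] conjI allI)
    fix x j
    have "\<bar>a * cos y\<bar> \<le> \<bar>a\<bar> + 1" for y
      using mult_left_mono[OF abs_cos_le_one abs_ge_zero, of a y] by (simp add: abs_mult)
    then show "\<bar>symb_deriv \<alpha> \<beta> (\<lambda>x j. a * cos (x - s)) x j\<bar> \<le> (\<bar>a\<bar> + 1) * japanese j powr (0 - real \<beta>)"
      using japanese_pos[of j] by (auto simp: symb_deriv_multiplier d)
  qed simp
  moreover have "cos (x + 2 * pi - s) = cos (x - s)" for x
    using cos_periodic[of "x - s"] by (simp add: algebra_simps)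
  ultimately show ?thesis
    unfolding symbol_class_def by (auto simp: d intro!: df)
qed

lemma symbol_seminorm_multiplier_le:
  assumes "\<And>\<alpha> x. \<bar>(deriv ^^ \<alpha>) m x\<bar> \<le> K"
  shows "symbol_seminorm 0 k (\<lambda>x j. m x) \<le> real ((k + 1)\<^sup>2) * K" "0 \<le> symbol_seminorm 0 k (\<lambda>x j. m x)"
proof -
  let ?f = "\<lambda>\<alpha> \<beta>. \<lambda>(x::real, j). japanese j powr (- 0 + real \<beta>) * \<bar>symb_deriv \<alpha> \<beta> (\<lambda>x j. m x) x j\<bar>"
  have K: "K \<ge> 0" using assms[of 0 0] by linarith
  have le: "?f \<alpha> \<beta> z \<le> K" for \<alpha> \<beta> z
    unfolding symb_deriv_multiplier using assms K japanese_pos[of "snd z"] by (cases z) auto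
  have ge: "0 \<le> ?f \<alpha> \<beta> z" for \<alpha> \<beta> z by (auto split: prod.splits)
  have Sle: "(SUP z\<in>UNIV. ?f \<alpha> \<beta> z) \<le> K" for \<alpha> \<beta> by (rule cSUP_least[OF _ le]) simp
  have Sge: "0 \<le> (SUP z\<in>UNIV. ?f \<alpha> \<beta> z)" for \<alpha> \<beta>
    using ge[where \<alpha>=\<alpha> and \<beta>=\<beta> and z="(0,0)"] by (rule order_trans) (intro cSUP_upper bdd_aboveI2[where M=K] le UNIV_I)
  have sub: "{(\<alpha>, \<beta>). \<alpha> + \<beta> \<le> k} \<subseteq> {..k} \<times> {..k}" by auto
  have "card {(\<alpha>, \<beta>). \<alpha> + \<beta> \<le> k} \<le> (k + 1)\<^sup>2"
    using card_mono[OF _ sub] by (simp add: power2_eq_square)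
  then have card: "real (card {(\<alpha>, \<beta>). \<alpha> + \<beta> \<le> k}) * K \<le> real ((k + 1)\<^sup>2) * K"
    using K by (intro mult_right_mono) linarith+
  have "symbol_seminorm 0 k (\<lambda>x j. m x) \<le> (\<Sum>(\<alpha>, \<beta>)\<in>{(\<alpha>, \<beta>). \<alpha> + \<beta> \<le> k}. K)"
    unfolding symbol_seminorm_def by (intro sum_mono) (use Sle in \<open>auto simp: case_prod_unfold\<close>)
  also have "\<dots> \<le> real ((k + 1)\<^sup>2) * K" using card by (simp add: case_prod_unfold)
  finally show "symbol_seminorm 0 k (\<lambda>x j. m x) \<le> real ((k + 1)\<^sup>2) * K" .
  show "0 \<le> symbol_seminorm 0 k (\<lambda>x j. m x)"
    unfolding symbol_seminorm_def by (intro sum_nonneg) (use Sge in \<open>auto simp: case_prod_unfold\<close>)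
qed

lemma cos_taylor:
  fixes y h :: real
  shows "\<bar>cos (y + h) - cos y + h * sin y\<bar> \<le> h\<^sup>2"
proof -
  have sin_lip: "\<bar>sin (y + s) - sin y\<bar> \<le> \<bar>s\<bar>" for s
    using field_differentiable_bound[of UNIV sin cos 1 "y + s" y]
    by (auto simp: has_field_derivative_at_within)
  let ?f = "\<lambda>s. cos (y + s) - cos y + s * sin y"
  have "norm (?f h - ?f 0) \<le> \<bar>h\<bar> * norm (h - 0)"
  proof (rule field_differentiable_bound[where S="{-\<bar>h\<bar>..\<bar>h\<bar>}" and f="?f" and f'="\<lambda>s. sin y - sin (y + s)"])
    show "(?f has_field_derivative sin y - sin (y + s)) (at s within {-\<bar>h\<bar>..\<bar>h\<bar>})" for s
      by (auto intro!: derivative_eq_intros)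
    show "norm (sin y - sin (y + s)) \<le> \<bar>h\<bar>" if "s \<in> {-\<bar>h\<bar>..\<bar>h\<bar>}" for s
      using sin_lip[of s] that by auto
  qed auto
  then show ?thesis by (simp add: power2_eq_square)
qed

lemma smooth_symbol_curve_travelling_wave:
  "smooth_symbol_curve 0 (\<lambda>t x j. a * cos (x - t))"
  unfolding smooth_symbol_curve_def
proof (intro conjI allI exI)
  \<comment> \<open>Differentiating \<open>n\<close> times in \<open>t\<close> delays the wave by \<open>n\<close> quarter periods.\<close>
  let ?w = "\<lambda>(n::nat) t (x::real) (j::int). a * cos (x - (t + n * (pi / 2)))"
  show "(\<lambda>x j. a * cos (x - (t + 2 * pi))) = (\<lambda>x (j::int). a * cos (x - t))" for t
  proof -
    have "cos (x - (t + 2 * pi)) = cos (x - t)" for x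
      using cos_periodic[of "x - t - 2*pi"] by (simp add: algebra_simps)
    then show ?thesis by simp
  qed
  show "?w 0 = (\<lambda>t x j. a * cos (x - t))" by simp
  show "?w n t \<in> symbol_class 0" for n t by (rule cos_multiplier_in_symbol_class)
  fix n :: nat and t :: real and k :: nat
  let ?m = "\<lambda>h x. (a * cos (x - (t + h + n * (pi / 2))) - a * cos (x - (t + n * (pi / 2)))) / h
       - a * cos (x - (t + Suc n * (pi / 2)))"
  have bound: "\<bar>(deriv ^^ \<alpha>) (?m h) x\<bar> \<le> \<bar>a\<bar> * \<bar>h\<bar>" if "h \<noteq> 0" for h \<alpha> x
  proof -
    have "?m h = (\<lambda>x. (a / h) * cos (x - (t + h + n * (pi / 2))) + (- a / h) * cos (x - (t + n * (pi / 2)))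
       + (- a) * cos (x - (t + Suc n * (pi / 2))))"
      using that by (auto simp: field_simps)
    then have "(deriv ^^ \<alpha>) (?m h) x = (a / h) * cos (x - (t + h + n * (pi / 2)) + \<alpha> * (pi / 2))
        + (- a / h) * cos (x - (t + n * (pi / 2)) + \<alpha> * (pi / 2))
        + (- a) * cos (x - (t + Suc n * (pi / 2)) + \<alpha> * (pi / 2))"
      by (simp only: deriv_funpow_phase)
    also have "\<dots> = (a / h) * (cos (y + (- h)) - cos y + (- h) * sin y)"
      if "y = x - (t + n * (pi / 2)) + \<alpha> * (pi / 2)" for y
    proof -
      have 1: "x - (t + h + n * (pi / 2)) + \<alpha> * (pi / 2) = y + (- h)" unfolding that by simp
      have 2: "x - (t + Suc n * (pi / 2)) + \<alpha> * (pi / 2) = y - pi / 2" unfolding that by (simp add: field_simps)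
      have 3: "cos (y - pi / 2) = sin y" by (simp add: cos_diff)
      show ?thesis unfolding 1 2 3 that[symmetric] using \<open>h \<noteq> 0\<close>
        by (simp add: field_simps)
    qed
    finally obtain y where "(deriv ^^ \<alpha>) (?m h) x = (a / h) * (cos (y + (- h)) - cos y + (- h) * sin y)"
      by blast
    then have "\<bar>(deriv ^^ \<alpha>) (?m h) x\<bar> \<le> \<bar>a / h\<bar> * (- h)\<^sup>2"
      using mult_left_mono[OF cos_taylor[of y "- h"] abs_ge_zero[of "a / h"]] by (simp only: abs_mult)
    also have "(- h)\<^sup>2 = \<bar>h\<bar> * \<bar>h\<bar>" by (simp add: power2_eq_square)
    also have "\<bar>a / h\<bar> * (\<bar>h\<bar> * \<bar>h\<bar>) = \<bar>a / h * h\<bar> * \<bar>h\<bar>" by (simp only: abs_mult mult.assoc)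
    also have "a / h * h = a" using that by simp
    finally show ?thesis .
  qed
  show "((\<lambda>h. symbol_seminorm 0 k (\<lambda>x j. (?w n (t + h) x j - ?w n t x j) / h - ?w (Suc n) t x j)) \<longlongrightarrow> 0) (at 0)"
  proof (rule tendsto_sandwich)
    show "\<forall>\<^sub>F h in at 0. 0 \<le> symbol_seminorm 0 k (\<lambda>x j. ?m h x)"
      unfolding eventually_at using symbol_seminorm_multiplier_le(2)[OF bound]
      by (intro exI[of _ 1]) simp
    show "\<forall>\<^sub>F h in at 0. symbol_seminorm 0 k (\<lambda>x j. ?m h x) \<le> real ((k + 1)\<^sup>2) * (\<bar>a\<bar> * \<bar>h\<bar>)"
      unfolding eventually_at using symbol_seminorm_multiplier_le(1)[OF bound]
      by (intro exI[of _ 1]) simp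
    show "((\<lambda>h. real ((k + 1)\<^sup>2) * (\<bar>a\<bar> * \<bar>h\<bar>)) \<longlongrightarrow> 0) (at 0)"
      by (rule tendsto_eq_intros refl | simp)+
  qed auto
qed

section \<open>Rapidly decreasing sequences\<close>

definition wt :: "int \<Rightarrow> real" where "wt j = 1 + \<bar>of_int j\<bar>"

lemma wt_ge_1: "wt j \<ge> 1" and wt_pos: "wt j > 0"
  unfolding wt_def by auto

text \<open>
  All \<open>t\<close>-dependent sequences below decay faster than every power of \<open>1 + |j|\<close>, locally uniformly in
  \<open>t\<close>. This one class is stable under shifts, products and polynomial weights, and justifies every
  rearrangement and termwise differentiation of a sum over the lattice.
\<close>

definition rapid :: "(real \<Rightarrow> int \<Rightarrow> 'a::real_normed_vector) \<Rightarrow> bool" where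
  "rapid c \<longleftrightarrow> (\<forall>T k. \<exists>C. \<forall>t j. \<bar>t\<bar> \<le> T \<longrightarrow> wt j ^ k * norm (c t j) \<le> C)"

lemma rapidE:
  assumes "rapid c"
  obtains C where "C \<ge> 0" "\<And>t j. \<bar>t\<bar> \<le> T \<Longrightarrow> wt j ^ k * norm (c t j) \<le> C"
proof -
  obtain C where "\<And>t j. \<bar>t\<bar> \<le> T \<Longrightarrow> wt j ^ k * norm (c t j) \<le> C"
    using assms unfolding rapid_def by meson
  then show ?thesis by (intro that[of "max C 0"]) (auto simp: max.coboundedI1)
qed

lemma rapid_dominated:
  assumes "rapid c" "\<And>T. \<exists>K\<ge>0. \<forall>t j. \<bar>t\<bar> \<le> T \<longrightarrow> norm (d t j) \<le> K * wt j ^ p * norm (c t j)"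
  shows "rapid d"
  unfolding rapid_def
proof (intro allI)
  fix T :: real and k :: nat
  obtain K where K: "K \<ge> 0" "\<And>t j. \<bar>t\<bar> \<le> T \<Longrightarrow> norm (d t j) \<le> K * wt j ^ p * norm (c t j)"
    using assms(2) by blast
  obtain C where C: "\<And>t j. \<bar>t\<bar> \<le> T \<Longrightarrow> wt j ^ (k + p) * norm (c t j) \<le> C"
    using rapidE[OF assms(1)] by metis
  have "wt j ^ k * norm (d t j) \<le> K * C" if "\<bar>t\<bar> \<le> T" for t j
  proof -
    have "wt j ^ k * norm (d t j) \<le> wt j ^ k * (K * wt j ^ p * norm (c t j))"
      using K(2)[OF that] wt_pos[of j] by (intro mult_left_mono) auto
    also have "\<dots> = K * (wt j ^ (k + p) * norm (c t j))" by (simp add: power_add)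
    also have "\<dots> \<le> K * C" using C[OF that] K(1) by (intro mult_left_mono) auto
    finally show ?thesis .
  qed
  then show "\<exists>C. \<forall>t j. \<bar>t\<bar> \<le> T \<longrightarrow> wt j ^ k * norm (d t j) \<le> C" by blast
qed

lemma rapid_poly_mult:
  fixes c :: "real \<Rightarrow> int \<Rightarrow> 'a::real_normed_algebra"
  assumes "rapid c" "\<And>t j. norm (m t j) \<le> K * wt j ^ p"
  shows "rapid (\<lambda>t j. m t j * c t j)"
proof (rule rapid_dominated[OF assms(1), where p=p], intro exI[of _ "\<bar>K\<bar>"] conjI allI impI)
  fix t j
  have "norm (m t j * c t j) \<le> (K * wt j ^ p) * norm (c t j)"
    using assms(2)[of t j] by (intro order_trans[OF norm_mult_ineq] mult_right_mono) auto
  also have "\<dots> \<le> (\<bar>K\<bar> * wt j ^ p) * norm (c t j)"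
    using wt_pos[of j] by (intro mult_right_mono) auto
  finally show "norm (m t j * c t j) \<le> \<bar>K\<bar> * wt j ^ p * norm (c t j)" by simp
qed simp

lemma rapid_norm_le:
  assumes "rapid c" "\<And>t j. norm (d t j) \<le> norm (c t j)"
  shows "rapid d"
  using assms by (intro rapid_dominated[OF assms(1), where p=0]) (auto intro!: exI[of _ 1])

lemma rapid_add:
  assumes "rapid c" "rapid d"
  shows "rapid (\<lambda>t j. c t j + d t j)"
  unfolding rapid_def
proof (intro allI)
  fix T :: real and k :: nat
  obtain C where C: "\<And>t j. \<bar>t\<bar> \<le> T \<Longrightarrow> wt j ^ k * norm (c t j) \<le> C" using rapidE[OF assms(1)] by metis
  obtain D where D: "\<And>t j. \<bar>t\<bar> \<le> T \<Longrightarrow> wt j ^ k * norm (d t j) \<le> D" using rapidE[OF assms(2)] by metis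
  have "wt j ^ k * norm (c t j + d t j) \<le> C + D" if "\<bar>t\<bar> \<le> T" for t j
  proof -
    have "wt j ^ k * norm (c t j + d t j) \<le> wt j ^ k * (norm (c t j) + norm (d t j))"
      using wt_pos[of j] by (intro mult_left_mono norm_triangle_ineq) auto
    then show ?thesis using C[OF that, of j] D[OF that, of j] by (simp add: distrib_left)
  qed
  then show "\<exists>C. \<forall>t j. \<bar>t\<bar> \<le> T \<longrightarrow> wt j ^ k * norm (c t j + d t j) \<le> C" by blast
qed

lemma rapid_minus: "rapid c \<Longrightarrow> rapid (\<lambda>t j. - c t j)"
  by (rule rapid_norm_le) auto

lemma rapid_diff: "rapid c \<Longrightarrow> rapid d \<Longrightarrow> rapid (\<lambda>t j. c t j - d t j)"
  using rapid_add[OF _ rapid_minus] by force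

lemma rapid_shift:
  assumes "rapid c"
  shows "rapid (\<lambda>t j. c t (j + s))"
  unfolding rapid_def
proof (intro allI)
  fix T :: real and k :: nat
  obtain C where C: "\<And>t j. \<bar>t\<bar> \<le> T \<Longrightarrow> wt j ^ k * norm (c t j) \<le> C" using rapidE[OF assms(1)] by metis
  have "wt j ^ k * norm (c t (j + s)) \<le> wt s ^ k * C" if "\<bar>t\<bar> \<le> T" for t j
  proof -
    have "wt j \<le> wt s + wt (j + s) - 1" unfolding wt_def by linarith
    also have "\<dots> = wt s * wt (j + s) - (wt s - 1) * (wt (j + s) - 1)" by (simp add: algebra_simps)
    also have "\<dots> \<le> wt s * wt (j + s)" using wt_ge_1[of s] wt_ge_1[of "j + s"] by simp
    finally have "wt j ^ k \<le> wt s ^ k * wt (j + s) ^ k"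
      using power_mono[of "wt j" "wt s * wt (j + s)" k] wt_pos[of j] by (simp add: power_mult_distrib)
    then have "wt j ^ k * norm (c t (j + s)) \<le> wt s ^ k * wt (j + s) ^ k * norm (c t (j + s))"
      by (rule mult_right_mono) simp
    also have "\<dots> \<le> wt s ^ k * C"
      using C[OF that, of "j + s"] wt_pos[of s] by (simp add: mult.assoc mult_left_mono)
    finally show ?thesis .
  qed
  then show "\<exists>C. \<forall>t j. \<bar>t\<bar> \<le> T \<longrightarrow> wt j ^ k * norm (c t (j + s)) \<le> C" by blast
qed

lemma rapid_prod:
  fixes c d :: "real \<Rightarrow> int \<Rightarrow> 'a::real_normed_algebra"
  assumes "rapid c" "rapid d"
  shows "rapid (\<lambda>t j. c t j * d t j)"
proof (rule rapid_dominated[OF assms(2), where p=0])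
  fix T :: real
  obtain C where C: "C \<ge> 0" "\<And>t j. \<bar>t\<bar> \<le> T \<Longrightarrow> wt j ^ 0 * norm (c t j) \<le> C"
    using rapidE[OF assms(1)] by metis
  then have "norm (c t j * d t j) \<le> C * norm (d t j)" if "\<bar>t\<bar> \<le> T" for t j
    using that by (intro order_trans[OF norm_mult_ineq] mult_right_mono) auto
  with C(1) show "\<exists>K\<ge>0. \<forall>t j. \<bar>t\<bar> \<le> T \<longrightarrow> norm (c t j * d t j) \<le> K * wt j ^ 0 * norm (d t j)"
    by auto
qed

lemma summable_on_inverse_wt_sq: "(\<lambda>j. 1 / wt j ^ 2) summable_on (UNIV :: int set)"
proof -
  have "summable (\<lambda>n. inverse (real (Suc n) ^ 2))"
    using inverse_power_summable[of 2, where 'a=real] by (subst summable_Suc_iff) auto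
  then have N: "(\<lambda>n. inverse (real (Suc n) ^ 2)) summable_on UNIV"
    by (simp add: summable_on_UNIV_nonneg_real_iff)
  have "(\<lambda>j. 1 / wt j ^ 2) summable_on range int"
    by (subst summable_on_reindex) (use N in \<open>auto simp: o_def wt_def inverse_eq_divide\<close>)
  moreover have "(\<lambda>j. 1 / wt j ^ 2) summable_on range (\<lambda>n. - int n)"
    by (subst summable_on_reindex) (use N in \<open>auto simp: o_def wt_def inverse_eq_divide inj_on_def\<close>)
  ultimately have "(\<lambda>j. 1 / wt j ^ 2) summable_on range int \<union> (range (\<lambda>n. - int n) - range int)"
    by (intro summable_on_Un_disjoint) (auto intro: summable_on_subset_banach)
  also have "range int \<union> (range (\<lambda>n. - int n) - range int) = UNIV"
  proof -
    have "j \<in> range int \<union> range (\<lambda>n. - int n)" for j by (cases j rule: int_cases2) auto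
    then show ?thesis by blast
  qed
  finally show ?thesis .
qed

lemma rapid_bound_inverse_sq:
  assumes "rapid c"
  obtains C where "C \<ge> 0" "\<And>t j. \<bar>t\<bar> \<le> T \<Longrightarrow> norm (c t j) \<le> C * (1 / wt j ^ 2)"
proof -
  obtain C where C: "C \<ge> 0" "\<And>t j. \<bar>t\<bar> \<le> T \<Longrightarrow> wt j ^ 2 * norm (c t j) \<le> C"
    using rapidE[OF assms] by metis
  have "norm (c t j) \<le> C * (1 / wt j ^ 2)" if "\<bar>t\<bar> \<le> T" for t j
    using C(2)[OF that, of j] wt_pos[of j] by (simp add: pos_le_divide_eq mult.commute)
  with C(1) show ?thesis by (rule that)
qed

lemma rapid_abs_summable:
  assumes "rapid c"
  shows "(\<lambda>j. norm (c t j)) summable_on UNIV"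
proof -
  obtain C where C: "\<And>s j. \<bar>s\<bar> \<le> \<bar>t\<bar> \<Longrightarrow> norm (c s j) \<le> C * (1 / wt j ^ 2)"
    using rapid_bound_inverse_sq[OF assms] by metis
  show ?thesis
    by (rule summable_on_comparison_test[OF summable_on_cmult_right[OF summable_on_inverse_wt_sq, of C]])
       (use C in auto)
qed

lemma rapid_summable:
  fixes c :: "real \<Rightarrow> int \<Rightarrow> 'a::banach"
  assumes "rapid c"
  shows "c t summable_on UNIV"
  using abs_summable_summable[OF rapid_abs_summable[OF assms]] .

lemma infsum_int_eq_suminf:
  fixes f :: "int \<Rightarrow> real"
  assumes "(\<lambda>j. norm (f j)) summable_on UNIV"
  shows "infsum f UNIV = (\<Sum>n. f (int_decode n))" "summable (\<lambda>n. norm (f (int_decode n)))"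
proof -
  have "((\<lambda>n. norm (f (int_decode n))) summable_on UNIV) \<longleftrightarrow> ((\<lambda>j. norm (f j)) summable_on UNIV)"
    by (rule summable_on_reindex_bij_betw[OF bij_int_decode])
  with assms have s: "(\<lambda>n. norm (f (int_decode n))) summable_on UNIV" by (simp only:)
  from s show "summable (\<lambda>n. norm (f (int_decode n)))"
    by (simp only: summable_on_UNIV_nonneg_real_iff[OF norm_ge_zero])
  have "infsum (\<lambda>n. f (int_decode n)) UNIV = infsum f UNIV"
    by (rule infsum_reindex_bij_betw[OF bij_int_decode])
  moreover have "((\<lambda>n. f (int_decode n)) has_sum infsum (\<lambda>n. f (int_decode n)) UNIV) UNIV"
    by (rule has_sum_infsum[OF abs_summable_summable[OF s]])
  then have "(\<lambda>n. f (int_decode n)) sums infsum (\<lambda>n. f (int_decode n)) UNIV"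
    by (rule has_sum_imp_sums)
  then have "infsum (\<lambda>n. f (int_decode n)) UNIV = (\<Sum>n. f (int_decode n))"
    by (rule sums_unique)
  ultimately show "infsum f UNIV = (\<Sum>n. f (int_decode n))" by (simp only:)
qed

lemma rapid_sum_has_derivative:
  fixes c c' :: "real \<Rightarrow> int \<Rightarrow> real"
  assumes "rapid c" "rapid c'" "\<And>t j. ((\<lambda>t. c t j) has_real_derivative c' t j) (at t)"
  shows "((\<lambda>t. \<Sum>\<^sub>\<infinity>j. c t j) has_real_derivative (\<Sum>\<^sub>\<infinity>j. c' t j)) (at t)"
proof -
  define S where "S = {- (\<bar>t\<bar> + 1)..\<bar>t\<bar> + 1}"
  obtain C where C: "C \<ge> 0" "\<And>s j. \<bar>s\<bar> \<le> \<bar>t\<bar> + 1 \<Longrightarrow> norm (c' s j) \<le> C * (1 / wt j ^ 2)"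
    using rapid_bound_inverse_sq[OF assms(2)] by metis
  have 1: "((\<lambda>t. \<Sum>n. c t (int_decode n)) has_field_derivative (\<Sum>n. c' t (int_decode n))) (at t)"
  proof (rule has_field_derivative_series'(2)[where S=S and ?x0.0=t and x=t])
    show "convex S" "t \<in> S" "t \<in> interior S" unfolding S_def by auto
    show "((\<lambda>t. c t (int_decode n)) has_field_derivative c' x (int_decode n)) (at x within S)" for n x
      by (rule has_field_derivative_at_within[OF assms(3)])
    show "uniformly_convergent_on S (\<lambda>n x. \<Sum>i<n. c' x (int_decode i))"
    proof (rule Weierstrass_m_test')
      show "norm (c' x (int_decode n)) \<le> C * (1 / wt (int_decode n) ^ 2)" if "x \<in> S" for n x
        using C(2)[of x] that unfolding S_def by auto
      have nn: "norm (C * (1 / wt j ^ 2)) = C * (1 / wt j ^ 2)" for j using C(1) by simp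
      show "summable (\<lambda>n. C * (1 / wt (int_decode n) ^ 2))"
        by (rule infsum_int_eq_suminf(2)[of "\<lambda>j. C * (1 / wt j ^ 2)", unfolded nn])
           (rule summable_on_cmult_right[OF summable_on_inverse_wt_sq])
    qed
    show "summable (\<lambda>n. c t (int_decode n))"
      by (rule summable_norm_cancel[OF infsum_int_eq_suminf(2)[OF rapid_abs_summable[OF assms(1)]]])
  qed
  show ?thesis
    unfolding infsum_int_eq_suminf(1)[OF rapid_abs_summable[OF assms(1)]]
      infsum_int_eq_suminf(1)[OF rapid_abs_summable[OF assms(2)]] by (rule 1)
qed

section \<open>Linear systems with nearest-neighbour coupling\<close>

text \<open>
  The primitive that vanishes at \<open>0\<close>, for times of both signs.
\<close>

definition prim :: "(real \<Rightarrow> complex) \<Rightarrow> real \<Rightarrow> complex" where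
  "prim f t = (if t \<ge> 0 then integral {0..t} f else - integral {t..0} f)"

lemma prim_0 [simp]: "prim f 0 = 0"
  unfolding prim_def by simp

lemma prim_has_vector_derivative:
  assumes "continuous_on UNIV f"
  shows "(prim f has_vector_derivative f t) (at t)"
proof -
  define T where "T = \<bar>t\<bar> + 1"
  have cont: "continuous_on S f" for S using assms continuous_on_subset by blast
  have int: "f integrable_on {a..b}" for a b by (intro integrable_continuous_real cont)
  have eq: "prim f u = integral {-T..u} f - integral {-T..0} f" if "u \<in> {-T<..<T}" for u
  proof (cases "u \<ge> 0")
    case True
    then show ?thesis unfolding prim_def
      using Henstock_Kurzweil_Integration.integral_combine[of "-T" 0 u f] int that by (simp add: algebra_simps)
  next
    case False
    then show ?thesis unfolding prim_def
      using Henstock_Kurzweil_Integration.integral_combine[of "-T" u 0 f] int that by (simp add: algebra_simps)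
  qed
  have "((\<lambda>u. integral {-T..u} f) has_vector_derivative f t) (at t within {-T..T})"
    by (intro integral_has_vector_derivative cont) (auto simp: T_def)
  then have "((\<lambda>u. integral {-T..u} f) has_vector_derivative f t) (at t)"
    by (subst (asm) at_within_interior) (auto simp: T_def)
  then have "((\<lambda>u. integral {-T..u} f - integral {-T..0} f) has_vector_derivative f t - 0) (at t)"
    by (intro derivative_intros)
  then have "((\<lambda>u. integral {-T..u} f - integral {-T..0} f) has_vector_derivative f t) (at t)" by simp
  then show ?thesis
    by (rule has_vector_derivative_transform_within_open[where S="{-T<..<T}"]) (use eq in \<open>auto simp: T_def\<close>)
qed

lemma integral_power_bound:
  fixes f :: "real \<Rightarrow> complex"
  assumes "continuous_on UNIV f" "\<And>s. norm (f s) \<le> K * \<bar>s\<bar> ^ n" "t \<ge> 0"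
  shows "norm (integral {0..t} f) \<le> K * t ^ Suc n / real (Suc n)"
proof -
  have "((\<lambda>s. K * s ^ Suc n / real (Suc n)) has_real_derivative K * s ^ n) (at s within {0..t})" for s
  proof -
    have "((\<lambda>s. K * s ^ Suc n / real (Suc n)) has_real_derivative K * (real (Suc n) * s ^ n) / real (Suc n)) (at s within {0..t})"
      using DERIV_pow[of "Suc n" s "{0..t}"] by (intro DERIV_cdivide DERIV_cmult) simp
    then show ?thesis by simp
  qed
  then have I: "((\<lambda>s. K * s ^ n) has_integral K * t ^ Suc n / real (Suc n) - K * 0 ^ Suc n / real (Suc n)) {0..t}"
    by (intro fundamental_theorem_of_calculus assms(3)) (simp flip: has_real_derivative_iff_has_vector_derivative)
  have "norm (integral {0..t} f) \<le> integral {0..t} (\<lambda>s. K * s ^ n)"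
  proof (rule integral_norm_bound_integral)
    show "f integrable_on {0..t}"
      by (intro integrable_continuous_real continuous_on_subset[OF assms(1)]) auto
    show "norm (f s) \<le> K * s ^ n" if "s \<in> {0..t}" for s using assms(2)[of s] that by simp
  qed (use I in blast)
  then show ?thesis unfolding integral_unique[OF I] by simp
qed

lemma prim_power_bound:
  assumes "continuous_on UNIV f" "\<And>s. norm (f s) \<le> K * \<bar>s\<bar> ^ n"
  shows "norm (prim f t) \<le> K * \<bar>t\<bar> ^ Suc n / real (Suc n)"
proof (cases "t \<ge> 0")
  case True
  then show ?thesis using integral_power_bound[OF assms True] unfolding prim_def by simp
next
  case False
  have "continuous_on UNIV (\<lambda>s. f (- s))"
    by (intro continuous_on_compose2[OF assms(1)] continuous_intros) auto
  then have "norm (integral {0..- t} (\<lambda>s. f (- s))) \<le> K * (- t) ^ Suc n / real (Suc n)"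
    using False assms(2)[of "- s" for s] by (intro integral_power_bound) auto
  moreover have "integral {0..- t} (\<lambda>s. f (- s)) = integral {t..0} f"
    using Henstock_Kurzweil_Integration.integral_reflect_real[of 0 t f] by (simp only: minus_zero)
  ultimately show ?thesis using False unfolding prim_def by simp
qed

lemma exponential_series_real: "(\<lambda>n. x ^ n / fact n) sums exp (x::real)"
  using exp_converges[of x] by (simp add: scaleR_conv_of_real field_simps)

lemma suminf_has_vector_derivative:
  fixes f :: "nat \<Rightarrow> real \<Rightarrow> complex"
  assumes "\<And>n t. (f n has_vector_derivative f' n t) (at t)"
    and "\<And>n t. \<bar>t\<bar> \<le> T \<Longrightarrow> norm (f' n t) \<le> M n" "summable M"
    and "\<bar>t0\<bar> < T" "\<And>t. summable (\<lambda>n. f n t)"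
  shows "((\<lambda>t. \<Sum>n. f n t) has_vector_derivative (\<Sum>n. f' n t0)) (at t0)"
proof -
  have sf': "summable (\<lambda>n. f' n t0)"
    using assms(2)[of t0] assms(4) by (intro summable_comparison_test'[OF assms(3), of 0]) auto
  have part: "((\<lambda>t. \<Sum>n. g (f n t)) has_real_derivative (\<Sum>n. g (f' n t0))) (at t0)"
    if g: "bounded_linear g" "\<And>z. \<bar>g z\<bar> \<le> cmod z" for g :: "complex \<Rightarrow> real"
  proof (rule has_field_derivative_series'(2)[where S="{-T..T}" and ?x0.0=t0 and x=t0])
    show "convex {-T..T}" "t0 \<in> {-T..T}" "t0 \<in> interior {-T..T}" using assms(4) by auto
    show "((\<lambda>t. g (f n t)) has_field_derivative g (f' n t)) (at t within {-T..T})" for n t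
      unfolding has_real_derivative_iff_has_vector_derivative
      by (rule has_vector_derivative_at_within[OF bounded_linear.has_vector_derivative[OF g(1) assms(1)]])
    show "uniformly_convergent_on {-T..T} (\<lambda>n x. \<Sum>i<n. g (f' i x))"
    proof (rule Weierstrass_m_test'[OF _ assms(3)])
      show "norm (g (f' n x)) \<le> M n" if "x \<in> {-T..T}" for n x
      proof -
        have "norm (f' n x) \<le> M n" using that by (intro assms(2)) auto
        with g(2)[of "f' n x"] show ?thesis by simp
      qed
    qed
    show "summable (\<lambda>n. g (f n t0))" by (rule bounded_linear.summable[OF g(1) assms(5)])
  qed
  have "(\<Sum>n. f n t) = Complex (\<Sum>n. Re (f n t)) (\<Sum>n. Im (f n t))" for t
    using bounded_linear.suminf[OF bounded_linear_Re assms(5)] bounded_linear.suminf[OF bounded_linear_Im assms(5)]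
    by (simp add: complex_eq_iff)
  moreover have "(\<Sum>n. f' n t0) = Complex (\<Sum>n. Re (f' n t0)) (\<Sum>n. Im (f' n t0))"
    using bounded_linear.suminf[OF bounded_linear_Re sf'] bounded_linear.suminf[OF bounded_linear_Im sf']
    by (simp add: complex_eq_iff)
  ultimately show ?thesis
    using part[OF bounded_linear_Re abs_Re_le_cmod] part[OF bounded_linear_Im abs_Im_le_cmod]
    by (simp add: has_vector_derivative_complex_iff)
qed

text \<open>
  A weight that changes at most by the factor \<open>2\<close> between neighbours, so that nearest-neighbour coupling
  is bounded in the weighted supremum norm; it also dominates the packet used as initial datum, and
  is itself rapidly decreasing.
\<close>

definition decay :: "int \<Rightarrow> real" where "decay j = (1/2) ^ nat \<bar>j\<bar>"

lemma decay_pos: "decay j > 0" unfolding decay_def by simp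

lemma decay_shift_le: "decay (j + 1) \<le> 2 * decay j" "decay (j - 1) \<le> 2 * decay j"
proof -
  have "decay k \<le> 2 * decay j" if "nat \<bar>j\<bar> \<le> Suc (nat \<bar>k\<bar>)" for k
  proof -
    have "(1/2::real) ^ Suc (nat \<bar>k\<bar>) \<le> (1/2) ^ nat \<bar>j\<bar>" using that by (intro power_decreasing) auto
    then show ?thesis unfolding decay_def by simp
  qed
  then show "decay (j + 1) \<le> 2 * decay j" "decay (j - 1) \<le> 2 * decay j" by auto
qed

context
  fixes A B :: "int \<Rightarrow> real \<Rightarrow> complex" and p0 :: "int \<Rightarrow> complex"
begin

primrec dyson :: "nat \<Rightarrow> int \<Rightarrow> real \<Rightarrow> complex" where
  "dyson 0 j = (\<lambda>t. p0 j)"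
| "dyson (Suc n) j = prim (\<lambda>s. A j s * dyson n (j - 1) s + B j s * dyson n (j + 1) s)"

end

text \<open>
  The Dyson series: the \<open>n\<close>-th iterate is at most \<open>M (4 L |t|)\<^sup>n / n!\<close> in the supremum norm weighted by
  \<open>decay\<close>, since each of the two neighbours costs a factor \<open>2 L\<close>. The series therefore converges
  for all times, and its sum keeps the exponential decay in \<open>j\<close>.
\<close>

lemma lattice_system_solvable:
  fixes A B :: "int \<Rightarrow> real \<Rightarrow> complex" and p0 :: "int \<Rightarrow> complex"
  assumes contA: "\<And>j. continuous_on UNIV (A j)" and contB: "\<And>j. continuous_on UNIV (B j)"
    and leA: "\<And>j t. cmod (A j t) \<le> L" and leB: "\<And>j t. cmod (B j t) \<le> L"
    and p0: "\<And>j. cmod (p0 j) \<le> M * decay j"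
  obtains p where "\<And>j. p j 0 = p0 j"
    "\<And>j t. (p j has_vector_derivative A j t * p (j - 1) t + B j t * p (j + 1) t) (at t)"
    "\<And>j t. cmod (p j t) \<le> M * exp (4 * L * \<bar>t\<bar>) * decay j"
proof -
  let ?P = "dyson A B p0"
  define g where "g n j s = A j s * ?P n (j - 1) s + B j s * ?P n (j + 1) s" for n j s
  have P_Suc: "?P (Suc n) j = prim (g n j)" for n j unfolding g_def by simp
  have L0: "L \<ge> 0" using leA[of 0 0] norm_ge_zero[of "A 0 0"] by linarith
  have M0: "M \<ge> 0" using order_trans[OF norm_ge_zero p0[of 0]] by (simp add: decay_def)
  have contP: "continuous_on UNIV (?P n j)" and contg: "continuous_on UNIV (g n j)" for n j
  proof -
    have P: "continuous_on UNIV (?P n j)" for j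
    proof (induction n arbitrary: j)
      case (Suc n)
      have g: "continuous_on UNIV (g n j)" unfolding g_def by (intro continuous_intros contA contB Suc)
      show ?case unfolding P_Suc
        by (intro continuous_at_imp_continuous_on ballI
            has_vector_derivative_continuous[OF prim_has_vector_derivative[OF g]])
    qed simp
    show "continuous_on UNIV (?P n j)" by (rule P)
    show "continuous_on UNIV (g n j)" unfolding g_def by (intro continuous_intros contA contB P)
  qed
  define K where "K n j = M * (4 * L) ^ n / fact n * decay j" for n j
  have gP: "cmod (?P n j t) \<le> K n j * \<bar>t\<bar> ^ n" for n j t
  proof (induction n arbitrary: j t)
    case 0
    then show ?case using p0 by (simp add: K_def)
  next
    case (Suc n)
    have "cmod (g n j s) \<le> (4 * L * K n j) * \<bar>s\<bar> ^ n" for s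
    proof -
      have "K n k * \<bar>s\<bar> ^ n \<le> 2 * K n j * \<bar>s\<bar> ^ n" if "decay k \<le> 2 * decay j" for k
      proof -
        have "M * (4 * L) ^ n / fact n * decay k \<le> M * (4 * L) ^ n / fact n * (2 * decay j)"
          using that M0 L0 by (intro mult_left_mono) auto
        also have "\<dots> = 2 * K n j" unfolding K_def by simp
        finally have "K n k \<le> 2 * K n j" unfolding K_def .
        then show ?thesis by (intro mult_right_mono) auto
      qed
      then have "cmod (?P n (j - 1) s) \<le> 2 * K n j * \<bar>s\<bar> ^ n" "cmod (?P n (j + 1) s) \<le> 2 * K n j * \<bar>s\<bar> ^ n"
        using order_trans[OF Suc] decay_shift_le by simp_all
      then have "cmod (A j s) * cmod (?P n (j - 1) s) + cmod (B j s) * cmod (?P n (j + 1) s)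
          \<le> L * (2 * K n j * \<bar>s\<bar> ^ n) + L * (2 * K n j * \<bar>s\<bar> ^ n)"
        using leA leB L0 by (intro add_mono mult_mono) auto
      moreover have "cmod (g n j s) \<le> cmod (A j s) * cmod (?P n (j - 1) s) + cmod (B j s) * cmod (?P n (j + 1) s)"
        unfolding g_def norm_mult[symmetric] by (rule norm_triangle_ineq)
      ultimately show ?thesis by (simp add: algebra_simps)
    qed
    from prim_power_bound[OF contg this]
    have "cmod (?P (Suc n) j t) \<le> (4 * L * K n j) * \<bar>t\<bar> ^ Suc n / real (Suc n)" unfolding P_Suc .
    also have "\<dots> = K (Suc n) j * \<bar>t\<bar> ^ Suc n" unfolding K_def by (simp add: field_simps)
    finally show ?case .
  qed
  have Kt: "K n j * \<bar>t\<bar> ^ n = M * decay j * ((4 * L * \<bar>t\<bar>) ^ n / fact n)" for n j t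
    unfolding K_def by (simp add: power_mult_distrib)
  have Ksums: "(\<lambda>n. K n j * \<bar>t\<bar> ^ n) sums (M * decay j * exp (4 * L * \<bar>t\<bar>))" for j t
    unfolding Kt by (intro sums_mult exponential_series_real)
  have Psum: "summable (\<lambda>n. cmod (?P n j t))" for j t
    using gP by (intro summable_comparison_test'[OF sums_summable[OF Ksums[of j t]], of 0]) auto
  then have Psum': "summable (\<lambda>n. ?P n j t)" for j t by (rule summable_norm_cancel)
  define p where "p j t = (\<Sum>n. ?P n j t)" for j t
  define Q where "Q n j t = (case n of 0 \<Rightarrow> 0 | Suc m \<Rightarrow> g m j t)" for n j t
  show ?thesis
  proof
    show "p j 0 = p0 j" for j
    proof -
      have "?P n j 0 = (if n = 0 then p0 j else 0)" for n by (cases n) (auto simp: P_Suc simp del: dyson.simps(2))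
      then show ?thesis unfolding p_def using sums_unique[OF sums_single[of 0 "\<lambda>_. p0 j"]] by simp
    qed
    show "cmod (p j t) \<le> M * exp (4 * L * \<bar>t\<bar>) * decay j" for j t
    proof -
      have "cmod (p j t) \<le> (\<Sum>n. cmod (?P n j t))" unfolding p_def by (rule summable_norm[OF Psum])
      also have "\<dots> \<le> (\<Sum>n. K n j * \<bar>t\<bar> ^ n)" by (intro suminf_le gP Psum sums_summable[OF Ksums])
      also have "\<dots> = M * decay j * exp (4 * L * \<bar>t\<bar>)" using sums_unique[OF Ksums] by simp
      finally show ?thesis by (simp add: mult_ac)
    qed
    show "(p j has_vector_derivative A j t * p (j - 1) t + B j t * p (j + 1) t) (at t)" for j t
    proof -
      define T where "T = \<bar>t\<bar> + 1"
      define R where "R m = L * (K m (j - 1) * T ^ m) + L * (K m (j + 1) * T ^ m)" for m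
      have "summable (\<lambda>m. K m k * T ^ m)" for k
        using sums_summable[OF Ksums[of k T]] unfolding T_def by simp
      then have R: "summable R" unfolding R_def by (intro summable_add summable_mult)
      have "((\<lambda>t. \<Sum>n. ?P n j t) has_vector_derivative (\<Sum>n. Q n j t)) (at t)"
      proof (rule suminf_has_vector_derivative[where M="\<lambda>n. case n of 0 \<Rightarrow> 0 | Suc m \<Rightarrow> R m" and T=T])
        show "(?P n j has_vector_derivative Q n j s) (at s)" for n s
          unfolding Q_def
          by (cases n) (auto simp: P_Suc simp del: dyson.simps(2) intro: prim_has_vector_derivative contg)
        show "cmod (Q n j s) \<le> (case n of 0 \<Rightarrow> 0 | Suc m \<Rightarrow> R m)" if "\<bar>s\<bar> \<le> T" for n s
        proof (cases n)
          case (Suc m)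
          have "cmod (?P m k s) \<le> K m k * T ^ m" for k
          proof -
            have "0 \<le> K m k" unfolding K_def using M0 L0 decay_pos[of k] by simp
            then have "K m k * \<bar>s\<bar> ^ m \<le> K m k * T ^ m" using that by (intro mult_left_mono power_mono) auto
            then show ?thesis using gP[of m k s] by linarith
          qed
          then have "cmod (A j s) * cmod (?P m (j - 1) s) + cmod (B j s) * cmod (?P m (j + 1) s) \<le> R m"
            unfolding R_def using leA leB L0 by (intro add_mono mult_mono) auto
          moreover have "cmod (g m j s) \<le> cmod (A j s) * cmod (?P m (j - 1) s) + cmod (B j s) * cmod (?P m (j + 1) s)"
            unfolding g_def norm_mult[symmetric] by (rule norm_triangle_ineq)
          ultimately show ?thesis using Suc by (simp add: Q_def)
        qed (simp add: Q_def)
        show "summable (\<lambda>n. case n of 0 \<Rightarrow> 0 | Suc m \<Rightarrow> R m)"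
          by (subst summable_Suc_iff[symmetric]) (use R in simp)
      qed (auto simp: T_def Psum')
      moreover have "(\<Sum>n. Q n j t) = A j t * p (j - 1) t + B j t * p (j + 1) t"
      proof -
        have "(\<lambda>m. g m j t) sums (A j t * p (j - 1) t + B j t * p (j + 1) t)"
          unfolding g_def p_def by (intro sums_add sums_mult summable_sums Psum')
        then have "(\<lambda>m. Q (Suc m) j t) sums (A j t * p (j - 1) t + B j t * p (j + 1) t)"
          by (simp add: Q_def)
        then have "(\<lambda>n. Q n j t) sums (A j t * p (j - 1) t + B j t * p (j + 1) t + Q 0 j t)"
          by (subst (asm) sums_Suc_iff) simp
        from sums_unique[OF this] show ?thesis by (simp add: Q_def)
      qed
      ultimately show ?thesis unfolding p_def by simp
    qed
  qed
qed

text \<open>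
  Compare \<open>2\<^sup>n = exp (n ln 2)\<close> with the \<open>k\<close>-th term of its exponential series.
\<close>

lemma wt_power_decay_bounded: "\<exists>C. \<forall>j. wt j ^ k * decay j \<le> C"
proof (intro exI allI)
  fix j
  have pos: "0 \<le> wt j * ln 2" using wt_pos[of j] by simp
  have "(wt j * ln 2) ^ k / fact k \<le> exp (wt j * ln 2)"
    using sum_le_suminf[OF sums_summable[OF exponential_series_real[of "wt j * ln 2"]], of "{k}"]
      sums_unique[OF exponential_series_real[of "wt j * ln 2"]] pos by simp
  also have "\<dots> = 2 powr wt j" by (simp add: powr_def)
  also have "\<dots> = 2 * (2 ^ nat \<bar>j\<bar>)"
  proof -
    have "wt j = 1 + real (nat \<bar>j\<bar>)" unfolding wt_def by simp
    then have "2 powr wt j = 2 powr 1 * 2 powr real (nat \<bar>j\<bar>)" by (simp only: powr_add)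
    also have "2 powr real (nat \<bar>j\<bar>) = (2::real) ^ nat \<bar>j\<bar>" by (rule powr_realpow) simp
    finally show ?thesis by simp
  qed
  finally have "wt j ^ k * ln 2 ^ k / fact k \<le> 2 / decay j"
    by (simp add: decay_def power_one_over power_mult_distrib)
  then show "wt j ^ k * decay j \<le> 2 * fact k / ln 2 ^ k"
    using decay_pos[of j] by (simp add: field_simps)
qed

section \<open>The lattice Hamiltonian and its conservation laws\<close>

text \<open>
  In the frame that moves with the wave, frequency \<open>j\<close> has energy \<open>|j| - j\<close>: nothing for \<open>j \<ge> 0\<close>, and a
  linearly growing barrier for \<open>j < 0\<close>.
\<close>

definition pot :: "int \<Rightarrow> real" where "pot j = \<bar>of_int j\<bar> - of_int j"

definition ham :: "(int \<Rightarrow> complex) \<Rightarrow> int \<Rightarrow> complex" where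
  "ham u j = of_real (pot j) * u j + (1/4) * (u (j - 1) + u (j + 1))"

definition lattice_flow :: "(real \<Rightarrow> int \<Rightarrow> complex) \<Rightarrow> bool" where
  "lattice_flow a \<longleftrightarrow> rapid a \<and>
     (\<forall>t j. ((\<lambda>t. a t j) has_vector_derivative - \<i> * ham (a t) j) (at t))"

lemma pot_nonneg: "pot j \<ge> 0" and pot_eq_0: "j \<ge> 0 \<Longrightarrow> pot j = 0"
  and pot_neg: "j < 0 \<Longrightarrow> pot j = - 2 * of_int j"
  unfolding pot_def by auto

text \<open>
  The potential is unbounded, but it is removed by the interaction picture
  \<open>p j t = cis (pot j * t) * a t j\<close>, which leaves a bounded coupling with oscillating coefficients \<open>A\<close>, \<open>B\<close>.
\<close>

lemma lattice_flow_exists: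
  assumes "\<And>j. cmod (a0 j) \<le> M * decay j"
  obtains a where "lattice_flow a" "a 0 = a0"
proof -
  define A where "A j t = - \<i> / 4 * cis ((pot j - pot (j - 1)) * t)" for j t
  define B where "B j t = - \<i> / 4 * cis ((pot j - pot (j + 1)) * t)" for j t
  obtain p where p: "\<And>j. p j 0 = a0 j"
    "\<And>j t. (p j has_vector_derivative A j t * p (j - 1) t + B j t * p (j + 1) t) (at t)"
    "\<And>j t. cmod (p j t) \<le> M * exp (4 * (1/4) * \<bar>t\<bar>) * decay j"
  proof (rule lattice_system_solvable[of A B "1/4" a0 M])
    show "continuous_on UNIV (A j)" "continuous_on UNIV (B j)" for j
      unfolding A_def B_def by (intro continuous_intros)+
  qed (use assms in \<open>auto simp: A_def B_def norm_mult norm_divide\<close>)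
  define a where "a t j = cis (- pot j * t) * p j t" for t j
  have M0: "M \<ge> 0" using order_trans[OF norm_ge_zero assms[of 0]] by (simp add: decay_def)
  have "rapid a"
    unfolding rapid_def
  proof (intro allI)
    fix T :: real and k :: nat
    obtain C where C: "\<And>j. wt j ^ k * decay j \<le> C" using wt_power_decay_bounded by blast
    have "wt j ^ k * norm (a t j) \<le> M * exp T * C" if "\<bar>t\<bar> \<le> T" for t j
    proof -
      have "norm (a t j) \<le> M * exp \<bar>t\<bar> * decay j" using p(3)[of j t] by (simp add: a_def norm_mult)
      also have "\<dots> \<le> M * exp T * decay j"
        using that M0 decay_pos[of j] by (intro mult_right_mono mult_left_mono) auto
      finally have "wt j ^ k * norm (a t j) \<le> wt j ^ k * (M * exp T * decay j)"
        using wt_pos[of j] by (intro mult_left_mono) auto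
      also have "\<dots> = M * exp T * (wt j ^ k * decay j)" by simp
      also have "\<dots> \<le> M * exp T * C" using M0 C by (intro mult_left_mono) auto
      finally show ?thesis .
    qed
    then show "\<exists>C. \<forall>t j. \<bar>t\<bar> \<le> T \<longrightarrow> wt j ^ k * norm (a t j) \<le> C" by blast
  qed
  moreover have "((\<lambda>t. a t j) has_vector_derivative - \<i> * ham (a t) j) (at t)" for t j
  proof -
    have c: "((\<lambda>t. cis (- pot j * t)) has_vector_derivative - \<i> * pot j * cis (- pot j * t)) (at t)"
      by (auto simp: has_vector_derivative_complex_iff intro!: derivative_eq_intros)
    have m: "cis (- pot j * t) * (z * cis ((pot j - pot k) * t) * p k t) = z * a t k" for k z
    proof -
      have "cis (- pot j * t) * cis ((pot j - pot k) * t) = cis (- pot k * t)"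
        by (simp add: cis_mult algebra_simps)
      then show ?thesis unfolding a_def by (metis mult.assoc mult.left_commute)
    qed
    have "((\<lambda>t. a t j) has_vector_derivative
        cis (- pot j * t) * (A j t * p (j - 1) t + B j t * p (j + 1) t)
        + (- \<i> * pot j * cis (- pot j * t)) * p j t) (at t)"
      unfolding a_def by (rule has_vector_derivative_mult[OF c p(2)])
    moreover have "cis (- pot j * t) * (A j t * p (j - 1) t + B j t * p (j + 1) t)
        = - \<i> / 4 * (a t (j - 1) + a t (j + 1))"
      unfolding A_def B_def distrib_left m by simp
    moreover have "- \<i> / 4 * (a t (j - 1) + a t (j + 1)) + (- \<i> * pot j * cis (- pot j * t)) * p j t
        = - \<i> * ham (a t) j"
      unfolding ham_def by (simp add: a_def[of t j] algebra_simps)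
    ultimately show ?thesis by (simp only:)
  qed
  ultimately show ?thesis using p(1) by (intro that[of a]) (auto simp: lattice_flow_def a_def)
qed

lemma pot_bound: "norm (of_real (pot j) :: 'a::real_normed_algebra_1) \<le> 2 * wt j ^ 1"
  unfolding norm_of_real by (auto simp: pot_def wt_def)

lemma rapid_shift_minus: "rapid c \<Longrightarrow> rapid (\<lambda>t j. c t (j - 1))"
  using rapid_shift[of c "-1"] by simp

lemma rapid_ham: "rapid a \<Longrightarrow> rapid (\<lambda>t. ham (a t))"
  unfolding ham_def
  by (intro rapid_add rapid_poly_mult[OF _ pot_bound] rapid_poly_mult[where m="\<lambda>t j. 1/4" and K=1 and p=0]
      rapid_shift rapid_shift_minus) auto

text \<open>
  \<open>ham\<close> is independent of time, so it commutes with the flow. Conservation of mass applied to this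
  second solution gives conservation of \<open>\<parallel>ham a\<parallel>\<^sup>2\<close>, which plays the part of the energy.
\<close>

lemma lattice_flow_ham:
  assumes "lattice_flow a"
  shows "lattice_flow (\<lambda>t. ham (a t))"
proof -
  have d: "((\<lambda>t. a t j) has_vector_derivative - \<i> * ham (a t) j) (at t)" for t j
    using assms unfolding lattice_flow_def by blast
  have "((\<lambda>t. ham (a t) j) has_vector_derivative - \<i> * ham (ham (a t)) j) (at t)" for t j
  proof -
    have "((\<lambda>t. ham (a t) j) has_vector_derivative
        of_real (pot j) * (- \<i> * ham (a t) j) + (1/4) * ((- \<i> * ham (a t) (j - 1)) + (- \<i> * ham (a t) (j + 1)))) (at t)"
      unfolding ham_def[of "a _"]
      by (intro has_vector_derivative_add has_vector_derivative_mult_right d[unfolded ham_def])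
    then show ?thesis unfolding ham_def[of "ham _"] by (simp add: algebra_simps)
  qed
  then show ?thesis using assms rapid_ham unfolding lattice_flow_def by blast
qed

lemma lattice_flow_rapid: "lattice_flow a \<Longrightarrow> rapid a"
  unfolding lattice_flow_def by blast

lemma lattice_flow_deriv_corr:
  assumes "lattice_flow a"
  shows "((\<lambda>t. cnj (a t k) * a t j) has_vector_derivative
     \<i> * (cnj (ham (a t) k) * a t j - cnj (a t k) * ham (a t) j)) (at t)"
proof -
  have d: "((\<lambda>t. a t j) has_vector_derivative - \<i> * ham (a t) j) (at t)" for t j
    using assms unfolding lattice_flow_def by blast
  have "((\<lambda>t. cnj (a t k) * a t j) has_vector_derivative
     cnj (a t k) * (- \<i> * ham (a t) j) + cnj (- \<i> * ham (a t) k) * a t j) (at t)"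
    by (intro has_vector_derivative_mult has_vector_derivative_cnj d)
  then show ?thesis by (simp add: algebra_simps)
qed

lemma rapid_corr:
  assumes "rapid a" "rapid b"
  shows "rapid (\<lambda>t j. cnj (a t j) * b t j)"
  by (intro rapid_prod assms(2) rapid_norm_le[OF assms(1)]) simp

lemma rapid_Re: "rapid c \<Longrightarrow> rapid (\<lambda>t j. Re (c t j))"
  and rapid_Im: "rapid c \<Longrightarrow> rapid (\<lambda>t j. Im (c t j))"
  by (auto elim!: rapid_norm_le simp: abs_Re_le_cmod abs_Im_le_cmod)

lemma rapid_norm_sq:
  fixes a :: "real \<Rightarrow> int \<Rightarrow> complex"
  assumes "rapid a" shows "rapid (\<lambda>t j. (cmod (a t j))\<^sup>2)"
  by (rule rapid_norm_le[OF rapid_prod[OF assms assms]]) (simp add: norm_mult power2_eq_square)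

lemma infsum_shift: "(\<Sum>\<^sub>\<infinity>j. f (j + s)) = (\<Sum>\<^sub>\<infinity>j::int. f j)"
proof -
  have "bij_betw (\<lambda>j. j + s) UNIV UNIV" by (rule bij_betwI[of _ _ _ "\<lambda>j. j - s"]) auto
  then show ?thesis by (rule infsum_reindex_bij_betw)
qed

lemma rapid_infsum_diff:
  fixes f g :: "real \<Rightarrow> int \<Rightarrow> 'a::banach"
  assumes "rapid f" "rapid g"
  shows "(\<Sum>\<^sub>\<infinity>j. f t j - g t j) = (\<Sum>\<^sub>\<infinity>j. f t j) - (\<Sum>\<^sub>\<infinity>j. g t j)"
  using infsum_add[OF rapid_summable[OF assms(1)] rapid_summable[OF rapid_minus[OF assms(2)]], of t t]
  by (simp add: infsum_uminus)

text \<open>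
  The conservation laws and both derivatives of the second moment come down to this identity, with
  \<open>q\<close> constant, quadratic and linear.
\<close>

lemma rapid_sum_by_parts:
  fixes f :: "real \<Rightarrow> int \<Rightarrow> real"
  assumes f: "rapid f" and q: "\<And>j. \<bar>q j\<bar> \<le> K * wt j ^ p" "\<And>j. \<bar>q (j + 1)\<bar> \<le> K' * wt j ^ p'"
  shows "(\<Sum>\<^sub>\<infinity>j. q j * (f t (j - 1) - f t j)) = (\<Sum>\<^sub>\<infinity>j. (q (j + 1) - q j) * f t j)"
proof -
  have r1: "rapid (\<lambda>t j. q j * f t j)" by (rule rapid_poly_mult[OF f]) (use q in auto)
  have r2: "rapid (\<lambda>t j. q (j + 1) * f t j)" by (rule rapid_poly_mult[OF f]) (use q in auto)
  have r3: "rapid (\<lambda>t j. q j * f t (j - 1))" using rapid_shift_minus[OF r2] by simp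
  have "(\<Sum>\<^sub>\<infinity>j. q j * (f t (j - 1) - f t j)) = (\<Sum>\<^sub>\<infinity>j. q j * f t (j - 1)) - (\<Sum>\<^sub>\<infinity>j. q j * f t j)"
    unfolding right_diff_distrib by (rule rapid_infsum_diff[OF r3 r1])
  also have "(\<Sum>\<^sub>\<infinity>j. q j * f t (j - 1)) = (\<Sum>\<^sub>\<infinity>j. q (j + 1) * f t j)"
    using infsum_shift[of "\<lambda>j. q j * f t (j - 1)" 1] by simp
  also have "\<dots> - (\<Sum>\<^sub>\<infinity>j. q j * f t j) = (\<Sum>\<^sub>\<infinity>j. (q (j + 1) - q j) * f t j)"
    unfolding left_diff_distrib by (rule rapid_infsum_diff[OF r2 r1, symmetric])
  finally show ?thesis .
qed

definition mass :: "(int \<Rightarrow> complex) \<Rightarrow> real" where "mass u = (\<Sum>\<^sub>\<infinity>j. (cmod (u j))\<^sup>2)"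

text \<open>
  The probability current across the bond between \<open>j\<close> and \<open>j + 1\<close>.
\<close>

definition current :: "(int \<Rightarrow> complex) \<Rightarrow> int \<Rightarrow> real" where
  "current u j = Im (cnj (u (j + 1)) * u j)"

lemma rapid_current: "rapid a \<Longrightarrow> rapid (\<lambda>t. current (a t))"
  unfolding current_def by (intro rapid_Im rapid_corr rapid_shift)

lemma deriv_norm_sq:
  assumes "lattice_flow a"
  shows "((\<lambda>t. (cmod (a t j))\<^sup>2) has_real_derivative (1/2) * (current (a t) (j - 1) - current (a t) j)) (at t)"
proof -
  have "((\<lambda>t. Re (cnj (a t j) * a t j)) has_vector_derivative
      Re (\<i> * (cnj (ham (a t) j) * a t j - cnj (a t j) * ham (a t) j))) (at t)"
    by (rule bounded_linear.has_vector_derivative[OF bounded_linear_Re lattice_flow_deriv_corr[OF assms]])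
  moreover have "Re (cnj z * z) = (cmod z)\<^sup>2" for z unfolding cmod_power2 by (simp add: power2_eq_square)
  moreover have "Re (\<i> * (cnj (ham u j) * u j - cnj (u j) * ham u j)) = (1/2) * (current u (j - 1) - current u j)" for u
    unfolding ham_def current_def by (simp add: algebra_simps add_divide_distrib diff_divide_distrib)
  ultimately show ?thesis by (simp only: has_real_derivative_iff_has_vector_derivative)
qed

lemma mass_conserved:
  assumes "lattice_flow a"
  shows "mass (a t) = mass (a 0)"
proof -
  have r: "rapid a" using assms by (rule lattice_flow_rapid)
  have "((\<lambda>t. mass (a t)) has_real_derivative 0) (at t)" for t
  proof -
    have "((\<lambda>t. mass (a t)) has_real_derivative (\<Sum>\<^sub>\<infinity>j. (1/2) * (current (a t) (j - 1) - current (a t) j))) (at t)"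
      unfolding mass_def
      by (intro rapid_sum_has_derivative rapid_norm_sq r deriv_norm_sq assms
          rapid_poly_mult[where m="\<lambda>t j. 1/2" and K=1 and p=0] rapid_diff rapid_shift_minus rapid_current) auto
    also have "(\<Sum>\<^sub>\<infinity>j. (1/2) * (current (a t) (j - 1) - current (a t) j)) = (\<Sum>\<^sub>\<infinity>j. (1/2 - 1/2) * current (a t) j)"
      by (rule rapid_sum_by_parts[OF rapid_current[OF r], where q="\<lambda>j. 1/2" and K=1 and p=0 and K'=1 and p'=0]) auto
    finally show ?thesis by simp
  qed
  then show ?thesis using DERIV_isconst_all by blast
qed

text \<open>
  The second moment is centred at \<open>-1/2\<close> so that, after two derivatives, the bond between \<open>-1\<close> and \<open>0\<close>
  has weight \<open>0\<close> in \<open>force\<close>. That bond is the only one where the potential jumps while \<open>u\<close> need not be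
  small on one of its sides.
\<close>

definition spread :: "(int \<Rightarrow> complex) \<Rightarrow> real" where
  "spread u = (\<Sum>\<^sub>\<infinity>j. (of_int j + 1/2)\<^sup>2 * (cmod (u j))\<^sup>2)"

definition momentum :: "(int \<Rightarrow> complex) \<Rightarrow> real" where
  "momentum u = (\<Sum>\<^sub>\<infinity>j. (of_int j + 1) * current u j)"

lemma quadratic_weights_le:
  "\<bar>(real_of_int j + 1/2)\<^sup>2\<bar> \<le> 1 * wt j ^ 2" "\<bar>(real_of_int (j + 1) + 1/2)\<^sup>2\<bar> \<le> 4 * wt j ^ 2"
  "\<bar>real_of_int j + 1\<bar> \<le> 1 * wt j ^ 1" "\<bar>real_of_int (j + 1) + 1\<bar> \<le> 2 * wt j ^ 1"
proof -
  have "\<bar>real_of_int j + 1/2\<bar> ^ 2 \<le> wt j ^ 2" unfolding wt_def by (intro power_mono) linarith+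
  then show "\<bar>(real_of_int j + 1/2)\<^sup>2\<bar> \<le> 1 * wt j ^ 2" by simp
  have "\<bar>real_of_int (j + 1) + 1/2\<bar> ^ 2 \<le> (2 * wt j) ^ 2"
    unfolding wt_def by (intro power_mono) (simp_all add: abs_if)
  then show "\<bar>(real_of_int (j + 1) + 1/2)\<^sup>2\<bar> \<le> 4 * wt j ^ 2" by (simp add: power_mult_distrib)
qed (auto simp: wt_def abs_if)

lemma spread_deriv:
  assumes "lattice_flow a"
  shows "((\<lambda>t. spread (a t)) has_real_derivative momentum (a t)) (at t)"
proof -
  have r: "rapid a" using assms by (rule lattice_flow_rapid)
  let ?q = "\<lambda>j. (real_of_int j + 1/2)\<^sup>2"
  have c: "rapid (\<lambda>t j. current (a t) (j - 1) - current (a t) j)"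
    by (intro rapid_diff rapid_shift_minus rapid_current r)
  have e: "?q j * ((1/2) * x) = (1/2) * (?q j * x)" for j x by simp
  have "((\<lambda>t. spread (a t)) has_real_derivative (\<Sum>\<^sub>\<infinity>j. ?q j * ((1/2) * (current (a t) (j - 1) - current (a t) j)))) (at t)"
    unfolding spread_def
  proof (intro rapid_sum_has_derivative)
    show "rapid (\<lambda>t j. ?q j * (cmod (a t j))\<^sup>2)"
      by (rule rapid_poly_mult[OF rapid_norm_sq[OF r], where K=1 and p=2]) (use quadratic_weights_le(1) in simp)
    show "rapid (\<lambda>t j. ?q j * ((1/2) * (current (a t) (j - 1) - current (a t) j)))"
      unfolding e by (rule rapid_poly_mult[where m="\<lambda>t j. 1/2" and K=1 and p=0, OF rapid_poly_mult[OF c, where K=1 and p=2]])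
        (use quadratic_weights_le(1) in simp_all)
    show "((\<lambda>t. ?q j * (cmod (a t j))\<^sup>2) has_real_derivative ?q j * ((1/2) * (current (a t) (j - 1) - current (a t) j))) (at t)" for t j
      by (intro DERIV_cmult deriv_norm_sq assms)
  qed
  also have "(\<Sum>\<^sub>\<infinity>j. ?q j * ((1/2) * (current (a t) (j - 1) - current (a t) j)))
      = (1/2) * (\<Sum>\<^sub>\<infinity>j. ?q j * (current (a t) (j - 1) - current (a t) j))"
    unfolding e by (rule infsum_cmult_right')
  also have "(\<Sum>\<^sub>\<infinity>j. ?q j * (current (a t) (j - 1) - current (a t) j)) = (\<Sum>\<^sub>\<infinity>j. (?q (j + 1) - ?q j) * current (a t) j)"
    by (rule rapid_sum_by_parts[OF rapid_current[OF r]]) (rule quadratic_weights_le)+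
  also have "(1/2) * (\<Sum>\<^sub>\<infinity>j. (?q (j + 1) - ?q j) * current (a t) j) = momentum (a t)"
    unfolding momentum_def infsum_cmult_right'[symmetric]
    by (intro infsum_cong) (simp add: power2_eq_square algebra_simps)
  finally show ?thesis .
qed

text \<open>
  Summed over \<open>j\<close> this is half of \<open>\<Sum> |u (j + 1) - u (j - 1)|\<^sup>2\<close>, the squared velocity of the free
  lattice motion.
\<close>

definition kin :: "(int \<Rightarrow> complex) \<Rightarrow> int \<Rightarrow> real" where
  "kin u j = (cmod (u j))\<^sup>2 - Re (cnj (u (j + 1)) * u (j - 1))"

lemma current_deriv:
  assumes "lattice_flow a"
  shows "((\<lambda>t. current (a t) j) has_real_derivative
     (pot (j + 1) - pot j) * Re (cnj (a t (j + 1)) * a t j) + (1/4) * (kin (a t) j - kin (a t) (j + 1))) (at t)"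
proof -
  have "((\<lambda>t. Im (cnj (a t (j + 1)) * a t j)) has_vector_derivative
      Im (\<i> * (cnj (ham (a t) (j + 1)) * a t j - cnj (a t (j + 1)) * ham (a t) j))) (at t)"
    by (rule bounded_linear.has_vector_derivative[OF bounded_linear_Im lattice_flow_deriv_corr[OF assms]])
  moreover have "Im (\<i> * (cnj (ham u (j + 1)) * u j - cnj (u (j + 1)) * ham u j))
     = (pot (j + 1) - pot j) * Re (cnj (u (j + 1)) * u j) + (1/4) * (kin u j - kin u (j + 1))" for u
    unfolding ham_def kin_def cmod_power2 by (simp add: algebra_simps power2_eq_square add_divide_distrib diff_divide_distrib)
  ultimately show ?thesis unfolding current_def by (simp only: has_real_derivative_iff_has_vector_derivative)
qed

lemma rapid_kin: "rapid a \<Longrightarrow> rapid (\<lambda>t. kin (a t))"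
  unfolding kin_def by (intro rapid_diff rapid_norm_sq rapid_Re rapid_corr rapid_shift rapid_shift_minus)

definition force :: "(int \<Rightarrow> complex) \<Rightarrow> real" where
  "force u = (\<Sum>\<^sub>\<infinity>j. (of_int j + 1) * ((pot (j + 1) - pot j) * Re (cnj (u (j + 1)) * u j)))"

lemma pot_diff_le: "\<bar>pot (j + 1) - pot j\<bar> \<le> 2"
  unfolding pot_def by (auto simp: abs_if)

lemma rapid_force_density:
  assumes "rapid a"
  shows "rapid (\<lambda>t j. (of_int j + 1) * ((pot (j + 1) - pot j) * Re (cnj (a t (j + 1)) * a t j)))"
  by (rule rapid_poly_mult[where K=1 and p=1, OF rapid_poly_mult[where K=2 and p=0, OF rapid_Re[OF rapid_corr[OF rapid_shift[OF assms] assms]]]])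
     (use quadratic_weights_le(3) pot_diff_le in simp_all)

text \<open>
  The virial identity: the second derivative of \<open>spread\<close> consists of the squared velocity and the
  work of the potential.
\<close>

lemma momentum_deriv:
  assumes "lattice_flow a"
  shows "((\<lambda>t. momentum (a t)) has_real_derivative force (a t) + (1/4) * (\<Sum>\<^sub>\<infinity>j. kin (a t) j)) (at t)"
proof -
  have r: "rapid a" using assms by (rule lattice_flow_rapid)
  let ?q = "\<lambda>j. real_of_int j + 1"
  let ?F = "\<lambda>t j. ?q j * ((pot (j + 1) - pot j) * Re (cnj (a t (j + 1)) * a t j))"
  let ?G = "\<lambda>t j. (1/4) * (?q j * (kin (a t) j - kin (a t) (j + 1)))"
  have rF: "rapid ?F" by (rule rapid_force_density[OF r])
  have rG: "rapid ?G"
    by (rule rapid_poly_mult[where m="\<lambda>t j. 1/4" and K=1 and p=0, OF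
          rapid_poly_mult[where K=1 and p=1, OF rapid_diff[OF rapid_kin[OF r] rapid_shift[OF rapid_kin[OF r]]]]])
       (use quadratic_weights_le(3) in simp_all)
  have "((\<lambda>t. momentum (a t)) has_real_derivative (\<Sum>\<^sub>\<infinity>j. ?F t j + ?G t j)) (at t)"
    unfolding momentum_def
  proof (intro rapid_sum_has_derivative)
    show "rapid (\<lambda>t j. ?q j * current (a t) j)"
      by (rule rapid_poly_mult[where K=1 and p=1, OF rapid_current[OF r]]) (use quadratic_weights_le(3) in simp)
    show "rapid (\<lambda>t j. ?F t j + ?G t j)" by (intro rapid_add rF rG)
    show "((\<lambda>t. ?q j * current (a t) j) has_real_derivative ?F t j + ?G t j) (at t)" for t j
      using DERIV_cmult[OF current_deriv[OF assms, where j=j and t=t], of "?q j"] by (simp add: distrib_left)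
  qed
  also have "(\<Sum>\<^sub>\<infinity>j. ?F t j + ?G t j) = force (a t) + (\<Sum>\<^sub>\<infinity>j. ?G t j)"
    unfolding force_def by (rule infsum_add) (rule rapid_summable[OF rF] rapid_summable[OF rG])+
  also have "(\<Sum>\<^sub>\<infinity>j. ?G t j) = (1/4) * (\<Sum>\<^sub>\<infinity>j. ?q j * (kin (a t) (j - 1 + 1) - kin (a t) (j + 1)))"
    unfolding infsum_cmult_right'[symmetric] by simp
  also have "(\<Sum>\<^sub>\<infinity>j. ?q j * (kin (a t) (j - 1 + 1) - kin (a t) (j + 1))) = (\<Sum>\<^sub>\<infinity>j. (?q (j + 1) - ?q j) * kin (a t) (j + 1))"
    by (rule rapid_sum_by_parts[OF rapid_shift[OF rapid_kin[OF r]]]) (rule quadratic_weights_le)+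
  also have "\<dots> = (\<Sum>\<^sub>\<infinity>j. kin (a t) j)" using infsum_shift[of "kin (a t)" 1] by simp
  finally show ?thesis .
qed

section \<open>Ballistic spreading\<close>

text \<open>
  The uneven weights put the large factor on \<open>ham u\<close>, whose norm is small compared with the mass, and
  leave the other term almost at its true size; equal weights \<open>2\<close> would not suffice below.
\<close>

lemma norm_sq_diff_weighted:
  "(cmod (x - y))\<^sup>2 \<le> 5 * (cmod x)\<^sup>2 + (5/4) * (cmod y)\<^sup>2"
proof -
  have "(cmod (x - y))\<^sup>2 \<le> (cmod x + cmod y)\<^sup>2" by (intro power_mono norm_triangle_ineq4) auto
  also have "\<dots> \<le> 5 * (cmod x)\<^sup>2 + (5/4) * (cmod y)\<^sup>2"
    using sum_squares_bound[of "2 * cmod x" "cmod y / 2"] by (simp add: power2_eq_square algebra_simps)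
  finally show ?thesis .
qed

text \<open>
  This measures how far the state penetrates the barrier on the negative frequencies.
\<close>

definition pot_mass :: "(int \<Rightarrow> complex) \<Rightarrow> real" where
  "pot_mass u = (\<Sum>\<^sub>\<infinity>j. (pot j)\<^sup>2 * (cmod (u j))\<^sup>2)"

lemma pot_sq_le: "\<bar>(pot j)\<^sup>2\<bar> \<le> 4 * wt j ^ 2"
proof -
  have "(pot j)\<^sup>2 \<le> (2 * wt j)\<^sup>2"
    using pot_nonneg[of j] by (intro power_mono) (auto simp: pot_def wt_def)
  then show ?thesis by (simp add: power_mult_distrib)
qed

lemma rapid_pot_density: "rapid a \<Longrightarrow> rapid (\<lambda>t j. (pot j)\<^sup>2 * (cmod (a t j))\<^sup>2)"
  by (rule rapid_poly_mult[OF rapid_norm_sq, where K=4 and p=2]) (use pot_sq_le in simp_all)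

lemma rapid_cmult: "rapid f \<Longrightarrow> rapid (\<lambda>t j. c * f t j)" for c :: "'a::real_normed_algebra"
  by (rule rapid_poly_mult[where K="norm c" and p=0]) auto

lemma infsum_shift_minus: "(\<Sum>\<^sub>\<infinity>j. f (j - 1)) = (\<Sum>\<^sub>\<infinity>j::int. f j)"
  using infsum_shift[of f "-1"] by simp

lemma hopping_bound:
  "(cmod ((1/4) * (u (j - 1) + u (j + 1))))\<^sup>2 \<le> 5 * (cmod (ham u j))\<^sup>2 + (5/4) * ((pot j)\<^sup>2 * (cmod (u j))\<^sup>2)"
proof -
  have "(1/4) * (u (j - 1) + u (j + 1)) = ham u j - of_real (pot j) * u j" by (simp add: ham_def)
  then show ?thesis using norm_sq_diff_weighted[of "ham u j" "of_real (pot j) * u j"]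
    by (simp only: norm_mult norm_of_real power_mult_distrib power2_abs)
qed

text \<open>
  For \<open>j < 0\<close>, split \<open>pot j * u j\<close> into \<open>ham u j\<close> and the hopping term. The left neighbour lies in the
  barrier, where \<open>pot \<ge> 4\<close>, so it is absorbed by \<open>pot\<^sup>2 |u|\<^sup>2\<close> there; the right neighbour may carry mass.
\<close>

lemma pot_mass_density_bound:
  "(pot j)\<^sup>2 * (cmod (u j))\<^sup>2 \<le> 5 * (cmod (ham u j))\<^sup>2
     + (5/32) * ((1/16) * ((pot (j - 1))\<^sup>2 * (cmod (u (j - 1)))\<^sup>2) + (cmod (u (j + 1)))\<^sup>2)"
proof (cases "j < 0")
  case True
  have "4 \<le> pot (j - 1)" using True by (simp add: pot_neg)
  then have "16 \<le> (pot (j - 1))\<^sup>2" using power_mono[of 4 "pot (j - 1)" 2] by simp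
  then have 1: "(cmod (u (j - 1)))\<^sup>2 \<le> (1/16) * ((pot (j - 1))\<^sup>2 * (cmod (u (j - 1)))\<^sup>2)"
    using mult_right_mono[of 16 "(pot (j - 1))\<^sup>2" "(cmod (u (j - 1)))\<^sup>2"] by simp
  let ?y = "(1/4) * (u (j - 1) + u (j + 1))"
  have "(cmod (u (j - 1) + u (j + 1)))\<^sup>2 \<le> (cmod (u (j - 1)) + cmod (u (j + 1)))\<^sup>2"
    by (intro power_mono norm_triangle_ineq) auto
  also have "\<dots> \<le> 2 * (cmod (u (j - 1)))\<^sup>2 + 2 * (cmod (u (j + 1)))\<^sup>2"
    using sum_squares_bound[of "cmod (u (j - 1))" "cmod (u (j + 1))"] by (simp add: power2_sum)
  finally have 2: "(cmod ?y)\<^sup>2 \<le> (1/8) * ((cmod (u (j - 1)))\<^sup>2 + (cmod (u (j + 1)))\<^sup>2)"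
    by (simp add: norm_mult norm_divide power_divide)
  have "of_real (pot j) * u j = ham u j - ?y" by (simp add: ham_def)
  then have "(pot j)\<^sup>2 * (cmod (u j))\<^sup>2 = (cmod (ham u j - ?y))\<^sup>2"
    by (metis norm_mult norm_of_real power_mult_distrib power2_abs)
  also have "\<dots> \<le> 5 * (cmod (ham u j))\<^sup>2 + (5/4) * (cmod ?y)\<^sup>2" by (rule norm_sq_diff_weighted)
  finally have 3: "(pot j)\<^sup>2 * (cmod (u j))\<^sup>2 \<le> 5 * (cmod (ham u j))\<^sup>2 + (5/4) * (cmod ?y)\<^sup>2" .
  have "d \<le> 5 * b + (5/32) * ((1/16) * dm + ap)"
    if "d \<le> 5 * b + (5/4) * y" "y \<le> (1/8) * (am + ap)" "am \<le> (1/16) * dm" for d b dm ap y am :: real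
    using that by (simp only: distrib_left)
  from this[OF 3 2 1] show ?thesis .
qed (simp add: pot_eq_0)

text \<open>
  The potential has slope \<open>-2\<close> below \<open>0\<close>, so for \<open>j \<le> -2\<close> the density equals
  \<open>pot (j + 1) Re (...)\<close>, and \<open>|u j| \<le> pot j |u j| / 4\<close>. For \<open>j = -1\<close> the factor \<open>j + 1\<close> vanishes,
  and for \<open>j \<ge> 0\<close> the slope does.
\<close>

lemma force_density_bound:
  "(of_int j + 1) * ((pot (j + 1) - pot j) * Re (cnj (u (j + 1)) * u j))
     \<ge> - (1/8) * ((pot (j + 1))\<^sup>2 * (cmod (u (j + 1)))\<^sup>2 + (pot j)\<^sup>2 * (cmod (u j))\<^sup>2)"
proof (cases "j \<le> -2")
  case True
  have "pot (j + 1) - pot j = - 2" "pot (j + 1) = - 2 * (of_int j + 1)" using True by (simp_all add: pot_neg)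
  then have 1: "(of_int j + 1) * ((pot (j + 1) - pot j) * Re (cnj (u (j + 1)) * u j))
      = pot (j + 1) * Re (cnj (u (j + 1)) * u j)"
    by (simp only: mult.assoc mult.left_commute)
  have "- (cmod (u (j + 1)) * cmod (u j)) \<le> Re (cnj (u (j + 1)) * u j)"
    using abs_Re_le_cmod[of "cnj (u (j + 1)) * u j"] unfolding norm_mult complex_mod_cnj by linarith
  then have 2: "pot (j + 1) * - (cmod (u (j + 1)) * cmod (u j)) \<le> pot (j + 1) * Re (cnj (u (j + 1)) * u j)"
    using pot_nonneg by (rule mult_left_mono)
  have 3: "(pot (j + 1) * cmod (u (j + 1))) * cmod (u j)
     \<le> (pot (j + 1) * cmod (u (j + 1))) * ((1/4) * (pot j * cmod (u j)))"
  proof (rule mult_left_mono)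
    have "4 \<le> pot j" using True by (simp add: pot_neg)
    then show "cmod (u j) \<le> (1/4) * (pot j * cmod (u j))"
      using mult_right_mono[of 4 "pot j" "cmod (u j)"] by simp
  qed (simp add: pot_nonneg)
  have 4: "2 * (pot (j + 1) * cmod (u (j + 1))) * (pot j * cmod (u j))
     \<le> (pot (j + 1))\<^sup>2 * (cmod (u (j + 1)))\<^sup>2 + (pot j)\<^sup>2 * (cmod (u j))\<^sup>2"
    using sum_squares_bound[of "pot (j + 1) * cmod (u (j + 1))" "pot j * cmod (u j)"]
    by (simp add: power_mult_distrib)
  have "p * R \<ge> - (1/8) * D"
    if "p * - (m * n) \<le> p * R" "(p * m) * n \<le> (p * m) * ((1/4) * (q * n))" "2 * (p * m) * (q * n) \<le> D"
    for p R D m n q :: real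
    using that by (simp add: mult.assoc)
  from this[OF 2 3 4] show ?thesis unfolding 1 .
next
  case False
  have "(of_int j + 1) * ((pot (j + 1) - pot j) * Re (cnj (u (j + 1)) * u j)) = 0"
    using False by (cases "j = -1") (auto simp: pot_eq_0)
  then show ?thesis unfolding \<open>_ = 0\<close> by (simp add: add_nonneg_nonneg)
qed

lemma kin_lower_bound:
  "kin u j \<ge> (cmod (u j))\<^sup>2 + (1/2) * ((cmod (u (j - 1)))\<^sup>2 + (cmod (u (j + 1)))\<^sup>2)
      - 40 * (cmod (ham u j))\<^sup>2 - 10 * ((pot j)\<^sup>2 * (cmod (u j))\<^sup>2)"
proof -
  have "kin u j = (cmod (u j))\<^sup>2 + (1/2) * ((cmod (u (j - 1)))\<^sup>2 + (cmod (u (j + 1)))\<^sup>2)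
      - 8 * (cmod ((1/4) * (u (j - 1) + u (j + 1))))\<^sup>2"
    unfolding kin_def cmod_power2 by (simp add: power2_eq_square algebra_simps add_divide_distrib)
  then show ?thesis using hopping_bound[of u j] by simp
qed

text \<open>
  Write \<open>N\<close>, \<open>B\<close>, \<open>D\<close> for \<open>mass a\<close>, \<open>mass (ham a)\<close>, \<open>pot_mass a\<close>. The three estimates are
  \<open>D \<le> 5 B + 5/32 (D/16 + N)\<close>, \<open>force \<ge> - D/4\<close> and \<open>\<Sum> kin \<ge> 2 N - 40 B - 10 D\<close>. The first
  gives \<open>D \<le> 0.158 N + 5.05 B\<close>, which leaves a positive multiple of \<open>N\<close> in the sum. The margin comes
  from the small hopping amplitude \<open>1/4\<close>: it keeps the state from climbing the barrier.
\<close>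

lemma acceleration_lower_bound:
  assumes "rapid a"
  shows "force (a t) + (1/4) * (\<Sum>\<^sub>\<infinity>j. kin (a t) j) \<ge> mass (a t) / 16 - 24 * mass (ham (a t))"
proof -
  note r = assms and rh = rapid_ham[OF assms]
  let ?n = "\<lambda>t j. (cmod (a t j))\<^sup>2"
  let ?b = "\<lambda>t j. (cmod (ham (a t) j))\<^sup>2"
  let ?d = "\<lambda>t j. (pot j)\<^sup>2 * (cmod (a t j))\<^sup>2"
  have rn: "rapid ?n" and rb: "rapid ?b" and rd: "rapid ?d"
    by (intro rapid_norm_sq r rh rapid_pot_density)+
  note rs = rapid_shift[where s=1] rapid_shift_minus
  have D: "pot_mass (a t) \<le> 5 * mass (ham (a t)) + (5/32) * ((1/16) * pot_mass (a t) + mass (a t))"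
  proof -
    let ?e = "\<lambda>t j. (1/16) * ?d t (j - 1) + ?n t (j + 1)"
    have re: "rapid ?e" by (intro rapid_add rapid_cmult rs(2)[OF rd] rs(1)[OF rn])
    have "pot_mass (a t) \<le> (\<Sum>\<^sub>\<infinity>j. 5 * ?b t j + (5/32) * ?e t j)"
      unfolding pot_mass_def
      by (intro infsum_mono rapid_summable[OF rd] rapid_summable[OF rapid_add[OF rapid_cmult[OF rb] rapid_cmult[OF re]]]
          pot_mass_density_bound)
    also have "\<dots> = (\<Sum>\<^sub>\<infinity>j. 5 * ?b t j) + (\<Sum>\<^sub>\<infinity>j. (5/32) * ?e t j)"
      by (rule infsum_add[OF rapid_summable[OF rapid_cmult[OF rb]] rapid_summable[OF rapid_cmult[OF re]]])
    also have "\<dots> = 5 * mass (ham (a t)) + (5/32) * (\<Sum>\<^sub>\<infinity>j. ?e t j)"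
      unfolding mass_def by (simp only: infsum_cmult_right')
    also have "(\<Sum>\<^sub>\<infinity>j. ?e t j) = (\<Sum>\<^sub>\<infinity>j. (1/16) * ?d t (j - 1)) + (\<Sum>\<^sub>\<infinity>j. ?n t (j + 1))"
      by (rule infsum_add[OF rapid_summable[OF rapid_cmult[OF rs(2)[OF rd]]] rapid_summable[OF rs(1)[OF rn]]])
    also have "\<dots> = (1/16) * pot_mass (a t) + mass (a t)"
      unfolding mass_def pot_mass_def
      by (simp only: infsum_cmult_right' infsum_shift[of "?n t" 1] infsum_shift_minus[of "?d t"])
    finally show ?thesis .
  qed
  have F: "force (a t) \<ge> - (1/8) * (pot_mass (a t) + pot_mass (a t))"
  proof -
    have "- (1/8) * (pot_mass (a t) + pot_mass (a t)) = - (1/8) * ((\<Sum>\<^sub>\<infinity>j. ?d t (j + 1)) + (\<Sum>\<^sub>\<infinity>j. ?d t j))"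
      unfolding pot_mass_def by (simp only: infsum_shift[of "?d t" 1])
    also have "\<dots> = - (1/8) * (\<Sum>\<^sub>\<infinity>j. ?d t (j + 1) + ?d t j)"
      by (subst infsum_add[OF rapid_summable[OF rs(1)[OF rd]] rapid_summable[OF rd]]) (rule refl)
    also have "\<dots> = (\<Sum>\<^sub>\<infinity>j. - (1/8) * (?d t (j + 1) + ?d t j))" by (rule infsum_cmult_right'[symmetric])
    also have "\<dots> \<le> force (a t)"
      unfolding force_def
      by (intro infsum_mono rapid_summable[OF rapid_force_density[OF r]]
          rapid_summable[OF rapid_cmult[OF rapid_add[OF rs(1)[OF rd] rd]]] force_density_bound)
    finally show ?thesis .
  qed
  have K: "(\<Sum>\<^sub>\<infinity>j. kin (a t) j) \<ge> 2 * mass (a t) - 40 * mass (ham (a t)) - 10 * pot_mass (a t)"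
  proof -
    let ?p = "\<lambda>t j. ?n t j + (1/2) * (?n t (j - 1) + ?n t (j + 1))"
    have rq: "rapid (\<lambda>t j. ?n t (j - 1) + ?n t (j + 1))" by (intro rapid_add rs(1)[OF rn] rs(2)[OF rn])
    have rp: "rapid ?p" by (intro rapid_add rn rapid_cmult rq)
    have "(\<Sum>\<^sub>\<infinity>j. ?p t j) = (\<Sum>\<^sub>\<infinity>j. ?n t j) + (1/2) * ((\<Sum>\<^sub>\<infinity>j. ?n t (j - 1)) + (\<Sum>\<^sub>\<infinity>j. ?n t (j + 1)))"
      by (simp only: infsum_add[OF rapid_summable[OF rn] rapid_summable[OF rapid_cmult[OF rq]]] infsum_cmult_right'
          infsum_add[OF rapid_summable[OF rs(2)[OF rn]] rapid_summable[OF rs(1)[OF rn]]])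
    also have "\<dots> = 2 * mass (a t)"
      unfolding infsum_shift[of "?n t" 1] infsum_shift_minus[of "?n t"] mass_def by simp
    finally have p: "(\<Sum>\<^sub>\<infinity>j. ?p t j) = 2 * mass (a t)" .
    have "(\<Sum>\<^sub>\<infinity>j. ?p t j - 40 * ?b t j - 10 * ?d t j) = (\<Sum>\<^sub>\<infinity>j. ?p t j) - 40 * (\<Sum>\<^sub>\<infinity>j. ?b t j) - 10 * (\<Sum>\<^sub>\<infinity>j. ?d t j)"
      by (simp only: rapid_infsum_diff[OF rapid_diff[OF rp rapid_cmult[OF rb]] rapid_cmult[OF rd]]
          rapid_infsum_diff[OF rp rapid_cmult[OF rb]] infsum_cmult_right')
    moreover have "(\<Sum>\<^sub>\<infinity>j. ?p t j - 40 * ?b t j - 10 * ?d t j) \<le> (\<Sum>\<^sub>\<infinity>j. kin (a t) j)"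
      by (intro infsum_mono rapid_summable[OF rapid_kin[OF r]] kin_lower_bound
          rapid_summable[OF rapid_diff[OF rapid_diff[OF rp rapid_cmult[OF rb]] rapid_cmult[OF rd]]])
    ultimately show ?thesis unfolding p mass_def pot_mass_def by simp
  qed
  have nonneg: "mass u \<ge> 0" for u unfolding mass_def by (intro infsum_nonneg) auto
  show ?thesis using D F K nonneg[of "a t"] nonneg[of "ham (a t)"] by (simp only: distrib_left)
qed

lemma quadratic_growth:
  fixes f f' f'' :: "real \<Rightarrow> real"
  assumes "\<And>t. (f has_real_derivative f' t) (at t)" "\<And>t. (f' has_real_derivative f'' t) (at t)"
    and "\<And>t. f'' t \<ge> 2" "t \<ge> 0"
  shows "f t \<ge> f 0 + f' 0 * t + t\<^sup>2"
proof -
  have 1: "f' s \<ge> f' 0 + 2 * s" if "s \<ge> 0" for s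
  proof -
    have "(\<lambda>s. f' s - 2 * s) 0 \<le> (\<lambda>s. f' s - 2 * s) s"
    proof (rule DERIV_nonneg_imp_nondecreasing[OF that])
      fix x
      have "((\<lambda>s. f' s - 2 * s) has_real_derivative f'' x - 2) (at x)"
        by (auto intro!: derivative_eq_intros assms)
      then show "\<exists>y. ((\<lambda>s. f' s - 2 * s) has_real_derivative y) (at x) \<and> 0 \<le> y"
        using assms(3)[of x] by (intro exI[of _ "f'' x - 2"]) simp
    qed
    then show ?thesis by simp
  qed
  have "(\<lambda>s. f s - f' 0 * s - s\<^sup>2) 0 \<le> (\<lambda>s. f s - f' 0 * s - s\<^sup>2) t"
  proof (rule DERIV_nonneg_imp_nondecreasing[OF assms(4)])
    fix x :: real assume "0 \<le> x"
    have "((\<lambda>s. f s - f' 0 * s - s\<^sup>2) has_real_derivative f' x - f' 0 - 2 * x) (at x)"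
      by (auto intro!: derivative_eq_intros assms)
    then show "\<exists>y. ((\<lambda>s. f s - f' 0 * s - s\<^sup>2) has_real_derivative y) (at x) \<and> 0 \<le> y"
      using 1[OF \<open>0 \<le> x\<close>] by (intro exI[of _ "f' x - f' 0 - 2 * x"]) simp
  qed
  then show ?thesis by simp
qed

text \<open>
  A packet of momentum \<open>\<pi>/2\<close>, where the free lattice motion is fastest and has energy \<open>0\<close>: neighbours
  cancel in the hopping term, and only the two ends contribute to \<open>ham packet\<close>. Its mass grows with
  its length while \<open>\<parallel>ham packet\<parallel>\<^sup>2\<close> stays \<open>1/4\<close>; length \<open>128\<close> makes \<open>N / 16 - 24 B\<close> equal to \<open>2\<close>.
\<close>

definition packet :: "int \<Rightarrow> complex" where
  "packet j = (if 1 \<le> j \<and> j \<le> 128 then \<i> ^ nat j else 0)"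

lemma mass_packet: "mass packet = 128"
proof -
  have "mass packet = (\<Sum>\<^sub>\<infinity>j\<in>{1..128::int}. 1)"
    unfolding mass_def by (rule infsum_cong_neutral) (auto simp: packet_def norm_power)
  then show ?thesis by simp
qed

lemma ham_packet: "(cmod (ham packet j))\<^sup>2 = (if j \<in> {0, 1, 128, 129} then 1/16 else 0)"
proof -
  have h: "ham packet j = (1/4) * (packet (j - 1) + packet (j + 1))" for j
    unfolding ham_def by (simp add: packet_def pot_eq_0)
  consider "j < 0" | "j = 0" | "j = 1" | "2 \<le> j" "j \<le> 127" | "j = 128" | "j = 129" | "j > 129" by linarith
  then show ?thesis
  proof cases
    case 4
    have "nat (j + 1) = Suc (Suc (nat (j - 1)))" using 4 by linarith
    then have "\<i> ^ nat (j + 1) = - (\<i> ^ nat (j - 1))" by simp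
    then show ?thesis unfolding h using 4 by (auto simp: packet_def)
  qed (auto simp: h packet_def norm_mult norm_power norm_divide power_divide power2_eq_square)
qed

lemma mass_ham_packet: "mass (ham packet) = 1/4"
proof -
  have "mass (ham packet) = (\<Sum>\<^sub>\<infinity>j\<in>{0, 1, 128, 129::int}. 1/16)"
    unfolding mass_def ham_packet by (rule infsum_cong_neutral) auto
  then show ?thesis by simp
qed

lemma packet_decay: "cmod (packet j) \<le> 2 ^ 128 * decay j"
proof (cases "1 \<le> j \<and> j \<le> 128")
  case True
  have "(1/2::real) ^ 128 \<le> (1/2) ^ nat \<bar>j\<bar>" using True by (intro power_decreasing) auto
  then show ?thesis using True by (simp add: packet_def norm_power decay_def field_simps)
qed (use decay_pos[of j] in \<open>auto simp: packet_def\<close>)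

lemma ballistic_flow_exists:
  obtains a where "lattice_flow a" "\<And>t. mass (a t) = 128" "\<forall>\<^sub>F t in at_top. spread (a t) \<ge> t\<^sup>2 / 2"
proof -
  obtain a where a: "lattice_flow a" "a 0 = packet" using lattice_flow_exists[OF packet_decay] by metis
  have m: "mass (a t) = 128" for t using mass_conserved[OF a(1), of t] by (simp add: a mass_packet)
  have h: "mass (ham (a t)) = 1/4" for t
    using mass_conserved[OF lattice_flow_ham[OF a(1)], of t] by (simp add: a mass_ham_packet)
  have "force (a t) + (1/4) * (\<Sum>\<^sub>\<infinity>j. kin (a t) j) \<ge> 2" for t
    using acceleration_lower_bound[OF lattice_flow_rapid[OF a(1)], of t] m[of t] h[of t] by simp
  then have g: "spread (a t) \<ge> spread (a 0) + momentum (a 0) * t + t\<^sup>2" if "t \<ge> 0" for t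
    using quadratic_growth[OF spread_deriv[OF a(1)] momentum_deriv[OF a(1)] _ that] by simp
  have "spread (a 0) \<ge> 0" unfolding spread_def by (intro infsum_nonneg) auto
  have "spread (a t) \<ge> t\<^sup>2 / 2" if t: "t \<ge> 2 * \<bar>momentum (a 0)\<bar>" for t
  proof -
    have t0: "t \<ge> 0" using t by linarith
    have "- momentum (a 0) * t \<le> (t / 2) * t" using t t0 by (intro mult_right_mono) auto
    then show ?thesis using g[OF t0] \<open>spread (a 0) \<ge> 0\<close> by (simp add: power2_eq_square)
  qed
  then have "\<forall>\<^sub>F t in at_top. spread (a t) \<ge> t\<^sup>2 / 2" unfolding eventually_at_top_linorder by blast
  then show ?thesis using a(1) m that by blast
qed

lemma power_tangent_line:
  fixes x y :: real
  assumes "x \<ge> 0" "y \<ge> 0"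
  shows "x ^ Suc n \<ge> y ^ Suc n + real (Suc n) * y ^ n * (x - y)"
proof (induction n)
  case (Suc n)
  have "x ^ Suc (Suc n) \<ge> x * (y ^ Suc n + real (Suc n) * y ^ n * (x - y))"
    using mult_left_mono[OF Suc assms(1)] by simp
  moreover have "x * (y ^ Suc n + real (Suc n) * y ^ n * (x - y))
     - (y ^ Suc (Suc n) + real (Suc (Suc n)) * y ^ Suc n * (x - y)) = real (Suc n) * y ^ n * (x - y)\<^sup>2"
    by (simp add: algebra_simps power2_eq_square)
  moreover have "real (Suc n) * y ^ n * (x - y)\<^sup>2 \<ge> 0" using assms by simp
  ultimately show ?case by linarith
qed simp

text \<open>
  Jensen's inequality for \<open>x \<mapsto> x\<^sup>r\<close>, obtained by integrating the tangent line at \<open>y\<close>, a lower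
  bound for the mean of \<open>1 + j\<^sup>2\<close>. Since the mass is fixed, growth of the second moment forces growth
  of all higher ones.
\<close>

lemma higher_moment_lower_bound:
  assumes "rapid a" "r \<ge> 1" "mass (a t) = N" "y \<ge> 0" "spread (a t) \<ge> 2 * N * y"
  shows "(\<Sum>\<^sub>\<infinity>j. (1 + (of_int j)\<^sup>2) ^ r * (cmod (a t j))\<^sup>2) \<ge> N * y ^ r"
proof -
  obtain n where n: "r = Suc n" using assms(2) by (cases r) auto
  let ?x = "\<lambda>j. 1 + (real_of_int j)\<^sup>2"
  let ?n = "\<lambda>t j. (cmod (a t j))\<^sup>2"
  have rn: "rapid ?n" by (rule rapid_norm_sq[OF assms(1)])
  have x0: "?x j \<ge> 0" for j by simp
  have x_le: "?x j \<le> 1 * wt j ^ 2" for j unfolding wt_def by (simp add: power2_eq_square algebra_simps)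
  have rr: "rapid (\<lambda>t j. ?x j ^ r * ?n t j)" for r
  proof (rule rapid_poly_mult[OF rn, where K=1 and p="2 * r"])
    show "norm (?x j ^ r) \<le> 1 * wt j ^ (2 * r)" for j
      using power_mono[OF x_le x0, of j r] by (simp add: power_mult norm_power)
  qed
  have r1: "rapid (\<lambda>t j. ?x j * ?n t j)" using rr[of 1] by simp
  have rq: "rapid (\<lambda>t j. (real_of_int j + 1/2)\<^sup>2 * ?n t j)"
    by (rule rapid_poly_mult[OF rn, where K=1 and p=2]) (use quadratic_weights_le(1) in simp)
  have "spread (a t) \<le> (\<Sum>\<^sub>\<infinity>j. 2 * (?x j * ?n t j))"
    unfolding spread_def
  proof (intro infsum_mono rapid_summable[OF rq] rapid_summable[OF rapid_cmult[OF r1]])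
    fix j
    have "2 * ?x j - (real_of_int j + 1/2)\<^sup>2 = (real_of_int j - 1/2)\<^sup>2 + 3/2"
      by (simp add: power2_eq_square algebra_simps)
    then have "(real_of_int j + 1/2)\<^sup>2 \<le> 2 * ?x j"
      using zero_le_power2[of "real_of_int j - 1/2"] by linarith
    then show "(real_of_int j + 1/2)\<^sup>2 * ?n t j \<le> 2 * (?x j * ?n t j)"
      unfolding mult.assoc[symmetric] by (rule mult_right_mono) simp
  qed
  also have "\<dots> = 2 * (\<Sum>\<^sub>\<infinity>j. ?x j * ?n t j)" by (rule infsum_cmult_right')
  finally have X: "(\<Sum>\<^sub>\<infinity>j. ?x j * ?n t j) \<ge> N * y" using assms(5) by simp
  \<comment> \<open>Slope and constant term of the tangent line of \<open>x \<mapsto> x\<^sup>r\<close> at \<open>y\<close>.\<close>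
  let ?c = "real (Suc n) * y ^ n"
  let ?k = "y ^ Suc n - ?c * y"
  have "N * y ^ r \<le> ?c * (\<Sum>\<^sub>\<infinity>j. ?x j * ?n t j) + ?k * N"
    using mult_left_mono[OF X, of ?c] assms(4) by (simp add: n algebra_simps)
  also have "\<dots> = (\<Sum>\<^sub>\<infinity>j. ?c * (?x j * ?n t j)) + (\<Sum>\<^sub>\<infinity>j. ?k * ?n t j)"
    unfolding assms(3)[symmetric] mass_def by (simp only: infsum_cmult_right')
  also have "\<dots> = (\<Sum>\<^sub>\<infinity>j. ?c * (?x j * ?n t j) + ?k * ?n t j)"
    by (rule infsum_add[symmetric, OF rapid_summable[OF rapid_cmult[OF r1]] rapid_summable[OF rapid_cmult[OF rn]]])
  also have "\<dots> \<le> (\<Sum>\<^sub>\<infinity>j. ?x j ^ r * ?n t j)"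
  proof (intro infsum_mono rapid_summable[OF rr] rapid_summable[OF rapid_add[OF rapid_cmult[OF r1] rapid_cmult[OF rn]]])
    fix j
    have "?c * ?x j + ?k \<le> ?x j ^ r"
      using power_tangent_line[OF x0 assms(4), of n j] unfolding n by (simp add: algebra_simps)
    then have "(?c * ?x j + ?k) * ?n t j \<le> ?x j ^ r * ?n t j" by (rule mult_right_mono) simp
    then show "?c * (?x j * ?n t j) + ?k * ?n t j \<le> ?x j ^ r * ?n t j" by (simp only: distrib_right mult.assoc)
  qed
  finally show ?thesis .
qed

section \<open>Fourier synthesis of solutions\<close>

definition synth :: "(int \<Rightarrow> complex) \<Rightarrow> real \<Rightarrow> complex" where
  "synth c x = (\<Sum>\<^sub>\<infinity>j. c j * cis (of_int j * x))"

lemma synth_summable: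
  assumes "(\<lambda>j. cmod (c j)) summable_on UNIV"
  shows "(\<lambda>j. c j * cis (of_int j * x)) summable_on UNIV"
  by (rule abs_summable_summable) (use assms in \<open>simp add: norm_mult\<close>)

lemma synth_add:
  assumes "(\<lambda>j. cmod (c j)) summable_on UNIV" "(\<lambda>j. cmod (d j)) summable_on UNIV"
  shows "synth (\<lambda>j. c j + d j) x = synth c x + synth d x"
  unfolding synth_def distrib_right by (rule infsum_add[OF synth_summable[OF assms(1)] synth_summable[OF assms(2)]])

lemma synth_scale: "synth (\<lambda>j. z * c j) x = z * synth c x"
  unfolding synth_def mult.assoc by (rule infsum_cmult_right')

lemma synth_shift:
  "synth (\<lambda>j. c (j - 1)) x = cis x * synth c x" "synth (\<lambda>j. c (j + 1)) x = cis (- x) * synth c x"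
proof -
  have 1: "c j * cis (of_int (j + 1) * x) = cis x * (c j * cis (of_int j * x))" for j
    by (simp add: distrib_right cis_mult[symmetric])
  have 2: "c j * cis (of_int (j - 1) * x) = cis (- x) * (c j * cis (of_int j * x))" for j
    by (simp add: left_diff_distrib cis_mult)
  show "synth (\<lambda>j. c (j - 1)) x = cis x * synth c x"
    unfolding synth_def infsum_cmult_right'[symmetric] 1[symmetric]
    using infsum_shift_minus[of "\<lambda>j. c j * cis (of_int (j + 1) * x)"] by simp
  show "synth (\<lambda>j. c (j + 1)) x = cis (- x) * synth c x"
    unfolding synth_def infsum_cmult_right'[symmetric] 2[symmetric]
    using infsum_shift[of "\<lambda>j. c j * cis (of_int (j - 1) * x)" 1] by simp
qed

text \<open>
  The tail of an absolutely convergent series bounds the error uniformly in \<open>x\<close>; continuity,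
  \<open>L\<^sup>2\<close> convergence and the value of the Fourier coefficients of \<open>synth c\<close> all come from this.
\<close>

lemma synth_uniform_limit:
  assumes c: "(\<lambda>j. cmod (c j)) summable_on UNIV"
  shows "uniform_limit UNIV (\<lambda>F x. \<Sum>j\<in>F. c j * cis (of_int j * x)) (synth c) (finite_subsets_at_top UNIV)"
proof (rule uniform_limitI)
  fix e :: real assume "e > 0"
  have "((\<lambda>F. \<Sum>j\<in>F. cmod (c j)) \<longlongrightarrow> (\<Sum>\<^sub>\<infinity>j. cmod (c j))) (finite_subsets_at_top UNIV)"
    using has_sum_infsum[OF c] unfolding has_sum_def .
  then have "\<forall>\<^sub>F F in finite_subsets_at_top UNIV. dist (\<Sum>j\<in>F. cmod (c j)) (\<Sum>\<^sub>\<infinity>j. cmod (c j)) < e"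
    using \<open>e > 0\<close> by (rule tendstoD)
  moreover have "\<forall>\<^sub>F F in finite_subsets_at_top (UNIV :: int set). finite F"
    by (rule eventually_finite_subsets_at_top_weakI)
  ultimately show "\<forall>\<^sub>F F in finite_subsets_at_top UNIV. \<forall>x\<in>UNIV. dist (\<Sum>j\<in>F. c j * cis (of_int j * x)) (synth c x) < e"
  proof eventually_elim
    case (elim F)
    show ?case
    proof
      fix x
      let ?f = "\<lambda>j. c j * cis (of_int j * x)"
      have cF: "(\<lambda>j. cmod (c j)) summable_on - F" by (rule summable_on_subset_banach[OF c]) simp
      have split: "infsum f UNIV = sum f F + infsum f (- F)" if "f summable_on UNIV" for f :: "int \<Rightarrow> 'z::banach"
        using infsum_Un_disjoint[of f F "- F"] elim(2) summable_on_subset_banach[OF that, of "- F"] by simp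
      have "synth c x - sum ?f F = infsum ?f (- F)"
        unfolding synth_def split[OF synth_summable[OF c]] by simp
      moreover have "cmod (infsum ?f (- F)) \<le> (\<Sum>\<^sub>\<infinity>j\<in>- F. cmod (?f j))"
        by (rule norm_infsum_bound) (use cF in \<open>simp add: norm_mult\<close>)
      moreover have "(\<Sum>\<^sub>\<infinity>j\<in>- F. cmod (?f j)) = (\<Sum>\<^sub>\<infinity>j. cmod (c j)) - (\<Sum>j\<in>F. cmod (c j))"
        using split[OF c] by (simp add: norm_mult)
      ultimately have "cmod (synth c x - sum ?f F) < e" using elim(1) by (simp add: dist_real_def)
      then show "dist (sum ?f F) (synth c x) < e" by (simp add: dist_norm norm_minus_commute)
    qed
  qed
qed

lemma synth_continuous:
  assumes "(\<lambda>j. cmod (c j)) summable_on UNIV"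
  shows "continuous_on UNIV (synth c)"
  by (rule uniform_limit_theorem[OF _ synth_uniform_limit[OF assms]])
     (auto intro!: always_eventually continuous_intros)

lemma synth_in_L2:
  assumes c: "(\<lambda>j. cmod (c j)) summable_on UNIV"
  shows "synth c \<in> L2"
proof (rule L2I_bounded)
  show "synth c (x + 2 * pi) = synth c x" for x unfolding synth_def cis_periodic ..
  show "synth c \<in> borel_measurable lebesgue" by (rule continuous_on_imp_lebesgue[OF synth_continuous[OF c]])
  show "cmod (synth c x) \<le> (\<Sum>\<^sub>\<infinity>j. cmod (c j))" for x
    using norm_infsum_bound[of "\<lambda>j. c j * cis (of_int j * x)" UNIV] c unfolding synth_def by (simp add: norm_mult)
qed

lemma L2_norm_le_sup:
  assumes "\<psi> \<in> L2" "\<And>x. cmod (\<psi> x) \<le> K"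
  shows "L2_norm \<psi> \<le> K"
proof (rule power2_le_imp_le)
  have "integral\<^sup>L circ (\<lambda>x. (cmod (\<psi> x))\<^sup>2) \<le> integral\<^sup>L circ (\<lambda>x. K\<^sup>2)"
    by (intro integral_mono L2_integrable_sq assms(1) integrable_circ_const power_mono assms(2) norm_ge_zero)
  then show "(L2_norm \<psi>)\<^sup>2 \<le> K\<^sup>2" unfolding L2_norm_sq integral_circ_const by (simp add: field_simps)
  show "0 \<le> K" by (rule order_trans[OF norm_ge_zero assms(2)[of 0]])
qed

lemma synth_L2_limit:
  assumes c: "(\<lambda>j. cmod (c j)) summable_on UNIV"
  shows "((\<lambda>F. L2_norm (\<lambda>x. synth c x - (\<Sum>j\<in>F. c j * cis (of_int j * x)))) \<longlongrightarrow> 0) (finite_subsets_at_top UNIV)"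
proof (rule tendstoI)
  fix e :: real assume "e > 0"
  then have "\<forall>\<^sub>F F in finite_subsets_at_top UNIV. \<forall>x\<in>UNIV. dist (\<Sum>j\<in>F. c j * cis (of_int j * x)) (synth c x) < e / 2"
    by (intro uniform_limitD[OF synth_uniform_limit[OF c]]) simp
  then show "\<forall>\<^sub>F F in finite_subsets_at_top UNIV. dist (L2_norm (\<lambda>x. synth c x - (\<Sum>j\<in>F. c j * cis (of_int j * x)))) 0 < e"
  proof eventually_elim
    case (elim F)
    have "L2_norm (\<lambda>x. synth c x - (\<Sum>j\<in>F. c j * cis (of_int j * x))) \<le> e / 2"
    proof (rule L2_norm_le_sup)
      show "(\<lambda>x. synth c x - (\<Sum>j\<in>F. c j * cis (of_int j * x))) \<in> L2"
        by (intro L2_diff synth_in_L2[OF c] L2_sum L2_cis)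
      show "cmod (synth c x - (\<Sum>j\<in>F. c j * cis (of_int j * x))) \<le> e / 2" for x
        using elim[rule_format, of x] by (simp add: dist_norm norm_minus_commute)
    qed
    then show ?case using L2_norm_nonneg \<open>e > 0\<close> by simp
  qed
qed

lemma cmod_fourier_coeff_le:
  assumes "\<psi> \<in> L2"
  shows "(cmod (fourier_coeff \<psi> j))\<^sup>2 \<le> (L2_norm \<psi>)\<^sup>2"
  using L2_norm_sq_diff_monomial[OF assms, of "fourier_coeff \<psi> j" j]
    zero_le_power2[of "L2_norm (\<lambda>x. \<psi> x - fourier_coeff \<psi> j * cis (of_int j * x))"] by simp

lemma fourier_coeff_synth:
  assumes c: "(\<lambda>j. cmod (c j)) summable_on UNIV"
  shows "fourier_coeff (synth c) j = c j"
proof -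
  let ?S = "\<lambda>F x. \<Sum>k\<in>F. c k * cis (of_int k * x)"
  have S: "?S F \<in> L2" for F by (intro L2_sum L2_cis)
  have "\<forall>\<^sub>F F in finite_subsets_at_top UNIV. cmod (fourier_coeff (synth c) j - c j) \<le> L2_norm (\<lambda>x. synth c x - ?S F x)"
    unfolding eventually_finite_subsets_at_top
  proof (intro exI[of _ "{j}"] conjI allI impI)
    fix F :: "int set" assume F: "finite F \<and> {j} \<subseteq> F \<and> F \<subseteq> UNIV"
    have e: "fourier_coeff (\<lambda>x. synth c x - ?S F x) j = fourier_coeff (synth c) j - c j"
      using fourier_coeff_diff[OF synth_in_L2[OF c] S[of F], of j] fourier_coeff_sum[of F c j] F by simp
    have "(cmod (fourier_coeff (\<lambda>x. synth c x - ?S F x) j))\<^sup>2 \<le> (L2_norm (\<lambda>x. synth c x - ?S F x))\<^sup>2"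
      by (rule cmod_fourier_coeff_le[OF L2_diff[OF synth_in_L2[OF c] S]])
    then show "cmod (fourier_coeff (synth c) j - c j) \<le> L2_norm (\<lambda>x. synth c x - ?S F x)"
      unfolding e by (rule power2_le_imp_le[OF _ L2_norm_nonneg])
  qed auto
  then have "cmod (fourier_coeff (synth c) j - c j) \<le> 0"
    by (intro tendsto_lowerbound[OF synth_L2_limit[OF c]]) auto
  then show ?thesis by simp
qed

lemma synth_abs_D:
  assumes "(\<lambda>j. cmod (c j)) summable_on UNIV" "(\<lambda>j. cmod (of_real \<bar>of_int j\<bar> * c j)) summable_on UNIV"
  shows "(synth c, synth (\<lambda>j. of_real \<bar>of_int j\<bar> * c j)) \<in> abs_D"
  unfolding abs_D_def quantization_def
  using synth_in_L2[OF assms(1)] synth_in_L2[OF assms(2)] synth_L2_limit[OF assms(2)]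
  by (simp add: fourier_coeff_synth[OF assms(1)])

lemma japanese_powr_le:
  assumes "s \<le> real k"
  shows "japanese j powr (2 * s) \<le> wt j ^ (2 * k)"
proof -
  have "japanese j powr (2 * s) \<le> japanese j powr real (2 * k)"
    using assms japanese_ge_1 by (intro powr_mono) auto
  also have "\<dots> = japanese j ^ (2 * k)" using japanese_pos by (rule powr_realpow)
  also have "\<dots> \<le> wt j ^ (2 * k)"
  proof (rule power_mono)
    have "1 + (real_of_int j)\<^sup>2 \<le> (wt j)\<^sup>2" unfolding wt_def by (simp add: power2_eq_square algebra_simps)
    then have "sqrt (1 + (real_of_int j)\<^sup>2) \<le> sqrt ((wt j)\<^sup>2)" by (rule real_sqrt_le_mono)
    then show "japanese j \<le> wt j" unfolding japanese_def using wt_pos[of j] by simp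
  qed (use japanese_pos[of j] in simp)
  finally show ?thesis .
qed

lemma rapid_sobolev_density:
  assumes "rapid c"
  shows "rapid (\<lambda>t j. japanese j powr (2 * s) * (cmod (c t j))\<^sup>2)"
proof -
  obtain k :: nat where "s \<le> real k" using real_arch_simple by blast
  then show ?thesis
    by (intro rapid_poly_mult[OF rapid_norm_sq[OF assms], where K=1 and p="2 * k"]) (simp add: japanese_powr_le)
qed

lemma synth_in_sobolev:
  assumes "rapid c"
  shows "synth (c t) \<in> sobolev s"
  unfolding sobolev_def
  using synth_in_L2[OF rapid_abs_summable[OF assms]] rapid_summable[OF rapid_sobolev_density[OF assms, of s]]
  by (simp add: fourier_coeff_synth[OF rapid_abs_summable[OF assms]])

lemma sobolev_norm_synth:
  assumes "(\<lambda>j. cmod (c j)) summable_on UNIV"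
  shows "sobolev_norm s (synth c) = sqrt (\<Sum>\<^sub>\<infinity>j. japanese j powr (2 * s) * (cmod (c j))\<^sup>2)"
  unfolding sobolev_norm_def fourier_coeff_synth[OF assms] ..

text \<open>
  Two powers of the weight beyond the Sobolev order make the series of squares, and that of the
  coefficients themselves, converge.
\<close>

lemma sobolev_norm_synth_le:
  assumes "C \<ge> 0" "\<And>j. wt j ^ (k + 2) * cmod (e j) \<le> C" "s \<le> real k"
  shows "(\<lambda>j. cmod (e j)) summable_on UNIV"
    and "sobolev_norm s (synth e) \<le> C * sqrt (\<Sum>\<^sub>\<infinity>j. 1 / wt j ^ 2)"
proof -
  have Z: "(\<lambda>j. c * (1 / wt j ^ 2)) summable_on UNIV" for c
    by (rule summable_on_cmult_right[OF summable_on_inverse_wt_sq])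
  have 1: "cmod (e j) \<le> C * (1 / wt j ^ 2)" for j
  proof -
    have "wt j ^ 2 * cmod (e j) \<le> wt j ^ (k + 2) * cmod (e j)"
      using wt_ge_1[of j] by (intro mult_right_mono power_increasing) auto
    then show ?thesis using assms(2)[of j] wt_pos[of j] by (simp add: field_simps)
  qed
  show sum: "(\<lambda>j. cmod (e j)) summable_on UNIV"
    by (rule summable_on_comparison_test[OF Z[of C]]) (use 1 in auto)
  have 2: "japanese j powr (2 * s) * (cmod (e j))\<^sup>2 \<le> C\<^sup>2 * (1 / wt j ^ 2)" for j
  proof -
    have "japanese j powr (2 * s) * (cmod (e j))\<^sup>2 \<le> wt j ^ (2 * k) * (cmod (e j))\<^sup>2"
      by (intro mult_right_mono japanese_powr_le assms) simp
    moreover have "wt j ^ (2 * k) * (cmod (e j))\<^sup>2 * wt j ^ 2 \<le> C\<^sup>2"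
    proof -
      have "wt j ^ (2 * k) * (cmod (e j))\<^sup>2 * wt j ^ 2 = (wt j ^ (k + 1) * cmod (e j))\<^sup>2"
        by (simp add: power_mult_distrib power_add power2_eq_square mult_2 power_mult)
      also have "\<dots> \<le> (wt j ^ (k + 2) * cmod (e j))\<^sup>2"
        using wt_ge_1[of j] by (intro power_mono mult_right_mono power_increasing) auto
      also have "\<dots> \<le> C\<^sup>2" using wt_pos[of j] assms(2)[of j] by (intro power_mono) auto
      finally show ?thesis .
    qed
    then have "wt j ^ (2 * k) * (cmod (e j))\<^sup>2 \<le> C\<^sup>2 * (1 / wt j ^ 2)"
      using wt_pos[of j] by (simp add: pos_le_divide_eq)
    ultimately show ?thesis by linarith
  qed
  have "(\<lambda>j. japanese j powr (2 * s) * (cmod (e j))\<^sup>2) summable_on UNIV"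
    by (rule summable_on_comparison_test[OF Z[of "C\<^sup>2"]]) (use 2 in auto)
  then have "(\<Sum>\<^sub>\<infinity>j. japanese j powr (2 * s) * (cmod (e j))\<^sup>2) \<le> (\<Sum>\<^sub>\<infinity>j. C\<^sup>2 * (1 / wt j ^ 2))"
    by (intro infsum_mono Z 2)
  also have "\<dots> = C\<^sup>2 * (\<Sum>\<^sub>\<infinity>j. 1 / wt j ^ 2)" by (rule infsum_cmult_right')
  finally have "sobolev_norm s (synth e) \<le> sqrt (C\<^sup>2 * (\<Sum>\<^sub>\<infinity>j. 1 / wt j ^ 2))"
    unfolding sobolev_norm_synth[OF sum] by (rule real_sqrt_le_mono)
  then show "sobolev_norm s (synth e) \<le> C * sqrt (\<Sum>\<^sub>\<infinity>j. 1 / wt j ^ 2)"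
    using assms(1) by (simp add: real_sqrt_mult)
qed

text \<open>
  Taylor's formula in every coefficient, uniformly in the weight. The first-order estimate is applied
  to \<open>c'\<close> to bound the variation of the derivative in the second-order one.
\<close>

lemma rapid_increment_bound:
  fixes c c' c'' :: "real \<Rightarrow> int \<Rightarrow> complex"
  assumes "rapid c'" "rapid c''"
    and c: "\<And>t j. ((\<lambda>t. c t j) has_vector_derivative c' t j) (at t)"
    and c': "\<And>t j. ((\<lambda>t. c' t j) has_vector_derivative c'' t j) (at t)"
  obtains C where "C \<ge> 0"
    "\<And>h j. \<bar>h\<bar> \<le> 1 \<Longrightarrow> wt j ^ k * cmod (c (t + h) j - c t j) \<le> \<bar>h\<bar> * C"
    "\<And>h j. \<bar>h\<bar> \<le> 1 \<Longrightarrow> wt j ^ k * cmod (c (t + h) j - c t j - h *\<^sub>R c' t j) \<le> \<bar>h\<bar>\<^sup>2 * C"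
proof -
  obtain C1 where C1: "C1 \<ge> 0" "\<And>s j. \<bar>s\<bar> \<le> \<bar>t\<bar> + 1 \<Longrightarrow> wt j ^ k * cmod (c' s j) \<le> C1"
    using rapidE[OF assms(1)] by metis
  obtain C2 where C2: "C2 \<ge> 0" "\<And>s j. \<bar>s\<bar> \<le> \<bar>t\<bar> + 1 \<Longrightarrow> wt j ^ k * cmod (c'' s j) \<le> C2"
    using rapidE[OF assms(2)] by metis
  have first: "wt j ^ k * cmod (f (t + h) - f t) \<le> \<bar>h\<bar> * (3 * M)"
    if h: "\<bar>h\<bar> \<le> 1" and f: "\<And>s. (f has_vector_derivative f' s) (at s)"
      and M: "\<And>s. \<bar>s\<bar> \<le> \<bar>t\<bar> + 1 \<Longrightarrow> wt j ^ k * cmod (f' s) \<le> M" for f f' h j M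
  proof -
    let ?S = "closed_segment t (t + h)"
    have S: "\<bar>s\<bar> \<le> \<bar>t\<bar> + 1" if "s \<in> ?S" for s
      using that h by (auto simp: closed_segment_eq_real_ivl split: if_splits)
    have w: "wt j ^ k > 0" using wt_pos[of j] by simp
    have b: "cmod (f' s) \<le> M / wt j ^ k" if "s \<in> ?S" for s
      using M[OF S[OF that]] w by (simp add: pos_le_divide_eq mult.commute)
    have "norm (f (t + h) - f t - (t + h - t) *\<^sub>R f' t) \<le> norm (t + h - t) * (2 * M / wt j ^ k)"
    proof (rule vector_differentiable_bound_linearization[where S="?S"])
      show "(f has_vector_derivative f' s) (at s within ?S)" for s
        by (rule has_vector_derivative_at_within[OF f])
      show "norm (f' s - f' t) \<le> 2 * M / wt j ^ k" if "s \<in> ?S" for s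
        using norm_triangle_ineq4[of "f' s" "f' t"] b[OF that] b[of t] by simp
    qed auto
    then have "cmod (f (t + h) - f t - h *\<^sub>R f' t) \<le> \<bar>h\<bar> * (2 * M / wt j ^ k)" by simp
    moreover have "cmod (h *\<^sub>R f' t) \<le> \<bar>h\<bar> * (M / wt j ^ k)"
      using mult_left_mono[OF b[OF ends_in_segment(1)] abs_ge_zero[of h]] by simp
    ultimately have "cmod (f (t + h) - f t) \<le> \<bar>h\<bar> * (2 * M / wt j ^ k) + \<bar>h\<bar> * (M / wt j ^ k)"
      using norm_triangle_ineq[of "f (t + h) - f t - h *\<^sub>R f' t" "h *\<^sub>R f' t"]
      unfolding diff_add_cancel by linarith
    also have "\<dots> = \<bar>h\<bar> * (3 * M) / wt j ^ k" by (simp add: add_divide_distrib[symmetric])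
    finally show ?thesis using w by (simp add: pos_le_divide_eq mult.commute)
  qed
  have second: "wt j ^ k * cmod (c (t + h) j - c t j - h *\<^sub>R c' t j) \<le> \<bar>h\<bar>\<^sup>2 * (3 * C2)" if h: "\<bar>h\<bar> \<le> 1" for h j
  proof -
    let ?S = "closed_segment t (t + h)"
    have w: "wt j ^ k > 0" using wt_pos[of j] by simp
    have "norm (c (t + h) j - c t j - (t + h - t) *\<^sub>R c' t j) \<le> norm (t + h - t) * (\<bar>h\<bar> * (3 * C2) / wt j ^ k)"
    proof (rule vector_differentiable_bound_linearization[where S="?S" and f="\<lambda>t. c t j" and f'="\<lambda>t. c' t j"])
      show "((\<lambda>t. c t j) has_vector_derivative c' s j) (at s within ?S)" for s
        by (rule has_vector_derivative_at_within[OF c])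
      show "norm (c' s j - c' t j) \<le> \<bar>h\<bar> * (3 * C2) / wt j ^ k" if "s \<in> ?S" for s
      proof -
        have sh: "\<bar>s - t\<bar> \<le> \<bar>h\<bar>" using that by (auto simp: closed_segment_eq_real_ivl split: if_splits)
        have "wt j ^ k * cmod (c' (t + (s - t)) j - c' t j) \<le> \<bar>s - t\<bar> * (3 * C2)"
          using sh h by (intro first[OF _ c' C2(2)]) auto
        also have "\<dots> \<le> \<bar>h\<bar> * (3 * C2)" using sh C2(1) by (intro mult_right_mono) auto
        finally show ?thesis using w by (simp add: pos_le_divide_eq mult.commute)
      qed
    qed auto
    then show ?thesis using w by (simp add: pos_le_divide_eq mult.commute power2_eq_square mult.left_commute)
  qed
  show ?thesis
  proof (rule that[of "3 * C1 + 3 * C2"])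
    show "wt j ^ k * cmod (c (t + h) j - c t j) \<le> \<bar>h\<bar> * (3 * C1 + 3 * C2)" if "\<bar>h\<bar> \<le> 1" for h j
      using first[OF that c C1(2), of j] mult_nonneg_nonneg[OF abs_ge_zero C2(1), of h] by (simp add: algebra_simps)
    show "wt j ^ k * cmod (c (t + h) j - c t j - h *\<^sub>R c' t j) \<le> \<bar>h\<bar>\<^sup>2 * (3 * C1 + 3 * C2)" if "\<bar>h\<bar> \<le> 1" for h j
      using second[OF that, of j] mult_nonneg_nonneg[OF zero_le_power2 C1(1), of "\<bar>h\<bar>"] by (simp add: algebra_simps)
  qed (use C1(1) C2(1) in simp)
qed

lemma synth_curve_differentiable:
  fixes c c' c'' :: "real \<Rightarrow> int \<Rightarrow> complex"
  assumes r: "rapid c" "rapid c'" "rapid c''"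
    and c: "\<And>t j. ((\<lambda>t. c t j) has_vector_derivative c' t j) (at t)"
    and c': "\<And>t j. ((\<lambda>t. c' t j) has_vector_derivative c'' t j) (at t)"
  shows "((\<lambda>u. sobolev_norm s (\<lambda>x. synth (c u) x - synth (c t) x)) \<longlongrightarrow> 0) (at t)"
    and "((\<lambda>h. sobolev_norm s (\<lambda>x. (synth (c (t + h)) x - synth (c t) x) / of_real h - synth (c' t) x)) \<longlongrightarrow> 0) (at 0)"
proof -
  obtain k :: nat where k: "s \<le> real k" using real_arch_simple by blast
  obtain C where C: "C \<ge> 0"
    "\<And>h j. \<bar>h\<bar> \<le> 1 \<Longrightarrow> wt j ^ (k + 2) * cmod (c (t + h) j - c t j) \<le> \<bar>h\<bar> * C"
    "\<And>h j. \<bar>h\<bar> \<le> 1 \<Longrightarrow> wt j ^ (k + 2) * cmod (c (t + h) j - c t j - h *\<^sub>R c' t j) \<le> \<bar>h\<bar>\<^sup>2 * C"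
    using rapid_increment_bound[OF r(2,3) c c'] by metis
  let ?Z = "sqrt (\<Sum>\<^sub>\<infinity>j. 1 / wt j ^ 2)"
  have nonneg: "0 \<le> sobolev_norm s \<psi>" for \<psi>
    unfolding sobolev_norm_def by (intro real_sqrt_ge_zero infsum_nonneg) simp
  have lim: "(g \<longlongrightarrow> 0) (at 0)" if "\<And>h. h \<noteq> 0 \<Longrightarrow> \<bar>h\<bar> \<le> 1 \<Longrightarrow> g h \<le> \<bar>h\<bar> * C * ?Z" "\<And>h. 0 \<le> g h" for g :: "real \<Rightarrow> real"
  proof (rule tendsto_sandwich[where f="\<lambda>_. 0" and h="\<lambda>h. \<bar>h\<bar> * C * ?Z"])
    show "\<forall>\<^sub>F h in at 0. g h \<le> \<bar>h\<bar> * C * ?Z"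
      unfolding eventually_at using that(1) by (intro exI[of _ 1]) auto
    show "((\<lambda>h. \<bar>h\<bar> * C * ?Z) \<longlongrightarrow> 0) (at 0)" by (rule tendsto_eq_intros refl | simp)+
  qed (use that(2) in auto)
  note sum = rapid_abs_summable
  have sub: "synth (\<lambda>j. d j - e j) x = synth d x - synth e x"
    if "(\<lambda>j. cmod (d j)) summable_on UNIV" "(\<lambda>j. cmod (e j)) summable_on UNIV" for d e x
    using synth_add[of d "\<lambda>j. (-1) * e j" x] synth_scale[of "-1" e x] that by simp
  have "((\<lambda>h. sobolev_norm s (\<lambda>x. synth (c (t + h)) x - synth (c t) x)) \<longlongrightarrow> 0) (at 0)"
  proof (rule lim)
    fix h :: real assume h: "\<bar>h\<bar> \<le> 1"
    have "(\<lambda>x. synth (c (t + h)) x - synth (c t) x) = synth (\<lambda>j. c (t + h) j - c t j)"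
      using sub[OF sum[OF r(1)] sum[OF r(1)]] by auto
    then show "sobolev_norm s (\<lambda>x. synth (c (t + h)) x - synth (c t) x) \<le> \<bar>h\<bar> * C * ?Z"
      using sobolev_norm_synth_le(2)[OF _ C(2)[OF h] k] C(1) by simp
  qed (rule nonneg)
  then show "((\<lambda>u. sobolev_norm s (\<lambda>x. synth (c u) x - synth (c t) x)) \<longlongrightarrow> 0) (at t)"
    by (subst LIM_offset_zero_iff) auto
  show "((\<lambda>h. sobolev_norm s (\<lambda>x. (synth (c (t + h)) x - synth (c t) x) / of_real h - synth (c' t) x)) \<longlongrightarrow> 0) (at 0)"
  proof (rule lim)
    fix h :: real assume h0: "h \<noteq> 0" and h: "\<bar>h\<bar> \<le> 1"
    let ?e = "\<lambda>j. of_real (1 / h) * (c (t + h) j - c t j - of_real h * c' t j)"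
    have hc: "(\<lambda>j. cmod (of_real h * c' t j)) summable_on UNIV"
      using summable_on_cmult_right[OF sum[OF r(2), of t], of "\<bar>h\<bar>"] by (simp add: norm_mult)
    have dc: "(\<lambda>j. cmod (c (t + h) j - c t j)) summable_on UNIV"
      by (rule sobolev_norm_synth_le(1)[OF _ C(2)[OF h] k]) (use C(1) in simp)
    have "synth ?e x = (synth (c (t + h)) x - synth (c t) x) / of_real h - synth (c' t) x" for x
    proof -
      have "synth ?e x = of_real (1 / h) * ((synth (c (t + h)) x - synth (c t) x) - of_real h * synth (c' t) x)"
        unfolding synth_scale sub[OF dc hc] sub[OF sum[OF r(1)] sum[OF r(1)]] ..
      then show ?thesis using h0 by (simp add: field_simps)
    qed
    then have "(\<lambda>x. (synth (c (t + h)) x - synth (c t) x) / of_real h - synth (c' t) x) = synth ?e" by auto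
    moreover have "wt j ^ (k + 2) * cmod (?e j) \<le> \<bar>h\<bar> * C" for j
    proof -
      have cancel: "(1 / y) * (y\<^sup>2 * C) = y * C" if "y \<noteq> 0" for y
        using that by (simp add: power2_eq_square)
      have "wt j ^ (k + 2) * cmod (?e j) = (1 / \<bar>h\<bar>) * (wt j ^ (k + 2) * cmod (c (t + h) j - c t j - of_real h * c' t j))"
        unfolding norm_mult norm_of_real by simp
      also have "\<dots> \<le> (1 / \<bar>h\<bar>) * (\<bar>h\<bar>\<^sup>2 * C)" by (intro mult_left_mono C(3)[OF h, unfolded scaleR_conv_of_real]) simp
      also have "\<dots> = \<bar>h\<bar> * C" using cancel[of "\<bar>h\<bar>"] h0 by simp
      finally show ?thesis .
    qed
    ultimately show "sobolev_norm s (\<lambda>x. (synth (c (t + h)) x - synth (c t) x) / of_real h - synth (c' t) x) \<le> \<bar>h\<bar> * C * ?Z"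
      using sobolev_norm_synth_le(2)[of "\<bar>h\<bar> * C" k ?e s] k C(1) by simp
  qed (rule nonneg)
qed

section \<open>Solutions of the half-wave equation\<close>

text \<open>
  The passage back from the moving frame to the laboratory frame.
\<close>

definition rotated :: "(real \<Rightarrow> int \<Rightarrow> complex) \<Rightarrow> real \<Rightarrow> int \<Rightarrow> complex" where
  "rotated a t j = cis (- (of_int j * t)) * a t j"

lemma rapid_rotated: "rapid a \<Longrightarrow> rapid (rotated a)"
  by (rule rapid_norm_le[where c=a]) (simp_all add: rotated_def norm_mult)

lemma rotated_deriv:
  assumes "((\<lambda>t. a t j) has_vector_derivative a' t j) (at t)"
  shows "((\<lambda>t. rotated a t j) has_vector_derivative rotated (\<lambda>t j. a' t j - \<i> * of_int j * a t j) t j) (at t)"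
proof -
  have "((\<lambda>t. cis (- (of_int j * t))) has_vector_derivative - \<i> * of_int j * cis (- (of_int j * t))) (at t)"
    by (auto simp: has_vector_derivative_complex_iff intro!: derivative_eq_intros)
  from has_vector_derivative_mult[OF this assms] show ?thesis
    unfolding rotated_def by (simp add: algebra_simps)
qed

lemma rapid_int_mult: "rapid c \<Longrightarrow> rapid (\<lambda>t j. \<i> * of_int j * c t j)"
  by (rule rapid_poly_mult[where K=1 and p=1]) (auto simp: norm_mult wt_def)

abbreviation wave_potential :: "real \<Rightarrow> L2_op" where
  "wave_potential t \<equiv> quantization (\<lambda>x j. (1/2) * cos (x - t))"

lemma wave_potential_bounds:
  "(1/2) * cos (x + 2 * pi - t) = (1/2) * cos (x - t)" "continuous_on UNIV (\<lambda>x. (1/2) * cos (x - t :: real))"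
  "\<bar>(1/2) * cos (x - t)\<bar> \<le> (1/2 :: real)"
proof -
  show "(1/2) * cos (x + 2 * pi - t) = (1/2) * cos (x - t)"
    using cos_periodic[of "x - t"] by (simp add: algebra_simps)
  show "continuous_on UNIV (\<lambda>x. (1/2) * cos (x - t :: real))" by (intro continuous_intros)
qed (simp add: abs_mult)

text \<open>
  Multiplication by \<open>cos (x - t) / 2\<close> moves frequency \<open>j\<close> to \<open>j \<plusminus> 1\<close> with amplitude \<open>1/4\<close> and phase
  \<open>e\<^sup>\<mp>\<^sup>i\<^sup>t\<close>. The rotation \<open>e\<^sup>-\<^sup>i\<^sup>j\<^sup>t\<close> absorbs exactly these phases and turns the energy \<open>|j|\<close> into
  \<open>pot j = |j| - j\<close>, so the half-wave equation becomes \<open>i a' = ham a\<close>.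
\<close>

lemma half_wave_solution_of_lattice_flow:
  assumes a: "lattice_flow a"
  shows "half_wave_solution s wave_potential (\<lambda>t. synth (rotated a t))"
proof -
  let ?c = "rotated a"
  define b where "b t j = - \<i> * ham (a t) j - \<i> * of_int j * a t j" for t j
  define b' where "b' t j = - \<i> * (- \<i> * ham (ham (a t)) j) - \<i> * of_int j * (- \<i> * ham (a t) j)" for t j
  let ?c' = "rotated b"
  define d where "d t j = b' t j - \<i> * of_int j * b t j" for t j
  let ?c'' = "rotated d"
  note ra = lattice_flow_rapid[OF a]
  note rh = rapid_ham[OF ra]
  have rb: "rapid b" unfolding b_def by (intro rapid_diff rapid_cmult rapid_int_mult ra rh)
  have rb': "rapid b'" unfolding b'_def
    by (intro rapid_diff rapid_cmult rapid_int_mult rh rapid_ham[OF rh])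
  have rd: "rapid d" unfolding d_def by (intro rapid_diff rb' rapid_int_mult rb)
  note r = rapid_rotated[OF ra] rapid_rotated[OF rb] rapid_rotated[OF rd]
  have da: "((\<lambda>t. a t j) has_vector_derivative - \<i> * ham (a t) j) (at t)"
    and dh: "((\<lambda>t. ham (a t) j) has_vector_derivative - \<i> * ham (ham (a t)) j) (at t)" for t j
    using a lattice_flow_ham[OF a] unfolding lattice_flow_def by blast+
  have dc: "((\<lambda>t. ?c t j) has_vector_derivative ?c' t j) (at t)" for t j
    using rotated_deriv[of a j "\<lambda>t j. - \<i> * ham (a t) j" t, OF da] unfolding b_def .
  have db: "((\<lambda>t. b t j) has_vector_derivative b' t j) (at t)" for t j
    unfolding b_def b'_def
    by (intro has_vector_derivative_diff has_vector_derivative_mult_right da dh)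
  have dc': "((\<lambda>t. ?c' t j) has_vector_derivative ?c'' t j) (at t)" for t j
    using rotated_deriv[of b j b' t, OF db] unfolding d_def .
  have sum: "(\<lambda>j. cmod (?c t j)) summable_on UNIV" for t by (rule rapid_abs_summable[OF r(1)])
  have ru: "rapid (\<lambda>t j. of_real \<bar>of_int j\<bar> * ?c t j)"
    by (rule rapid_poly_mult[OF r(1), where K=1 and p=1]) (auto simp: wt_def)
  let ?u = "\<lambda>t. synth (\<lambda>j. of_real \<bar>of_int j\<bar> * ?c t j)"
  let ?v = "\<lambda>t x. of_real ((1/2) * cos (x - t)) * synth (?c t) x"
  have eq: "\<i> * synth (?c' t) x = ?u t x + ?v t x" for t x
  proof -
    let ?l = "\<lambda>j. (1/4) * (cis (- t) * ?c t (j - 1))" and ?r = "\<lambda>j. (1/4) * (cis t * ?c t (j + 1))"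
    have rl: "rapid (\<lambda>t' j. (1/4) * (cis (- t) * ?c t' (j - 1)))" and rr: "rapid (\<lambda>t' j. (1/4) * (cis t * ?c t' (j + 1)))"
      by (intro rapid_cmult rapid_shift rapid_shift_minus r(1))+
    have sl: "(\<lambda>j. cmod (?l j)) summable_on UNIV" and sr: "(\<lambda>j. cmod (?r j)) summable_on UNIV"
      and slr: "(\<lambda>j. cmod (?l j + ?r j)) summable_on UNIV"
      by (rule rapid_abs_summable[OF rl] rapid_abs_summable[OF rr] rapid_abs_summable[OF rapid_add[OF rl rr]])+
    \<comment> \<open>The equation for one Fourier coefficient; \<open>pot j + j = |j|\<close>.\<close>
    have coeff: "\<i> * ?c' t j = of_real \<bar>of_int j\<bar> * ?c t j + (?l j + ?r j)" for j
    proof -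
      have 1: "cis (- t) * ?c t (j - 1) = cis (- (of_int j * t)) * a t (j - 1)"
        and 2: "cis t * ?c t (j + 1) = cis (- (of_int j * t)) * a t (j + 1)"
        unfolding rotated_def mult.assoc[symmetric] cis_mult by (simp_all add: algebra_simps)
      show ?thesis unfolding 1 2 unfolding rotated_def b_def ham_def pot_def by (simp add: algebra_simps)
    qed
    have "\<i> * synth (?c' t) x = synth (\<lambda>j. of_real \<bar>of_int j\<bar> * ?c t j + (?l j + ?r j)) x"
      unfolding coeff[symmetric] synth_scale ..
    also have "\<dots> = ?u t x + (synth ?l x + synth ?r x)"
      unfolding synth_add[OF rapid_abs_summable[OF ru] slr] synth_add[OF sl sr] ..
    also have "synth ?l x = (1/4) * (cis (x - t) * synth (?c t) x)"
      unfolding synth_scale synth_shift(1) by (simp add: cis_mult mult.assoc[symmetric])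
    also have "synth ?r x = (1/4) * (cis (t - x) * synth (?c t) x)"
      unfolding synth_scale synth_shift(2) by (simp add: cis_mult mult.assoc[symmetric])
    also have "(1/4) * (cis (x - t) * synth (?c t) x) + (1/4) * (cis (t - x) * synth (?c t) x) = ?v t x"
    proof -
      have "cis (x - t) + cis (t - x) = of_real (2 * cos (x - t))"
        using cos_minus[of "x - t"] sin_minus[of "x - t"] by (simp add: complex_eq_iff)
      then have "(1/4) * ((cis (x - t) + cis (t - x)) * synth (?c t) x) = ?v t x" by simp
      then show ?thesis by (simp add: algebra_simps)
    qed
    finally show ?thesis .
  qed
  show ?thesis
    unfolding half_wave_solution_def
  proof (intro conjI allI)
    fix t
    show "synth (?c t) \<in> sobolev s" by (rule synth_in_sobolev[OF r(1)])
    show "((\<lambda>u. sobolev_norm s (\<lambda>x. synth (?c u) x - synth (?c t) x)) \<longlongrightarrow> 0) (at t)"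
      by (rule synth_curve_differentiable(1)[OF r dc dc'])
    have "?v t \<in> L2"
    proof (rule L2_mult_bounded[OF synth_in_L2[OF sum], where B="1/2"])
      show "(\<lambda>x. complex_of_real ((1/2) * cos (x - t))) \<in> borel_measurable lebesgue"
        by (intro continuous_on_imp_lebesgue continuous_intros)
      show "complex_of_real ((1/2) * cos (x + 2 * pi - t)) = complex_of_real ((1/2) * cos (x - t))" for x
        unfolding wave_potential_bounds(1) ..
      show "cmod (complex_of_real ((1/2) * cos (x - t))) \<le> 1/2" for x
        unfolding norm_of_real by (rule wave_potential_bounds(3))
    qed
    then have v: "(synth (?c t), ?v t) \<in> wave_potential t"
      unfolding quantization_multiplication[of "\<lambda>x. (1/2) * cos (x - t)", OF wave_potential_bounds]
      using synth_in_L2[OF sum] by simp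
    show "\<exists>\<psi>' u v. \<psi>' \<in> sobolev (s - 1) \<and>
        ((\<lambda>h. sobolev_norm (s - 1) (\<lambda>x. (synth (?c (t + h)) x - synth (?c t) x) / of_real h - \<psi>' x)) \<longlongrightarrow> 0) (at 0) \<and>
        (synth (?c t), u) \<in> abs_D \<and> (synth (?c t), v) \<in> wave_potential t \<and>
        (AE x in lebesgue. \<i> * \<psi>' x = u x + v x)"
    proof (intro exI conjI)
      show "synth (?c' t) \<in> sobolev (s - 1)" by (rule synth_in_sobolev[OF r(2)])
      show "((\<lambda>h. sobolev_norm (s - 1) (\<lambda>x. (synth (?c (t + h)) x - synth (?c t) x) / of_real h - synth (?c' t) x)) \<longlongrightarrow> 0) (at 0)"
        by (rule synth_curve_differentiable(2)[OF r dc dc'])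
      show "(synth (?c t), ?u t) \<in> abs_D" by (rule synth_abs_D[OF sum rapid_abs_summable[OF ru]])
      show "(synth (?c t), ?v t) \<in> wave_potential t" by (rule v)
      show "AE x in lebesgue. \<i> * synth (?c' t) x = ?u t x + ?v t x" by (rule AE_I2[OF eq])
    qed
  qed
qed

theorem theorem3p17:
  "\<exists>V :: real \<Rightarrow> L2_op.
     V \<in> smooth_pseudo_diff 0 \<and>
     (\<forall>t. self_adjoint_op (V t)) \<and>
     (\<forall>r :: nat. r \<ge> 1 \<longrightarrow>
        (\<exists>C > (0 :: real). \<exists>\<psi> :: real \<Rightarrow> real \<Rightarrow> complex.
           half_wave_solution (real r) V \<psi> \<and>
           (\<forall>t\<ge>0. \<psi> t \<in> sobolev (real r)) \<and>
           (\<forall>\<^sub>F t in at_top. sobolev_norm (real r) (\<psi> t) \<ge> C * t ^ r)))"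
proof (intro exI[of _ wave_potential] conjI allI impI)
  have "wave_potential t \<in> pseudo_diff_ops 0" for t
    unfolding pseudo_diff_ops_def by (intro imageI cos_multiplier_in_symbol_class)
  then show "wave_potential \<in> smooth_pseudo_diff 0"
    unfolding smooth_pseudo_diff_def using smooth_symbol_curve_travelling_wave[of "1/2"] by blast
  show "self_adjoint_op (wave_potential t)" for t
    by (rule self_adjoint_multiplication[OF wave_potential_bounds])
  obtain a where a: "lattice_flow a" and m: "\<And>t. mass (a t) = 128"
    and sp: "\<forall>\<^sub>F t in at_top. spread (a t) \<ge> t\<^sup>2 / 2"
    using ballistic_flow_exists by metis
  note ra = lattice_flow_rapid[OF a]
  fix r :: nat assume r: "r \<ge> 1"
  let ?\<psi> = "\<lambda>t. synth (rotated a t)"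
  \<comment> \<open>The second moment \<open>t\<^sup>2 / 2\<close> is \<open>2 N y\<close> with \<open>N = 128\<close> and \<open>y = t\<^sup>2 / 512\<close>.\<close>
  let ?C = "sqrt (128 * (1 / 512) ^ r)"
  have bound: "sobolev_norm (real r) (?\<psi> t) \<ge> ?C * t ^ r" if t: "spread (a t) \<ge> t\<^sup>2 / 2" "t \<ge> 0" for t
  proof -
    have jp: "japanese j powr (2 * real r) = (1 + (real_of_int j)\<^sup>2) ^ r" for j
    proof -
      have "japanese j powr (2 * real r) = japanese j powr real (2 * r)" by simp
      also have "\<dots> = (japanese j ^ 2) ^ r" using japanese_pos[of j] by (simp only: powr_realpow power_mult)
      also have "japanese j ^ 2 = 1 + (real_of_int j)\<^sup>2" unfolding japanese_def by simp
      finally show ?thesis .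
    qed
    have cm: "cmod (rotated a t j) = cmod (a t j)" for j by (simp add: rotated_def norm_mult)
    have "?C * t ^ r = sqrt (128 * (t\<^sup>2 / 512) ^ r)"
    proof -
      have "128 * (t\<^sup>2 / 512) ^ r = (128 * (1 / 512) ^ r) * (t ^ r)\<^sup>2"
        by (simp add: power_divide power_mult[symmetric] mult.commute)
      then show ?thesis using t(2) by (simp only: real_sqrt_mult real_sqrt_abs) simp
    qed
    also have "\<dots> \<le> sqrt (\<Sum>\<^sub>\<infinity>j. (1 + (of_int j)\<^sup>2) ^ r * (cmod (a t j))\<^sup>2)"
      by (intro real_sqrt_le_mono higher_moment_lower_bound[where a=a, OF ra r m]) (use t in auto)
    also have "\<dots> = sobolev_norm (real r) (?\<psi> t)"
      unfolding sobolev_norm_synth[OF rapid_abs_summable[OF rapid_rotated[OF ra]]] jp cm ..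
    finally show ?thesis .
  qed
  have "\<forall>\<^sub>F t in at_top. sobolev_norm (real r) (?\<psi> t) \<ge> ?C * t ^ r"
    using sp eventually_ge_at_top[of 0] by eventually_elim (rule bound)
  then show "\<exists>C > (0 :: real). \<exists>\<psi> :: real \<Rightarrow> real \<Rightarrow> complex.
           half_wave_solution (real r) wave_potential \<psi> \<and>
           (\<forall>t\<ge>0. \<psi> t \<in> sobolev (real r)) \<and>
           (\<forall>\<^sub>F t in at_top. sobolev_norm (real r) (\<psi> t) \<ge> C * t ^ r)"
  proof (intro exI conjI allI impI)
    show "0 < ?C" by simp
    show "half_wave_solution (real r) wave_potential ?\<psi>" by (rule half_wave_solution_of_lattice_flow[OF a])
    show "?\<psi> t \<in> sobolev (real r)" for t by (rule synth_in_sobolev[OF rapid_rotated[OF ra]])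
  qed
qed

end
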